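(* Let $\mathcal{P}_{\mathbb{Q}}$ be the class of finite-dimensional polyhedral normed spaces over $\mathbb{Q}$ (with $\mathbb{Q}$-valued norms), with linear isometric injections as embeddings, and let $\mathfrak{G}_{\mathbb{Q}}$ be its Fraïssé limit (the rational Gurarii space). Then: (1) $\mathcal{P}_{\mathbb{Q}}$ does not have the $1$-Hrushovski property; (2) the class $(\mathcal{P}_{\mathbb{Q}})_1$ of partial isometries does not have the weak amalgamation property; (3) the linear isometry group $\mathrm{Aut}(\mathfrak{G}_{\mathbb{Q}})$ does not have a comeager conjugacy class.
   Context: A finite-dimensional normed space $X$ over $\mathbb{Q}$ is polyhedral if there are finitely many $\mathbb{Q}$-linear functionals $u_1^*,\dots,u_n^*:X\to\mathbb{Q}$ with $\|x\|=\max_i|u_i^*(x)|$ for all $x\in X$ (equivalently, its closed unit ball is the absolutely convex hull, with rational coefficients, of finitely many points). $\mathcal{P}_{\mathbb{Q}}$ is closed under isometric isomorphism and is a Fraïssé class (hereditary, joint embedding and amalgamation, countably many isomorphism types); its Fraïssé limit $\mathfrak{G}_{\mathbb{Q}}$ is the unique (up to isometric isomorphism) countable normed $\mathbb{Q}$-space whose finite-dimensional subspaces are, up to isometry, exactly the members of $\mathcal{P}_{\mathbb{Q}}$, and which has the extension property: for $A\subseteq B$ in $\mathcal{P}_{\mathbb{Q}}$ and a linear isometric embedding $\alpha:A\to\mathfrak{G}_{\mathbb{Q}}$ there is a linear isometric embedding $\beta:B\to\mathfrak{G}_{\mathbb{Q}}$ extending $\alpha$. $\mathrm{Aut}(\mathfrak{G}_{\mathbb{Q}})$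 is the group of surjective linear isometries of $\mathfrak{G}_{\mathbb{Q}}$ with the topology of pointwise convergence ($\mathfrak{G}_{\mathbb{Q}}$ taken discrete); it is a Polish group, and a conjugacy class is an orbit of the action of the group on itself by conjugation. A class $\mathcal{K}$ has the $1$-Hrushovski property if for every $A\in\mathcal{K}$ and every partial automorphism $f$ of $A$ (an isomorphism between substructures of $A$, here a linear isometry between subspaces) there is $B\in\mathcal{K}$ with $A\subseteq B$ such that $f$ extends to an automorphism of $B$ (here a surjective linear isometry of $B$). $(\mathcal{P}_{\mathbb{Q}})_1$ consists of triples $(C,f:A\to B)$ with $C\in\mathcal{P}_{\mathbb{Q}}$, $A,B$ subspaces of $C$ and $f$ a surjective linear isometry from $A$ onto $B$; an embedding $(C,f:A\to B)\to(C',f':A'\to B')$ is a linear isometric injection $\alpha:C\to C'$ with $\alpha(A)\subseteq A'$ and $\alpha(f(a))=f'(\alpha(a))$ for all $a\in A$. A class $\mathcal{K}$ with embeddings has the weak amalgamation property (WAP) if for every $A\in\mathcal{K}$ there are $A'\in\mathcal{K}$ and an embedding $\phi:A\to A'$ such that for all $B,C\in\mathcal{K}$ and embeddings $\alpha:A'\to B$, $\beta:A'\to C$ there are $D\in\mathcal{K}$ and embeddings $\gamma:B\to D$, $\delta:C\to D$ with $\gamma\circ\alpha\circ\phi=\delta\circ\beta\circ\phi$. *)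

theory Defs
  imports
    "HOL-Analysis.Analysis"
    "HOL-Algebra.Group_Action"
    "HOL-Library.Function_Algebras"
begin

section \<open>Vector spaces over the rationals\<close>

text \<open>The analogue of \<^class>\<open>real_vector\<close> with rational scalars.\<close>

class rat_vector = ab_group_add +
  fixes scaleQ :: "rat \<Rightarrow> 'a \<Rightarrow> 'a" (infixr \<open>*\<^sub>Q\<close> 75)
  assumes scaleQ_add_right: "a *\<^sub>Q (x + y) = a *\<^sub>Q x + a *\<^sub>Q y"
    and scaleQ_add_left: "(a + b) *\<^sub>Q x = a *\<^sub>Q x + b *\<^sub>Q x"
    and scaleQ_scaleQ: "a *\<^sub>Q b *\<^sub>Q x = (a * b) *\<^sub>Q x"
    and scaleQ_one: "1 *\<^sub>Q x = x"

global_interpretation rat_vector: vector_space "scaleQ :: rat \<Rightarrow> 'a \<Rightarrow> 'a::rat_vector"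
  by unfold_locales (rule scaleQ_add_right scaleQ_add_left scaleQ_scaleQ scaleQ_one)+

global_interpretation rat_vector_pair: vector_space_pair
  "scaleQ :: rat \<Rightarrow> 'a \<Rightarrow> 'a::rat_vector" "scaleQ :: rat \<Rightarrow> 'b \<Rightarrow> 'b::rat_vector"
  by unfold_locales

instantiation rat :: rat_vector
begin
definition scaleQ_rat :: "rat \<Rightarrow> rat \<Rightarrow> rat" where "scaleQ_rat a x = a * x"
instance by standard (simp_all add: scaleQ_rat_def algebra_simps)
end

instantiation "fun" :: (type, rat_vector) rat_vector
begin
definition scaleQ_fun :: "rat \<Rightarrow> ('a \<Rightarrow> 'b) \<Rightarrow> 'a \<Rightarrow> 'b"
  where "scaleQ_fun a f = (\<lambda>i. a *\<^sub>Q f i)"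
instance
  by standard
    (simp_all add: scaleQ_fun_def fun_eq_iff scaleQ_add_right scaleQ_add_left
      scaleQ_scaleQ scaleQ_one)
end

definition rat_linear_on :: "'a::rat_vector set \<Rightarrow> ('a \<Rightarrow> 'b::rat_vector) \<Rightarrow> bool"
  where "rat_linear_on V f \<longleftrightarrow>
    (\<forall>x\<in>V. \<forall>y\<in>V. f (x + y) = f x + f y) \<and> (\<forall>c. \<forall>x\<in>V. f (c *\<^sub>Q x) = c *\<^sub>Q f x)"

definition rat_finite_dim :: "'a::rat_vector set \<Rightarrow> bool"
  where "rat_finite_dim V \<longleftrightarrow> (\<exists>B. finite B \<and> rat_vector.span B = V)"


section \<open>Normed spaces over the rationals\<close>

text \<open>
  A normed space is a linear subspace of an ambient rational vector space together with a
  norm on it; the values of the norm outside the carrier are irrelevant. All norms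
  considered here take rational values.
\<close>

record 'a rat_nspace = "'a partial_object" +
  nrm :: "'a \<Rightarrow> rat"

definition rat_normed_space :: "'a::rat_vector rat_nspace \<Rightarrow> bool"
  where "rat_normed_space X \<longleftrightarrow>
    rat_vector.subspace (carrier X) \<and>
    (\<forall>x\<in>carrier X. 0 \<le> nrm X x \<and> (nrm X x = 0 \<longleftrightarrow> x = 0)) \<and>
    (\<forall>x\<in>carrier X. \<forall>y\<in>carrier X. nrm X (x + y) \<le> nrm X x + nrm X y) \<and>
    (\<forall>c. \<forall>x\<in>carrier X. nrm X (c *\<^sub>Q x) = \<bar>c\<bar> * nrm X x)"

definition polyhedral_space :: "'a::rat_vector rat_nspace \<Rightarrow> bool"
  where "polyhedral_space X \<longleftrightarrow>
    rat_normed_space X \<and> rat_finite_dim (carrier X) \<and>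
    (\<exists>U :: ('a \<Rightarrow> rat) set. finite U \<and> U \<noteq> {} \<and> (\<forall>u\<in>U. rat_linear_on (carrier X) u) \<and>
       (\<forall>x\<in>carrier X. nrm X x = Max ((\<lambda>u. \<bar>u x\<bar>) ` U)))"

text \<open>\<open>sub_nspace A B\<close>: \<open>A\<close> is a subspace of \<open>B\<close> with the norm induced from \<open>B\<close>
  (for normed spaces \<open>A\<close> and \<open>B\<close> in the same ambient space).\<close>

definition sub_nspace :: "'a rat_nspace \<Rightarrow> 'a rat_nspace \<Rightarrow> bool"
  where "sub_nspace A B \<longleftrightarrow>
    carrier A \<subseteq> carrier B \<and> (\<forall>x\<in>carrier A. nrm A x = nrm B x)"

definition is_subspace_of :: "'a::rat_vector set \<Rightarrow> 'a rat_nspace \<Rightarrow> bool"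
  where "is_subspace_of V X \<longleftrightarrow> rat_vector.subspace V \<and> V \<subseteq> carrier X"

definition isometric_embedding ::
    "'a::rat_vector rat_nspace \<Rightarrow> 'b::rat_vector rat_nspace \<Rightarrow> ('a \<Rightarrow> 'b) \<Rightarrow> bool"
  where "isometric_embedding X Y f \<longleftrightarrow>
    f \<in> carrier X \<rightarrow> carrier Y \<and> rat_linear_on (carrier X) f \<and> inj_on f (carrier X) \<and>
    (\<forall>x\<in>carrier X. nrm Y (f x) = nrm X x)"

definition surj_isometry ::
    "'a::rat_vector rat_nspace \<Rightarrow> 'b::rat_vector rat_nspace \<Rightarrow> ('a \<Rightarrow> 'b) \<Rightarrow> bool"
  where "surj_isometry X Y f \<longleftrightarrow> isometric_embedding X Y f \<and> f ` carrier X = carrier Y"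

text \<open>\<open>A\<close> and \<open>B\<close> are subspaces of \<open>X\<close>, and \<open>f\<close> maps \<open>A\<close> linearly and isometrically
  onto \<open>B\<close>, both with the norm of \<open>X\<close>.\<close>

definition partial_isometry ::
    "'a::rat_vector rat_nspace \<Rightarrow> 'a set \<Rightarrow> 'a set \<Rightarrow> ('a \<Rightarrow> 'a) \<Rightarrow> bool"
  where "partial_isometry X A B f \<longleftrightarrow>
    is_subspace_of A X \<and> is_subspace_of B X \<and>
    surj_isometry (X\<lparr>carrier := A\<rparr>) (X\<lparr>carrier := B\<rparr>) f"


section \<open>The class of polyhedral spaces\<close>

text \<open>
  As the ambient space for the class we take the rational sequences. It is
  infinite-dimensional, so the class contains an isometric copy of every polyhedral space
  (\<open>polyhedral_space_has_copy\<close> below), and every member has isomorphic copies of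
  all its extensions as literal superspaces within the class.
\<close>

definition polyhedral_class :: "(nat \<Rightarrow> rat) rat_nspace set"
  where "polyhedral_class = {X. polyhedral_space X}"

definition one_hrushovski_property :: "'a::rat_vector rat_nspace set \<Rightarrow> bool"
  where "one_hrushovski_property K \<longleftrightarrow>
    (\<forall>A\<in>K. \<forall>V W f. partial_isometry A V W f \<longrightarrow>
      (\<exists>B\<in>K. sub_nspace A B \<and> (\<exists>g. surj_isometry B B g \<and> (\<forall>x\<in>V. g x = f x))))"

text \<open>
  A system \<open>(C, f : A \<rightarrow> B)\<close>. Values of the map outside its domain are irrelevant.
\<close>

record 'a isometry_system =
  sys_space :: "'a rat_nspace"
  sys_dom :: "'a set"
  sys_cod :: "'a set"
  sys_map :: "'a \<Rightarrow> 'a"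

definition isometry_systems :: "'a::rat_vector rat_nspace set \<Rightarrow> 'a isometry_system set"
  where "isometry_systems K =
    {S. sys_space S \<in> K \<and> partial_isometry (sys_space S) (sys_dom S) (sys_cod S) (sys_map S)}"

definition system_embedding ::
    "'a::rat_vector isometry_system \<Rightarrow> 'a isometry_system \<Rightarrow> ('a \<Rightarrow> 'a) \<Rightarrow> bool"
  where "system_embedding S T \<alpha> \<longleftrightarrow>
    isometric_embedding (sys_space S) (sys_space T) \<alpha> \<and>
    \<alpha> ` sys_dom S \<subseteq> sys_dom T \<and>
    (\<forall>a\<in>sys_dom S. \<alpha> (sys_map S a) = sys_map T (\<alpha> a))"

text \<open>
  \<open>emb A B f\<close> says that \<open>f\<close> is an embedding of \<open>A\<close> into \<open>B\<close>, and \<open>pts A\<close> is the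
  underlying set of \<open>A\<close>, on which embeddings with domain \<open>A\<close> are to be compared.
\<close>

definition weak_amalgamation_property ::
    "'o set \<Rightarrow> ('o \<Rightarrow> 'o \<Rightarrow> ('a \<Rightarrow> 'a) \<Rightarrow> bool) \<Rightarrow> ('o \<Rightarrow> 'a set) \<Rightarrow> bool"
  where "weak_amalgamation_property K emb pts \<longleftrightarrow>
    (\<forall>A\<in>K. \<exists>A'\<in>K. \<exists>\<phi>. emb A A' \<phi> \<and>
      (\<forall>B\<in>K. \<forall>C\<in>K. \<forall>\<alpha> \<beta>. emb A' B \<alpha> \<and> emb A' C \<beta> \<longrightarrow>
        (\<exists>D\<in>K. \<exists>\<gamma> \<delta>. emb B D \<gamma> \<and> emb C D \<delta> \<and>
          (\<forall>x\<in>pts A. (\<gamma> \<circ> \<alpha> \<circ> \<phi>) x = (\<delta> \<circ> \<beta> \<circ> \<phi>) x))))"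


section \<open>The rational Gurarii space and its isometry group\<close>

text \<open>
  The Fraisse limit of the class of polyhedral spaces, described by the properties that
  determine it up to isometric isomorphism.
\<close>

definition rational_gurarii_space :: "'g::rat_vector rat_nspace \<Rightarrow> bool"
  where "rational_gurarii_space G \<longleftrightarrow>
    rat_normed_space G \<and> countable (carrier G) \<and>
    (\<forall>V. is_subspace_of V G \<and> rat_finite_dim V \<longrightarrow>
      (\<exists>X\<in>polyhedral_class. \<exists>f. surj_isometry (G\<lparr>carrier := V\<rparr>) X f)) \<and>
    (\<forall>X\<in>polyhedral_class. \<exists>V. is_subspace_of V G \<and> rat_finite_dim V \<and>
      (\<exists>f. surj_isometry (G\<lparr>carrier := V\<rparr>) X f)) \<and>
    (\<forall>A\<in>polyhedral_class. \<forall>B\<in>polyhedral_class. \<forall>\<alpha>.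
      sub_nspace A B \<and> isometric_embedding A G \<alpha> \<longrightarrow>
      (\<exists>\<beta>. isometric_embedding B G \<beta> \<and> (\<forall>x\<in>carrier A. \<beta> x = \<alpha> x)))"

definition isometry_group :: "'g::rat_vector rat_nspace \<Rightarrow> ('g \<Rightarrow> 'g) monoid"
  where "isometry_group G =
    (BijGroup (carrier G))\<lparr>carrier := {g \<in> Bij (carrier G). surj_isometry G G g}\<rparr>"

definition isometry_group_topology :: "'g::rat_vector rat_nspace \<Rightarrow> ('g \<Rightarrow> 'g) topology"
  where "isometry_group_topology G =
    subtopology (product_topology (\<lambda>_. discrete_topology (carrier G)) (carrier G))
      (carrier (isometry_group G))"

definition conjugacy_class :: "('a, 'b) monoid_scheme \<Rightarrow> 'a \<Rightarrow> 'a set"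
  where "conjugacy_class \<G> x =
    orbit \<G> (\<lambda>g. \<lambda>h\<in>carrier \<G>. g \<otimes>\<^bsub>\<G>\<^esub> h \<otimes>\<^bsub>\<G>\<^esub> inv\<^bsub>\<G>\<^esub> g) x"

definition nowhere_dense_in :: "'a topology \<Rightarrow> 'a set \<Rightarrow> bool"
  where "nowhere_dense_in T S \<longleftrightarrow> S \<subseteq> topspace T \<and> T interior_of (T closure_of S) = {}"

definition meager_in :: "'a topology \<Rightarrow> 'a set \<Rightarrow> bool"
  where "meager_in T S \<longleftrightarrow> (\<exists>F. countable F \<and> (\<forall>N\<in>F. nowhere_dense_in T N) \<and> S = \<Union>F)"

definition comeager_in :: "'a topology \<Rightarrow> 'a set \<Rightarrow> bool"
  where "comeager_in T S \<longleftrightarrow> S \<subseteq> topspace T \<and> meager_in T (topspace T - S)"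


section \<open>Adequacy of the encoding\<close>

lemma isometry_group_subgroup:
  assumes "rat_normed_space G"
  shows "subgroup (carrier (isometry_group G)) (BijGroup (carrier G))"
proof -
  interpret B: group "BijGroup (carrier G)" by (rule group_BijGroup)
  let ?V = "carrier G" and ?I = "carrier (isometry_group G)"
  have I: "g \<in> ?I \<longleftrightarrow> g \<in> Bij ?V \<and> (\<forall>x\<in>?V. nrm G (g x) = nrm G x) \<and> rat_linear_on ?V g" for g
    by (auto simp: isometry_group_def surj_isometry_def isometric_embedding_def Bij_def bij_betw_def)
  have V: "x + y \<in> ?V" "c *\<^sub>Q x \<in> ?V" if "x \<in> ?V" "y \<in> ?V" for x y c
    using assms that
    by (auto simp: rat_normed_space_def intro: rat_vector.subspace_add rat_vector.subspace_scale)
  have bij: "g x \<in> ?V" "x \<in> ?V" if "g \<in> Bij ?V" "x \<in> ?V" for g x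
    using that Bij_imp_funcset[of g ?V] by auto
  show ?thesis
  proof (rule B.subgroupI)
    show "?I \<subseteq> carrier (BijGroup ?V)"
      by (auto simp: I BijGroup_def)
    have "(\<lambda>x\<in>?V. x) \<in> ?I"
      using V by (auto simp: I id_Bij rat_linear_on_def)
    then show "?I \<noteq> {}" by blast
  next
    fix g assume g: "g \<in> ?I"
    then have gB: "g \<in> Bij ?V" and b: "bij_betw g ?V ?V" by (auto simp: I Bij_def)
    have eq: "inv\<^bsub>BijGroup ?V\<^esub> g = (\<lambda>x\<in>?V. inv_into ?V g x)"
      using gB by (rule inv_BijGroup)
    let ?h = "inv_into ?V g"
    have h: "?h x \<in> ?V" "g (?h x) = x" if "x \<in> ?V" for x
      using b that by (auto simp: bij_betw_def inv_into_into f_inv_into_f)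
    have hg: "?h (g x) = x" if "x \<in> ?V" for x
      using b that by (auto simp: bij_betw_def)
    have "?h (x + y) = ?h x + ?h y" if "x \<in> ?V" "y \<in> ?V" for x y
    proof -
      have "g (?h x + ?h y) = x + y" using g h that by (simp add: I rat_linear_on_def)
      then show ?thesis using hg V h that by metis
    qed
    moreover have "?h (c *\<^sub>Q x) = c *\<^sub>Q ?h x" if "x \<in> ?V" for x c
    proof -
      have "g (c *\<^sub>Q ?h x) = c *\<^sub>Q x" using g h that by (simp add: I rat_linear_on_def)
      then show ?thesis using hg V h that by metis
    qed
    moreover have "nrm G (?h x) = nrm G x" if "x \<in> ?V" for x
      using g h that unfolding I by metis
    ultimately show "inv\<^bsub>BijGroup ?V\<^esub> g \<in> ?I"
      using V restrict_inv_into_Bij[OF gB] unfolding eq by (simp add: I rat_linear_on_def)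
  next
    fix g h assume "g \<in> ?I" "h \<in> ?I"
    then show "g \<otimes>\<^bsub>BijGroup ?V\<^esub> h \<in> ?I"
      using V bij by (simp add: I BijGroup_def rat_linear_on_def compose_Bij compose_eq)
  qed
qed

lemma group_isometry_group:
  assumes "rat_normed_space G"
  shows "group (isometry_group G)"
  using subgroup.subgroup_is_group[OF isometry_group_subgroup[OF assms] group_BijGroup]
  by (simp add: isometry_group_def)

lemma topspace_isometry_group_topology:
  "topspace (isometry_group_topology G) = carrier (isometry_group G)"
  by (auto simp: isometry_group_topology_def isometry_group_def Bij_def bij_betw_def PiE_def)

lemma polyhedral_space_has_copy:
  fixes X :: "'a::rat_vector rat_nspace"
  assumes X: "polyhedral_space X"
  shows "\<exists>Y\<in>polyhedral_class. \<exists>f. surj_isometry X Y f"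
proof -
  let ?V = "carrier X"
  obtain S where S: "finite S" "rat_vector.span S = ?V"
    using X by (auto simp: polyhedral_space_def rat_finite_dim_def)
  obtain B where B: "B \<subseteq> S" "rat_vector.independent B" "S \<subseteq> rat_vector.span B"
    using rat_vector.maximal_independent_subset by metis
  have fB: "finite B" using B S finite_subset by blast
  have sB: "rat_vector.span B = ?V"
    using B S by (metis rat_vector.span_mono rat_vector.span_span subset_antisym)
  define f :: "'a \<Rightarrow> nat \<Rightarrow> rat"
    where "f v = (\<lambda>n. rat_vector.representation B v (from_nat_into B n))" for v
  have V: "x + y \<in> ?V" "c *\<^sub>Q x \<in> ?V" if "x \<in> ?V" "y \<in> ?V" for x y c
    using that unfolding sB[symmetric]
    by (auto intro: rat_vector.span_add rat_vector.span_scale)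
  have add: "f (x + y) = f x + f y" if "x \<in> ?V" "y \<in> ?V" for x y
    using that B sB by (simp add: f_def rat_vector.representation_add fun_eq_iff)
  have scale: "f (c *\<^sub>Q x) = c *\<^sub>Q f x" if "x \<in> ?V" for x c
    using that B sB
    by (simp add: f_def rat_vector.representation_scale fun_eq_iff scaleQ_fun_def scaleQ_rat_def)
  have inj: "inj_on f ?V"
  proof (rule inj_onI)
    fix x y assume xy: "x \<in> ?V" "y \<in> ?V" "f x = f y"
    have "rat_vector.representation B x b = rat_vector.representation B y b" for b
    proof (cases "b \<in> B")
      case True
      then obtain n where "b = from_nat_into B n"
        using fB by (metis countable_finite from_nat_into_surj)
      then show ?thesis using xy(3) by (metis f_def)
    next
      case False
      then show ?thesis using rat_vector.representation_ne_zero by metis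
    qed
    then have "rat_vector.representation B x = rat_vector.representation B y" by blast
    then show "x = y"
      using rat_vector.sum_nonzero_representation_eq[OF B(2)] sB xy by metis
  qed
  define h where "h = inv_into ?V f"
  have h: "h (f x) = x" if "x \<in> ?V" for x using inj that by (simp add: h_def)
  define Y where "Y = \<lparr>carrier = f ` ?V, nrm = nrm X \<circ> h\<rparr>"
  have zero: "0 \<in> ?V" using sB rat_vector.span_zero by blast
  have f0: "f 0 = 0" using scale[OF zero, of 0] by simp
  have ff: "f x = 0 \<longleftrightarrow> x = 0" if "x \<in> ?V" for x
    using inj that zero f0 by (metis inj_onD)
  have fadd: "f x + f y = f (x + y)" if "x \<in> ?V" "y \<in> ?V" for x y using add that by simp
  have fscale: "c *\<^sub>Q f x = f (c *\<^sub>Q x)" if "x \<in> ?V" for x c using scale that by simp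
  have "rat_normed_space Y"
  proof -
    have "rat_vector.subspace (f ` ?V)"
      using V zero f0 fadd fscale by (auto simp: rat_vector.subspace_def image_iff)
    then show ?thesis
      using X V unfolding polyhedral_space_def rat_normed_space_def
      by (auto simp: Y_def h ff fadd fscale)
  qed
  moreover have "rat_finite_dim (f ` ?V)"
  proof -
    have "f ` rat_vector.span B \<subseteq> rat_vector.span (f ` B)"
    proof -
      let ?W = "{x \<in> ?V. f x \<in> rat_vector.span (f ` B)}"
      have "rat_vector.subspace ?W"
        unfolding rat_vector.subspace_def
      proof (intro conjI allI ballI)
        show "0 \<in> ?W" using zero rat_vector.span_zero by (metis (mono_tags) f0 mem_Collect_eq)
        show "x + y \<in> ?W" if "x \<in> ?W" "y \<in> ?W" for x y
          using that V by (simp add: add rat_vector.span_add)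
        show "c *\<^sub>Q x \<in> ?W" if "x \<in> ?W" for c x
          using that V(2)[of x x c] by (simp add: scale rat_vector.span_scale)
      qed
      moreover have "B \<subseteq> ?W"
        using sB rat_vector.span_superset[of B] by (auto intro: rat_vector.span_base)
      ultimately have "rat_vector.span B \<subseteq> ?W" by (intro rat_vector.span_minimal)
      then show ?thesis by blast
    qed
    moreover have "rat_vector.span (f ` B) \<subseteq> f ` ?V"
    proof (rule rat_vector.span_minimal)
      show "f ` B \<subseteq> f ` ?V" using sB rat_vector.span_superset by blast
      show "rat_vector.subspace (f ` ?V)"
        using \<open>rat_normed_space Y\<close> by (simp add: rat_normed_space_def Y_def)
    qed
    ultimately have "rat_vector.span (f ` B) = f ` ?V" unfolding sB by (intro subset_antisym)
    then show ?thesis using fB unfolding rat_finite_dim_def by blast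
  qed
  moreover obtain U :: "('a \<Rightarrow> rat) set" where U: "finite U" "U \<noteq> {}"
    "\<forall>u\<in>U. rat_linear_on ?V u" "\<forall>x\<in>?V. nrm X x = Max ((\<lambda>u. \<bar>u x\<bar>) ` U)"
    using X by (auto simp: polyhedral_space_def)
  have "polyhedral_space Y"
    unfolding polyhedral_space_def
  proof (intro conjI exI[of _ "(\<lambda>u. u \<circ> h) ` U"])
    show "\<forall>u\<in>(\<lambda>u. u \<circ> h) ` U. rat_linear_on (carrier Y) u"
      using U V by (auto simp: rat_linear_on_def Y_def h fadd fscale)
    show "\<forall>x\<in>carrier Y. nrm Y x = Max ((\<lambda>u. \<bar>u x\<bar>) ` (\<lambda>u. u \<circ> h) ` U)"
      using U by (simp add: Y_def h image_image)
  qed (use U calculation in \<open>auto simp: Y_def\<close>)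
  moreover have "surj_isometry X Y f"
    using inj by (auto simp: surj_isometry_def isometric_embedding_def rat_linear_on_def Y_def h add scale)
  ultimately show ?thesis by (auto simp: polyhedral_class_def)
qed

end

theory Submission
  imports Defs "HOL-Computational_Algebra.Polynomial"
begin

text \<open>
  Let \<open>v\<close>, \<open>f v\<close> span a plane with norm \<open>max \<bar>a + b\<bar> \<bar>a\<bar>\<close>. For a functional \<open>u\<close> of norm one and an
  isometry \<open>g\<close> extending \<open>f\<close>, the sequence \<open>u (g\<^sup>t v)\<close> stays equal to 1 backward in time once it is 1,
  while some \<open>u\<close> has \<open>u v = 1\<close> and \<open>u (g v) = 0\<close>. Such a sequence satisfies no linear recurrence, so \<open>v\<close>
  lies in no finite-dimensional invariant subspace.

  For any polyhedral space with a partial isometry \<open>f\<close>, the rational Hahn-Banach theorem extends \<open>f\<close>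
  and its inverse to contractions of a finite-dimensional \<open>\<ell>\<^sub>\<infinity>\<close> space, and the pair dilates to the shift on a
  space of sequences. There a fixed polynomial \<open>p\<close> in the shift turns every vector into a finitely supported
  sequence, so sums of widely spaced shifts of \<open>p v\<close> stay bounded. Adding a sequence of norm one made of many spaced
  copies of a finitely supported one gives a second extension in which these sums grow linearly. Hence no
  finite system determines the norm on the orbit of \<open>v\<close>, which refutes weak amalgamation. If a conjugacy
  class were comeager, the norm on the orbit of \<open>v\<close> would be constant on a dense subset of a nonempty open
  set by Baire's theorem, and ultrahomogeneity realises both extensions inside that set.
\<close>

section \<open>Extension of functionals over the rationals\<close>

text \<open>Members of the class are finite-dimensional with finitely many norming functionals, so a
  dilation can keep only finitely many shifts of \<open>X\<close>; yet its norm must be the supremum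
  over all integer times, or the shift would in general not be isometric. The supremum is attained
  in a bounded stretch because future and past come from two contractions: a combination observed
  after time 0 is a contraction of the ones observed at time 0, and similarly in the past. The two
  contractions need not be inverse to each other; they only have to agree with \<open>f\<close> and
  its inverse where these are defined. The same matrices supply \<open>p\<close>: each satisfies a
  monic recurrence, and the product of the two polynomials can fail to annihilate only near time 0,
  where the regimes meet. The wandering vector makes this defect nonzero. In the end
  \<open>p\<close> acts twice, once in the new row and once in the tested combination, so the growth
  is governed by \<open>p^2\<close>, nonzero on the orbit because no nonzero polynomial in the shift
  kills a finitely supported nonzero sequence.\<close>

text \<open>
  Points are elements of an arbitrary set \<open>Z\<close>; its linear structure enters only through the
  existence of points on which all the functionals take the values of \<open>y - c x\<close>.
\<close>

lemma farkas:
  fixes u :: "'i \<Rightarrow> 'p \<Rightarrow> rat" and k :: "'p \<Rightarrow> rat"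
  assumes "finite I"
    and "\<And>x y c. x \<in> Z \<Longrightarrow> y \<in> Z \<Longrightarrow>
      \<exists>w\<in>Z. (\<forall>i\<in>I. u i w = u i y - c * u i x) \<and> k w = k y - c * k x"
    and "\<And>z. z \<in> Z \<Longrightarrow> \<forall>i\<in>I. 0 \<le> u i z \<Longrightarrow> 0 \<le> k z"
  shows "\<exists>c. (\<forall>i\<in>I. 0 \<le> c i) \<and> (\<forall>z\<in>Z. k z = (\<Sum>i\<in>I. c i * u i z))"
  using assms
proof (induction I arbitrary: u k rule: finite_induct)
  case empty
  have "k z = 0" if z: "z \<in> Z" for z
  proof -
    \<comment> \<open>The factor 2 makes \<open>w\<close> stand in for \<open>-z\<close>, so
      nonnegativity of \<open>k\<close> at both points forces \<open>k z = 0\<close>.\<close>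
    obtain w where "w \<in> Z" "k w = k z - 2 * k z" using empty.prems(1)[OF z z] by blast
    then show ?thesis using empty.prems(2)[OF z] empty.prems(2)[of w] by force
  qed
  then show ?case by simp
next
  case (insert j I)
  show ?case
  proof (cases "\<forall>z\<in>Z. (\<forall>i\<in>I. 0 \<le> u i z) \<longrightarrow> 0 \<le> k z")
    case True
    have "\<exists>c. (\<forall>i\<in>I. 0 \<le> c i) \<and> (\<forall>z\<in>Z. k z = (\<Sum>i\<in>I. c i * u i z))"
    proof (rule insert.IH)
      show "\<exists>w\<in>Z. (\<forall>i\<in>I. u i w = u i y - c * u i x) \<and> k w = k y - c * k x"
        if "x \<in> Z" "y \<in> Z" for x y c
        using insert.prems(1)[OF that, of c] by auto
    qed (use True in blast)
    then obtain c where c: "\<forall>i\<in>I. 0 \<le> c i" "\<forall>z\<in>Z. k z = (\<Sum>i\<in>I. c i * u i z)" by blast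
    have eq: "(\<Sum>i\<in>I. (c(j := 0)) i * u i z) = (\<Sum>i\<in>I. c i * u i z)" for z
      using insert.hyps by (intro sum.cong) auto
    show ?thesis
      by (rule exI[of _ "c(j := 0)"]) (use c insert.hyps eq in auto)
  next
    case False
    then obtain x where x: "x \<in> Z" "\<And>i. i \<in> I \<Longrightarrow> 0 \<le> u i x" "k x < 0" by force
    have ujx: "u j x < 0" using insert.prems(2)[OF x(1)] x(2,3) by fastforce
    \<comment> \<open>\<open>u'\<close> and \<open>k'\<close> are \<open>u\<close> and
      \<open>k\<close> composed with the projection along \<open>x\<close> onto the kernel of
      \<open>u j\<close>: the point \<open>w = y - (u j y / u j x) x\<close> satisfies
      \<open>u j w = 0\<close>, \<open>u i w = u' i y\<close> and \<open>k w = k' y\<close>. This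
      eliminates \<open>u j\<close> before the induction hypothesis is applied.\<close>
    define u' where "u' = (\<lambda>i z. u i z - u i x / u j x * u j z)"
    define k' where "k' = (\<lambda>z. k z - k x / u j x * u j z)"
    have "\<exists>c. (\<forall>i\<in>I. 0 \<le> c i) \<and> (\<forall>z\<in>Z. k' z = (\<Sum>i\<in>I. c i * u' i z))"
    proof (rule insert.IH)
      show "\<exists>w\<in>Z. (\<forall>i\<in>I. u' i w = u' i b - c * u' i a) \<and> k' w = k' b - c * k' a"
        if ab: "a \<in> Z" "b \<in> Z" for a b c
      proof -
        obtain w where w: "w \<in> Z" "\<forall>i\<in>insert j I. u i w = u i b - c * u i a"
          "k w = k b - c * k a"
          using insert.prems(1)[OF ab, of c] by blast
        define d e where "d i = u i x / u j x" and "e = k x / u j x" for i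
        have D: "u' i z = u i z - d i * u j z" "k' z = k z - e * u j z" for i z
          by (simp_all add: u'_def k'_def d_def e_def)
        have W: "u i w = u i b - c * u i a" if "i \<in> insert j I" for i using w(2) that by blast
        show ?thesis
        proof (intro bexI[of _ w] conjI ballI)
          show "u' i w = u' i b - c * u' i a" if "i \<in> I" for i
            unfolding D using W[of i] W[of j] that by (simp add: right_diff_distrib)
          show "k' w = k' b - c * k' a"
            unfolding D using w(3) W[of j] by (simp add: right_diff_distrib)
        qed (rule w(1))
      qed
    next
      fix y assume y: "y \<in> Z" "\<forall>i\<in>I. 0 \<le> u' i y"
      obtain w where w: "w \<in> Z" "\<forall>i\<in>insert j I. u i w = u i y - u j y / u j x * u i x"
        "k w = k y - u j y / u j x * k x"
        using insert.prems(1)[OF x(1) y(1), of "u j y / u j x"] by blast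
      have "0 \<le> u i w" if "i \<in> insert j I" for i
        using that w(2) y(2) ujx by (auto simp: u'_def mult.commute)
      then show "0 \<le> k' y" using insert.prems(2)[OF w(1)] w(3) by (simp add: k'_def mult.commute)
    qed
    then obtain c where "\<forall>i\<in>I. 0 \<le> c i" "\<forall>z\<in>Z. k' z = (\<Sum>i\<in>I. c i * u' i z)" by blast
    then have c: "\<And>i. i \<in> I \<Longrightarrow> 0 \<le> c i"
      "\<And>z. z \<in> Z \<Longrightarrow> k' z = (\<Sum>i\<in>I. c i * u' i z)" by simp_all
    \<comment> \<open>Undoing the projection leaves \<open>a\<close> as the coefficient of
      \<open>u j\<close>; it is nonnegative because \<open>k x\<close> and \<open>u j x\<close> are
      negative while the \<open>u i x\<close> are not.\<close>
    define a where "a = k x / u j x - (\<Sum>i\<in>I. c i * (u i x / u j x))"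
    have "0 \<le> k x / u j x" using x(3) ujx by (simp add: divide_nonpos_nonpos)
    moreover have "(\<Sum>i\<in>I. c i * (u i x / u j x)) \<le> 0"
      using c(1) x(2) ujx
      by (intro sum_nonpos mult_nonneg_nonpos divide_nonneg_neg) auto
    ultimately have a: "0 \<le> a" by (simp add: a_def)
    have "k z = a * u j z + (\<Sum>i\<in>I. c i * u i z)" if "z \<in> Z" for z
    proof -
      have "(\<Sum>i\<in>I. c i * u' i z) = (\<Sum>i\<in>I. c i * u i z) - (\<Sum>i\<in>I. c i * (u i x / u j x)) * u j z"
        by (simp add: u'_def algebra_simps sum_subtractf sum_distrib_left sum_distrib_right)
      then show ?thesis using c(2)[OF that] by (simp add: k'_def a_def algebra_simps)
    qed
    moreover have "(\<Sum>i\<in>I. (c(j := a)) i * u i z) = (\<Sum>i\<in>I. c i * u i z)" for z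
      using insert.hyps by (intro sum.cong) auto
    ultimately show ?thesis
      using a c(1) insert.hyps by (intro exI[of _ "c(j := a)"]) auto
  qed
qed

text \<open>Rational Hahn-Banach in coordinates: on the image of \<open>Z\<close> under the
  \<open>u i\<close>, with the maximum norm, \<open>k\<close> is a contraction, and coefficients of
  absolute sum at most 1 extend it to the whole coordinate space. The certificate from
  \<open>farkas\<close> has total weight 1 because \<open>r\<close> occurs with coefficient 1 in
  \<open>r - k x\<close>, and that weight bounds the sum of the
  \<open>\<bar>l i\<bar>\<close>.\<close>

lemma functional_dominated_by_max:
  fixes u :: "'i \<Rightarrow> 'p \<Rightarrow> rat" and k :: "'p \<Rightarrow> rat"
  assumes I: "finite I" "I \<noteq> {}" and ne: "Z \<noteq> {}"
    and cl: "\<And>x y c. x \<in> Z \<Longrightarrow> y \<in> Z \<Longrightarrow>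
      \<exists>w\<in>Z. (\<forall>i\<in>I. u i w = u i y - c * u i x) \<and> k w = k y - c * k x"
    and dom: "\<And>z. z \<in> Z \<Longrightarrow> \<exists>i\<in>I. \<bar>k z\<bar> \<le> \<bar>u i z\<bar>"
  shows "\<exists>l. (\<Sum>i\<in>I. \<bar>l i\<bar>) \<le> 1 \<and> (\<forall>z\<in>Z. k z = (\<Sum>i\<in>I. l i * u i z))"
proof -
  \<comment> \<open>Homogenisation: \<open>r - k\<close> is nonnegative wherever all \<open>r \<plusminus> u i\<close> are.\<close>
  let ?U = "\<lambda>(i, s::bool) (x, r). r + (if s then u i x else - u i x)"
  have "\<exists>c. (\<forall>i\<in>I \<times> UNIV. 0 \<le> c i) \<and>
    (\<forall>z\<in>Z \<times> UNIV. (\<lambda>(x, r). r - k x) z = (\<Sum>i\<in>I \<times> UNIV. c i * ?U i z))"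
  proof (rule farkas)
    fix p p' :: "'p \<times> rat" and c assume "p \<in> Z \<times> UNIV" "p' \<in> Z \<times> UNIV"
    then obtain x r y s where p: "p = (x, r)" "p' = (y, s)" "x \<in> Z" "y \<in> Z" by auto
    obtain w where w: "w \<in> Z" "\<forall>i\<in>I. u i w = u i y - c * u i x" "k w = k y - c * k x"
      using cl[OF p(3,4)] by blast
    show "\<exists>w\<in>Z \<times> UNIV. (\<forall>i\<in>I \<times> UNIV. ?U i w = ?U i p' - c * ?U i p) \<and>
        (case w of (x, r) \<Rightarrow> r - k x) = (case p' of (x, r) \<Rightarrow> r - k x) - c * (case p of (x, r) \<Rightarrow> r - k x)"
      by (rule bexI[of _ "(w, s - c * r)"]) (use w p in \<open>auto simp: algebra_simps\<close>)
  next
    fix p :: "'p \<times> rat" assume "p \<in> Z \<times> UNIV" and pos: "\<forall>i\<in>I \<times> UNIV. 0 \<le> ?U i p"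
    then obtain x r where p: "p = (x, r)" "x \<in> Z" by auto
    obtain i where i: "i \<in> I" "\<bar>k x\<bar> \<le> \<bar>u i x\<bar>" using dom[OF p(2)] by blast
    have "0 \<le> r + u i x" "0 \<le> r - u i x"
      using bspec[OF pos, of "(i, True)"] bspec[OF pos, of "(i, False)"] i p by auto
    then show "0 \<le> (case p of (x, r) \<Rightarrow> r - k x)" using i p by auto
  qed (use I in auto)
  then obtain c where c0: "\<forall>i\<in>I \<times> UNIV. 0 \<le> c i"
    and eq1: "\<forall>z\<in>Z \<times> UNIV. (\<lambda>(x, r). r - k x) z = (\<Sum>i\<in>I \<times> UNIV. c i * ?U i z)" by blast
  have c: "0 \<le> c (i, s)" if "i \<in> I" for i s using c0 that by blast
  have eq0: "r - k x = (\<Sum>i\<in>I \<times> UNIV. c i * ?U i (x, r))" if "x \<in> Z" for x r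
    using bspec[OF eq1, of "(x, r)"] that by simp
  have eq: "r - k x = (\<Sum>i\<in>I. (c (i, True) + c (i, False)) * r + (c (i, True) - c (i, False)) * u i x)"
    if "x \<in> Z" for x r
  proof -
    have "(\<Sum>i\<in>I \<times> UNIV. c i * ?U i (x, r)) = (\<Sum>i\<in>I. \<Sum>s\<in>UNIV. c (i, s) * ?U (i, s) (x, r))"
      unfolding sum.cartesian_product by (intro sum.cong) auto
    also have "\<dots> = (\<Sum>i\<in>I. (c (i, True) + c (i, False)) * r + (c (i, True) - c (i, False)) * u i x)"
      by (intro sum.cong) (auto simp: UNIV_bool algebra_simps)
    finally show ?thesis by (simp add: eq0[OF that])
  qed
  define a where "a = (\<Sum>i\<in>I. c (i, True) + c (i, False))"
  define l where "l = (\<lambda>i. c (i, False) - c (i, True))"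
  have eq': "r - k x = a * r - (\<Sum>i\<in>I. l i * u i x)" if "x \<in> Z" for x r
    unfolding eq[OF that] a_def l_def
    by (simp add: sum.distrib sum_distrib_left sum_subtractf algebra_simps)
  obtain x where x: "x \<in> Z" using ne by blast
  have "a = 1" using eq'[OF x, of 0] eq'[OF x, of 1] by simp
  moreover have "(\<Sum>i\<in>I. \<bar>l i\<bar>) \<le> a"
    unfolding a_def l_def
  proof (rule sum_mono)
    show "\<bar>c (i, False) - c (i, True)\<bar> \<le> c (i, True) + c (i, False)" if "i \<in> I" for i
      using c[OF that, of True] c[OF that, of False] by linarith
  qed
  moreover have "k z = (\<Sum>i\<in>I. l i * u i z)" if "z \<in> Z" for z using eq'[OF that, of 0] by simp
  ultimately show ?thesis by metis
qed

section \<open>Linear recurrences\<close>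

lemma span_image_lessThan:
  fixes a :: "nat \<Rightarrow> 'a::rat_vector"
  assumes "x \<in> rat_vector.span (a ` {..<n})"
  shows "\<exists>c. x = (\<Sum>j<n. c j *\<^sub>Q a j)"
proof -
  let ?W = "{x. \<exists>c. x = (\<Sum>j<n. c j *\<^sub>Q a j)}"
  have "rat_vector.subspace ?W"
    unfolding rat_vector.subspace_def
  proof (intro conjI ballI allI)
    show "0 \<in> ?W" by (auto intro!: exI[of _ "\<lambda>_. 0"])
    show "x + y \<in> ?W" if xy: "x \<in> ?W" "y \<in> ?W" for x y
    proof -
      from xy obtain c d where "x = (\<Sum>j<n. c j *\<^sub>Q a j)" "y = (\<Sum>j<n. d j *\<^sub>Q a j)" by auto
      then have "x + y = (\<Sum>j<n. (c j + d j) *\<^sub>Q a j)"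
        by (simp add: scaleQ_add_left sum.distrib)
      then show ?thesis by (intro CollectI exI)
    qed
    show "b *\<^sub>Q x \<in> ?W" if x: "x \<in> ?W" for b x
    proof -
      from x obtain c where "x = (\<Sum>j<n. c j *\<^sub>Q a j)" by auto
      then have "b *\<^sub>Q x = (\<Sum>j<n. (b * c j) *\<^sub>Q a j)"
        by (simp add: rat_vector.scale_sum_right scaleQ_scaleQ)
      then show ?thesis by (intro CollectI exI)
    qed
  qed
  moreover have "a ` {..<n} \<subseteq> ?W"
  proof
    fix y assume "y \<in> a ` {..<n}"
    then obtain i where i: "i < n" "y = a i" by auto
    have "(\<Sum>j<n. (if j = i then 1 else 0) *\<^sub>Q a j) = (\<Sum>j<n. if j = i then a j else 0)"
      by (intro sum.cong) (auto simp: scaleQ_one)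
    then have "y = (\<Sum>j<n. (if j = i then 1 else 0) *\<^sub>Q a j)"
      using i by (simp add: sum.delta')
    then show "y \<in> ?W" by (intro CollectI exI)
  qed
  ultimately show ?thesis using assms rat_vector.span_minimal by blast
qed

text \<open>More than \<open>card B\<close> terms cannot be independent, and the first term
  dependent on its predecessors has coefficient 1 in the relation. This monic form is what later
  makes the annihilating polynomials nonzero.\<close>

lemma linear_recurrence:
  fixes a :: "nat \<Rightarrow> 'a::rat_vector"
  assumes B: "finite B" and a: "\<And>i. a i \<in> rat_vector.span B"
  shows "\<exists>n c. a n = (\<Sum>j<n. c j *\<^sub>Q a j)"
proof -
  have "\<exists>n. a n \<in> rat_vector.span (a ` {..<n})"
  proof (rule ccontr)
    assume *: "\<nexists>n. a n \<in> rat_vector.span (a ` {..<n})"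
    have "rat_vector.independent (a ` {..<n}) \<and> card (a ` {..<n}) = n" for n
    proof (induction n)
      case 0
      then show ?case by (simp add: rat_vector.independent_empty)
    next
      case (Suc n)
      have "a n \<notin> rat_vector.span (a ` {..<n})" using * by simp
      moreover from this have "a n \<notin> a ` {..<n}" using rat_vector.span_base[of "a n" "a ` {..<n}"] by auto
      ultimately show ?case
        using Suc by (simp add: lessThan_Suc rat_vector.independent_insert)
    qed
    note ind = this[of "Suc (card B)"]
    have "a ` {..<Suc (card B)} \<subseteq> rat_vector.span B" using a by blast
    then show False
      using rat_vector.independent_span_bound[OF B, of "a ` {..<Suc (card B)}"] ind by simp
  qed
  then show ?thesis using span_image_lessThan by blast
qed

section \<open>Polynomials in the shift, acting on two-sided sequences\<close>

definition poly_shift :: "rat poly \<Rightarrow> (int \<Rightarrow> rat) \<Rightarrow> int \<Rightarrow> rat"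
  where "poly_shift p s t = (\<Sum>j\<le>degree p. coeff p j * s (t + int j))"

lemma poly_shift_altdef:
  assumes "degree p \<le> n"
  shows "poly_shift p s t = (\<Sum>j\<le>n. coeff p j * s (t + int j))"
  unfolding poly_shift_def
  using assms by (intro sum.mono_neutral_left) (auto simp: coeff_eq_0)

lemma poly_shift_0 [simp]: "poly_shift 0 s t = 0"
  by (simp add: poly_shift_def)

lemma poly_shift_pCons: "poly_shift (pCons a p) s t = a * s t + poly_shift p s (t + 1)"
proof -
  have "poly_shift (pCons a p) s t = (\<Sum>j\<le>Suc (degree p). coeff (pCons a p) j * s (t + int j))"
    by (rule poly_shift_altdef) (simp add: degree_pCons_le)
  also have "\<dots> = a * s t + (\<Sum>j\<le>degree p. coeff p j * s (t + 1 + int j))"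
    by (subst sum.atMost_Suc_shift) (simp add: algebra_simps)
  finally show ?thesis by (simp add: poly_shift_def)
qed

lemma poly_shift_1: "poly_shift 1 s t = s t"
  by (simp add: one_pCons poly_shift_pCons)

lemma poly_shift_add: "poly_shift (p + q) s t = poly_shift p s t + poly_shift q s t"
proof -
  let ?n = "max (degree p) (degree q)"
  have "degree (p + q) \<le> ?n" by (rule degree_add_le_max)
  then show ?thesis
    by (simp add: poly_shift_altdef[of _ ?n] algebra_simps sum.distrib)
qed

lemma poly_shift_smult: "poly_shift (smult a p) s t = a * poly_shift p s t"
  by (subst poly_shift_altdef[of _ "degree p"])
    (simp_all add: degree_smult_le poly_shift_def sum_distrib_left mult.assoc)

lemma poly_shift_mult: "poly_shift (p * q) s t = poly_shift p (poly_shift q s) t"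
  by (induction p arbitrary: t)
    (simp_all add: poly_shift_pCons poly_shift_add poly_shift_smult)

lemma poly_shift_sum: "poly_shift (\<Sum>i\<in>I. p i) s t = (\<Sum>i\<in>I. poly_shift (p i) s t)"
  by (induction I rule: infinite_finite_induct) (simp_all add: poly_shift_add)

lemma poly_shift_monom: "poly_shift (monom a n) s t = a * s (t + int n)"
proof -
  have "poly_shift (monom a n) s t = (\<Sum>j\<le>n. coeff (monom a n) j * s (t + int j))"
    by (rule poly_shift_altdef) (rule degree_monom_le)
  also have "\<dots> = (\<Sum>j\<le>n. if n = j then a * s (t + int j) else 0)"
    by (intro sum.cong) auto
  finally show ?thesis by simp
qed

lemma poly_shift_sum_seq: "poly_shift p (\<lambda>t. \<Sum>i\<in>I. s i t) t = (\<Sum>i\<in>I. poly_shift p (s i) t)"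
  unfolding poly_shift_def sum_distrib_left by (rule sum.swap)

lemma poly_shift_mult_seq: "poly_shift p (\<lambda>t. c * s t) t = c * poly_shift p s t"
  unfolding poly_shift_def sum_distrib_left by (simp add: algebra_simps)

lemma poly_shift_translate: "poly_shift p (\<lambda>t. s (t + k)) t = poly_shift p s (t + k)"
  unfolding poly_shift_def by (simp add: algebra_simps)

text \<open>The last nonzero entry \<open>s t1\<close> meets the lowest nonzero coefficient
  \<open>coeff p j\<close> at time \<open>t1 - j\<close>, and no other product survives
  there.\<close>

lemma poly_shift_nonzero:
  assumes p: "p \<noteq> 0" and s: "\<And>t. t > b \<Longrightarrow> s t = 0" and "s t0 \<noteq> 0"
  shows "\<exists>t. poly_shift p s t \<noteq> 0"
proof -
  have "\<exists>n. s (b - int n) \<noteq> 0"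
    using assms(3) s[of t0] by (intro exI[of _ "nat (b - t0)"]) (cases "t0 > b"; simp)
  then obtain n where n: "s (b - int n) \<noteq> 0" "\<And>k. k < n \<Longrightarrow> s (b - int k) = 0"
    using exists_least_iff[of "\<lambda>n. s (b - int n) \<noteq> 0"] by blast
  define t1 where "t1 = b - int n"
  have t1: "s t1 \<noteq> 0" using n by (simp add: t1_def)
  have after: "s t = 0" if "t > t1" for t
  proof (cases "t > b")
    case False
    then have "s (b - int (nat (b - t))) = 0" using that by (intro n(2)) (simp add: t1_def)
    then show ?thesis using False by simp
  qed (use s in blast)
  have "\<exists>j. coeff p j \<noteq> 0" using p leading_coeff_0_iff by blast
  then obtain j where j: "coeff p j \<noteq> 0" "\<And>k. k < j \<Longrightarrow> coeff p k = 0"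
    using exists_least_iff[of "\<lambda>j. coeff p j \<noteq> 0"] by blast
  have "poly_shift p s (t1 - int j) = (\<Sum>k\<le>degree p. if k = j then coeff p j * s t1 else 0)"
    unfolding poly_shift_def
  proof (rule sum.cong)
    show "coeff p k * s (t1 - int j + int k) = (if k = j then coeff p j * s t1 else 0)" for k
      using j(2)[of k] after[of "t1 - int j + int k"] by (cases k j rule: linorder_cases) auto
  qed simp
  also have "\<dots> = coeff p j * s t1" using le_degree[OF j(1)] by simp
  finally show ?thesis using j(1) t1 by (metis mult_eq_0_iff)
qed

section \<open>Contractive kernels and trajectories\<close>

text \<open>A point \<open>x\<close> will enter only through its coordinates
  \<open>\<lambda>r. r x\<close> at the norming functionals \<open>r\<close> in \<open>U\<close>.
  The matrix \<open>l\<close> acts on this coordinate space, where Hahn-Banach extends a partial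
  isometry to a contraction row by row.\<close>

definition kernel_op :: "'u set \<Rightarrow> ('u \<Rightarrow> 'u \<Rightarrow> rat) \<Rightarrow> ('u \<Rightarrow> rat) \<Rightarrow> 'u \<Rightarrow> rat"
  where "kernel_op U l \<phi> q = (\<Sum>r\<in>U. l q r * \<phi> r)"

lemma kernel_op_pow_Suc:
  "(kernel_op U l ^^ Suc n) \<phi> q = (\<Sum>r\<in>U. l q r * (kernel_op U l ^^ n) \<phi> r)"
  unfolding funpow.simps comp_apply by (subst kernel_op_def) (rule refl)

lemma kernel_op_pow_cong:
  assumes "\<And>r. r \<in> U \<Longrightarrow> \<phi> r = \<psi> r" and "q \<in> U"
  shows "(kernel_op U l ^^ n) \<phi> q = (kernel_op U l ^^ n) \<psi> q"
  using assms(2) by (induction n arbitrary: q) (simp_all add: kernel_op_pow_Suc assms(1) del: funpow.simps(2))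

lemma kernel_op_pow_sum:
  "(kernel_op U l ^^ n) (\<lambda>r. \<Sum>i\<in>I. c i * \<phi> i r) q = (\<Sum>i\<in>I. c i * (kernel_op U l ^^ n) (\<phi> i) q)"
proof (induction n arbitrary: q)
  case (Suc n)
  have "(kernel_op U l ^^ Suc n) (\<lambda>r. \<Sum>i\<in>I. c i * \<phi> i r) q
      = (\<Sum>r\<in>U. \<Sum>i\<in>I. c i * (l q r * (kernel_op U l ^^ n) (\<phi> i) r))"
    unfolding kernel_op_pow_Suc Suc.IH by (simp add: sum_distrib_left mult.left_commute)
  also have "\<dots> = (\<Sum>i\<in>I. \<Sum>r\<in>U. c i * (l q r * (kernel_op U l ^^ n) (\<phi> i) r))"
    by (rule sum.swap)
  finally show ?case unfolding kernel_op_pow_Suc by (simp add: sum_distrib_left)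
qed simp

text \<open>Rows of absolute sum at most 1 never increase the maximum. The conclusion names an index
  instead of the maximum because the window hypothesis of \<open>polyhedral_dilation\<close> asks
  for one.\<close>

lemma kernel_op_pow_le:
  assumes U: "finite U" and l: "\<And>q. q \<in> U \<Longrightarrow> (\<Sum>r\<in>U. \<bar>l q r\<bar>) \<le> 1" and q: "q \<in> U"
  shows "\<exists>r\<in>U. \<bar>(kernel_op U l ^^ n) \<phi> q\<bar> \<le> \<bar>\<phi> r\<bar>"
proof -
  let ?M = "Max ((\<lambda>r. \<bar>\<phi> r\<bar>) ` U)"
  have M: "\<bar>\<phi> r\<bar> \<le> ?M" if "r \<in> U" for r using U that by simp
  have M0: "0 \<le> ?M" using M[OF q] by linarith
  have "\<bar>(kernel_op U l ^^ n) \<phi> q\<bar> \<le> ?M" using q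
  proof (induction n arbitrary: q)
    case (Suc n)
    have "\<bar>(kernel_op U l ^^ Suc n) \<phi> q\<bar> \<le> (\<Sum>r\<in>U. \<bar>l q r * (kernel_op U l ^^ n) \<phi> r\<bar>)"
      unfolding kernel_op_pow_Suc by (rule sum_abs)
    also have "\<dots> \<le> (\<Sum>r\<in>U. \<bar>l q r\<bar> * ?M)"
      unfolding abs_mult by (intro sum_mono mult_left_mono Suc.IH) auto
    also have "\<dots> = (\<Sum>r\<in>U. \<bar>l q r\<bar>) * ?M" by (simp add: sum_distrib_right)
    also have "\<dots> \<le> 1 * ?M" using l[OF Suc.prems] M0 by (rule mult_right_mono)
    finally show ?case by simp
  qed (use M in simp)
  moreover have "?M \<in> (\<lambda>r. \<bar>\<phi> r\<bar>) ` U" using U q by (intro Max_in) auto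
  ultimately show ?thesis by auto
qed

text \<open>A substitute for Cayley-Hamilton: the powers of the matrix lie in the span of finitely
  many unit matrices, so one recurrence holds for them, and hence for all \<open>\<phi>\<close> and
  \<open>q\<close> at once.\<close>

lemma kernel_op_recurrence:
  assumes U: "finite U"
  shows "\<exists>n c. \<forall>\<phi>. \<forall>q\<in>U. (kernel_op U l ^^ n) \<phi> q = (\<Sum>j<n. c j * (kernel_op U l ^^ j) \<phi> q)"
proof -
  let ?d = "\<lambda>r s. if s = r then 1 else 0 :: rat"
  \<comment> \<open>Entry \<open>(q, r)\<close> of the \<open>n\<close>-th power, read off at the
    unit vector at \<open>r\<close>. The value 0 outside \<open>U\<close> keeps every power in the
    span of finitely many unit matrices.\<close>
  define a :: "nat \<Rightarrow> 'a \<times> 'a \<Rightarrow> rat"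
    where "a n = (\<lambda>(q, r). if q \<in> U \<and> r \<in> U then (kernel_op U l ^^ n) (?d r) q else 0)" for n
  have mem: "a n \<in> rat_vector.span (?d ` (U \<times> U))" for n
  proof -
    have "a n = (\<Sum>p\<in>U \<times> U. a n p *\<^sub>Q ?d p)"
    proof
      fix p
      have sum_app: "(\<Sum>i\<in>I. F i) p = (\<Sum>i\<in>I. F i p)" for I and F :: "'a \<times> 'a \<Rightarrow> 'a \<times> 'a \<Rightarrow> rat"
        by (induction I rule: infinite_finite_induct) auto
      have "(\<Sum>p'\<in>U \<times> U. a n p' *\<^sub>Q ?d p') p = (\<Sum>p'\<in>U \<times> U. if p = p' then a n p' else 0)"
        unfolding sum_app by (intro sum.cong) (auto simp: scaleQ_fun_def scaleQ_rat_def)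
      also have "\<dots> = a n p" using U by (auto simp: a_def split: prod.splits)
      finally show "a n p = (\<Sum>p'\<in>U \<times> U. a n p' *\<^sub>Q ?d p') p" by simp
    qed
    also have "\<dots> \<in> rat_vector.span (?d ` (U \<times> U))"
      by (intro rat_vector.span_sum rat_vector.span_scale rat_vector.span_base) auto
    finally show ?thesis .
  qed
  obtain n c where nc: "a n = (\<Sum>j<n. c j *\<^sub>Q a j)"
    using linear_recurrence[of "?d ` (U \<times> U)" a] mem U by auto
  have sum_app: "(\<Sum>i\<in>I. F i) p = (\<Sum>i\<in>I. F i p)" for I p and F :: "nat \<Rightarrow> 'a \<times> 'a \<Rightarrow> rat"
    by (induction I rule: infinite_finite_induct) auto
  have base: "(kernel_op U l ^^ n) (?d r) q = (\<Sum>j<n. c j * (kernel_op U l ^^ j) (?d r) q)"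
    if "q \<in> U" "r \<in> U" for q r
    using fun_cong[OF nc, of "(q, r)"] that
    by (simp add: sum_app a_def scaleQ_fun_def scaleQ_rat_def)
  have expand: "(kernel_op U l ^^ k) \<phi> q = (\<Sum>r\<in>U. \<phi> r * (kernel_op U l ^^ k) (?d r) q)"
    if "q \<in> U" for k \<phi> q
  proof -
    have "(kernel_op U l ^^ k) \<phi> q = (kernel_op U l ^^ k) (\<lambda>s. \<Sum>r\<in>U. \<phi> r * ?d r s) q"
    proof (rule kernel_op_pow_cong)
      show "\<phi> s = (\<Sum>r\<in>U. \<phi> r * ?d r s)" if "s \<in> U" for s
      proof -
        have "(\<Sum>r\<in>U. \<phi> r * ?d r s) = (\<Sum>r\<in>U. if s = r then \<phi> r else 0)"
          by (intro sum.cong) auto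
        then show ?thesis using U that by simp
      qed
    qed (rule that)
    then show ?thesis by (simp add: kernel_op_pow_sum)
  qed
  have "(kernel_op U l ^^ n) \<phi> q = (\<Sum>j<n. c j * (kernel_op U l ^^ j) \<phi> q)" if q: "q \<in> U" for \<phi> q
  proof -
    have "(kernel_op U l ^^ n) \<phi> q = (\<Sum>r\<in>U. \<Sum>j<n. c j * (\<phi> r * (kernel_op U l ^^ j) (?d r) q))"
      unfolding expand[OF q, of n \<phi>]
      by (intro sum.cong) (simp_all add: base[OF q] sum_distrib_left mult.left_commute)
    also have "\<dots> = (\<Sum>j<n. \<Sum>r\<in>U. c j * (\<phi> r * (kernel_op U l ^^ j) (?d r) q))"
      by (rule sum.swap)
    finally show ?thesis unfolding expand[OF q, of _ \<phi>] by (simp add: sum_distrib_left)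
  qed
  then show ?thesis by blast
qed

text \<open>
  Going forward in time a functional is propagated by the kernel \<open>l\<close>, going backward by \<open>l'\<close>; the
  two kernels are contractive extensions of a partial isometry and of its inverse.
\<close>

definition trajectory ::
    "'u set \<Rightarrow> ('u \<Rightarrow> 'u \<Rightarrow> rat) \<Rightarrow> ('u \<Rightarrow> 'u \<Rightarrow> rat) \<Rightarrow> 'u \<Rightarrow> int \<Rightarrow> ('u \<Rightarrow> rat) \<Rightarrow> rat"
  where "trajectory U l l' q t \<phi> =
    (if 0 \<le> t then (kernel_op U l ^^ nat t) \<phi> q else (kernel_op U l' ^^ nat (- t)) \<phi> q)"

lemma trajectory_nonpos:
  "t \<le> 0 \<Longrightarrow> trajectory U l l' q t \<phi> = (kernel_op U l' ^^ nat (- t)) \<phi> q"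
  by (cases "t = 0") (simp_all add: trajectory_def)

text \<open>Forward times obey the recurrence of \<open>l\<close>, backward times that of
  \<open>l'\<close> read in reverse, and since polynomials in the shift commute, the product of the
  two kills both. The times that escape lie strictly between \<open>-d\<close> and 0, where both
  regimes are involved. Everything depends on the kernels alone, so one \<open>p\<close> and one
  \<open>d\<close> serve all \<open>q\<close> and \<open>\<phi>\<close>.\<close>

lemma trajectory_annihilator:
  assumes U: "finite U"
  shows "\<exists>p d. p \<noteq> 0 \<and> (\<forall>q\<in>U. \<forall>\<phi> t. 0 \<le> t \<or> t \<le> - int d \<longrightarrow>
    poly_shift p (\<lambda>t. trajectory U l l' q t \<phi>) t = 0)"
proof -
  let ?e = "\<lambda>q \<phi> t. trajectory U l l' q t \<phi>"
  obtain n c where nc: "\<And>\<phi> q. q \<in> U \<Longrightarrow>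
      (kernel_op U l ^^ n) \<phi> q = (\<Sum>j<n. c j * (kernel_op U l ^^ j) \<phi> q)"
    using kernel_op_recurrence[OF U, of l] by blast
  obtain n' c' where nc': "\<And>\<phi> q. q \<in> U \<Longrightarrow>
      (kernel_op U l' ^^ n') \<phi> q = (\<Sum>j<n'. c' j * (kernel_op U l' ^^ j) \<phi> q)"
    using kernel_op_recurrence[OF U, of l'] by blast
  define A where "A = monom 1 n + (\<Sum>j<n. monom (- c j) j)"
  \<comment> \<open>Time runs backward under \<open>l'\<close>, so its coefficients appear in
    reversed order and the coefficient 1 ends up in the constant term.\<close>
  define B where "B = monom 1 0 + (\<Sum>j<n'. monom (- c' j) (n' - j))"
  have "coeff A n = 1" by (simp add: A_def coeff_sum)
  then have A0: "A \<noteq> 0" by auto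
  have "coeff B 0 = 1" by (simp add: B_def coeff_sum)
  then have B0: "B \<noteq> 0" by auto
  have A: "poly_shift A (?e q \<phi>) t = 0" if q: "q \<in> U" and t: "0 \<le> t" for q \<phi> t
  proof -
    have e: "?e q \<phi> (t + int j) = (kernel_op U l ^^ j) ((kernel_op U l ^^ nat t) \<phi>) q" for j
    proof -
      have "nat (t + int j) = j + nat t" using t by simp
      then show ?thesis using t by (simp add: trajectory_def funpow_add)
    qed
    show ?thesis
      by (simp add: A_def poly_shift_add poly_shift_sum poly_shift_monom e nc[OF q] sum_negf)
  qed
  have B: "poly_shift B (?e q \<phi>) t = 0" if q: "q \<in> U" and t: "t \<le> - int n'" for q \<phi> t
  proof -
    define \<psi> where "\<psi> = (kernel_op U l' ^^ nat (- t - int n')) \<phi>"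
    have e: "?e q \<phi> (t + int (n' - j)) = (kernel_op U l' ^^ j) \<psi> q" if "j \<le> n'" for j
    proof -
      have "nat (- (t + int (n' - j))) = j + nat (- t - int n')" using t that by simp
      then show ?thesis
        using t that by (subst trajectory_nonpos) (simp_all add: funpow_add \<psi>_def)
    qed
    have "poly_shift B (?e q \<phi>) t = ?e q \<phi> (t + int (n' - n')) - (\<Sum>j<n'. c' j * ?e q \<phi> (t + int (n' - j)))"
      by (simp add: B_def poly_shift_add poly_shift_sum poly_shift_1 poly_shift_monom sum_negf)
    also have "(\<Sum>j<n'. c' j * ?e q \<phi> (t + int (n' - j))) = (\<Sum>j<n'. c' j * (kernel_op U l' ^^ j) \<psi> q)"
      using e by (intro sum.cong) simp_all
    also have "?e q \<phi> (t + int (n' - n')) = (\<Sum>j<n'. c' j * (kernel_op U l' ^^ j) \<psi> q)"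
      using e[of n'] nc'[OF q] by simp
    also have "\<dots> - \<dots> = 0" by simp
    finally show ?thesis .
  qed
  have "poly_shift (A * B) (?e q \<phi>) t = 0"
    if q: "q \<in> U" and t: "0 \<le> t \<or> t \<le> - int (n' + degree A)" for q \<phi> t
    using t
  proof
    assume "0 \<le> t"
    then have "poly_shift B (poly_shift A (?e q \<phi>)) t = 0"
      by (subst poly_shift_def) (simp add: A[OF q])
    then show ?thesis by (metis mult.commute poly_shift_mult)
  next
    assume "t \<le> - int (n' + degree A)"
    then have "poly_shift A (poly_shift B (?e q \<phi>)) t = 0"
      by (subst poly_shift_def) (simp add: B[OF q])
    then show ?thesis by (simp add: poly_shift_mult)
  qed
  then show ?thesis using A0 B0
    by (intro exI[of _ "A * B"] exI[of _ "n' + degree A"]) (simp del: of_nat_add)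
qed

text \<open>\<open>e q t x\<close> imitates \<open>q\<close> applied to the \<open>t\<close>-th
  iterate of \<open>x\<close> under \<open>f\<close>, for all integers \<open>t\<close> and even
  where no iterate exists. The fifth conclusion says that a combination seen at any time is
  dominated by one starting in \<open>{- int N..0}\<close>; it is what turns a supremum over all
  times into a maximum.\<close>

lemma partial_isometry_trajectories:
  fixes X :: "'a::rat_vector rat_nspace"
  assumes U: "finite U" "U \<noteq> {}"
    and lin: "\<And>u. u \<in> U \<Longrightarrow> rat_linear_on (carrier X) u"
    and nrm: "\<And>x. x \<in> carrier X \<Longrightarrow> nrm X x = Max ((\<lambda>u. \<bar>u x\<bar>) ` U)"
    and f: "partial_isometry X V W f"
  obtains e :: "('a \<Rightarrow> rat) \<Rightarrow> int \<Rightarrow> 'a \<Rightarrow> rat" and p d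
  where "\<And>q x. q \<in> U \<Longrightarrow> e q 0 x = q x"
    and "\<And>q t. q \<in> U \<Longrightarrow> rat_linear_on (carrier X) (e q t)"
    and "\<And>q t x. q \<in> U \<Longrightarrow> x \<in> carrier X \<Longrightarrow> \<bar>e q t x\<bar> \<le> nrm X x"
    and "\<And>q t x. q \<in> U \<Longrightarrow> x \<in> V \<Longrightarrow> e q (t + 1) x = e q t (f x)"
    and "\<And>q t N xs. q \<in> U \<Longrightarrow> \<exists>r\<in>U. \<exists>t'\<in>{- int N..0}.
      \<bar>\<Sum>i\<le>N. e q (t + int i) (xs i)\<bar> \<le> \<bar>\<Sum>i\<le>N. e r (t' + int i) (xs i)\<bar>"
    and "p \<noteq> 0"
    and "\<And>q t x. q \<in> U \<Longrightarrow> 0 \<le> t \<or> t \<le> - int d \<Longrightarrow> poly_shift p (\<lambda>t. e q t x) t = 0"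
proof -
  have VX: "V \<subseteq> carrier X" "rat_vector.subspace V"
    and flin: "rat_linear_on V f" and fX: "\<And>x. x \<in> V \<Longrightarrow> f x \<in> carrier X"
    and fnrm: "\<And>x. x \<in> V \<Longrightarrow> nrm X (f x) = nrm X x"
    using f by (auto simp: partial_isometry_def is_subspace_of_def surj_isometry_def
        isometric_embedding_def)
  have V0: "V \<noteq> {}" using VX(2) rat_vector.subspace_0 by blast
  have le: "\<bar>u x\<bar> \<le> nrm X x" if "u \<in> U" "x \<in> carrier X" for u x
    using U that by (simp add: nrm)
  have att: "\<exists>u\<in>U. \<bar>u x\<bar> = nrm X x" if "x \<in> carrier X" for x
  proof -
    have "Max ((\<lambda>u. \<bar>u x\<bar>) ` U) \<in> (\<lambda>u. \<bar>u x\<bar>) ` U" using U by (intro Max_in) auto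
    then show ?thesis using nrm[OF that] by auto
  qed
  \<comment> \<open>The closure hypothesis of \<open>functional_dominated_by_max\<close> is supplied
    by \<open>y - c x\<close>, at the points and at their images under \<open>f\<close>
    simultaneously, so that it serves for both extensions below.\<close>
  have sub: "\<exists>w\<in>V. (\<forall>u\<in>U. u w = u y - c * u x) \<and> (\<forall>u\<in>U. u (f w) = u (f y) - c * u (f x))"
    if x: "x \<in> V" and y: "y \<in> V" for x y c
  proof (intro bexI[of _ "y + (- c) *\<^sub>Q x"] conjI ballI)
    have mem: "(- c) *\<^sub>Q x \<in> V" using VX(2) x rat_vector.subspace_scale by blast
    then show "y + (- c) *\<^sub>Q x \<in> V" using VX(2) y rat_vector.subspace_add by blast
    have fw: "f (y + (- c) *\<^sub>Q x) = f y + (- c) *\<^sub>Q f x"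
      using flin x y mem unfolding rat_linear_on_def by metis
    fix u assume u: "u \<in> U"
    have comb: "u (b + (- c) *\<^sub>Q a) = u b - c * u a" if "a \<in> carrier X" "b \<in> carrier X"
      "(- c) *\<^sub>Q a \<in> carrier X" for a b
    proof -
      have "u (b + (- c) *\<^sub>Q a) = u b + u ((- c) *\<^sub>Q a)" "u ((- c) *\<^sub>Q a) = (- c) *\<^sub>Q u a"
        using lin[OF u] that unfolding rat_linear_on_def by blast+
      then show ?thesis by (simp add: scaleQ_rat_def)
    qed
    show "u (y + (- c) *\<^sub>Q x) = u y - c * u x" using comb x y mem VX(1) by blast
    have "(- c) *\<^sub>Q f x = f ((- c) *\<^sub>Q x)" using flin x unfolding rat_linear_on_def by metis
    then have "(- c) *\<^sub>Q f x \<in> carrier X" using fX mem by simp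
    then show "u (f (y + (- c) *\<^sub>Q x)) = u (f y) - c * u (f x)"
      unfolding fw using comb fX x y by blast
  qed
  have "\<forall>q\<in>U. \<exists>l. (\<Sum>r\<in>U. \<bar>l r\<bar>) \<le> 1 \<and> (\<forall>x\<in>V. q (f x) = (\<Sum>r\<in>U. l r * r x))"
  proof
    fix q assume q: "q \<in> U"
    show "\<exists>l. (\<Sum>r\<in>U. \<bar>l r\<bar>) \<le> 1 \<and> (\<forall>x\<in>V. q (f x) = (\<Sum>r\<in>U. l r * r x))"
    proof (rule functional_dominated_by_max[OF U V0])
      show "\<exists>w\<in>V. (\<forall>i\<in>U. i w = i y - c * i x) \<and> q (f w) = q (f y) - c * q (f x)"
        if "x \<in> V" "y \<in> V" for x y c using sub[OF that, of c] q by blast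
      show "\<exists>i\<in>U. \<bar>q (f z)\<bar> \<le> \<bar>i z\<bar>" if "z \<in> V" for z
        using att[of z] that VX(1) le[OF q fX[OF that]] fnrm[OF that] by (metis subsetD)
    qed
  qed
  then obtain l where l: "\<And>q. q \<in> U \<Longrightarrow> (\<Sum>r\<in>U. \<bar>l q r\<bar>) \<le> 1"
    "\<And>q x. q \<in> U \<Longrightarrow> x \<in> V \<Longrightarrow> q (f x) = (\<Sum>r\<in>U. l q r * r x)"
    by metis
  \<comment> \<open>The inverse of \<open>f\<close> is extended without being formed:
    \<open>V\<close> remains the set of points, and \<open>q x\<close> is dominated by the values of
    the functionals at \<open>f x\<close>.\<close>
  have "\<forall>q\<in>U. \<exists>l. (\<Sum>r\<in>U. \<bar>l r\<bar>) \<le> 1 \<and> (\<forall>x\<in>V. q x = (\<Sum>r\<in>U. l r * r (f x)))"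
  proof
    fix q assume q: "q \<in> U"
    show "\<exists>l. (\<Sum>r\<in>U. \<bar>l r\<bar>) \<le> 1 \<and> (\<forall>x\<in>V. q x = (\<Sum>r\<in>U. l r * r (f x)))"
    proof (rule functional_dominated_by_max[OF U V0])
      show "\<exists>w\<in>V. (\<forall>i\<in>U. i (f w) = i (f y) - c * i (f x)) \<and> q w = q y - c * q x"
        if "x \<in> V" "y \<in> V" for x y c using sub[OF that, of c] q by blast
      show "\<exists>i\<in>U. \<bar>q z\<bar> \<le> \<bar>i (f z)\<bar>" if "z \<in> V" for z
        using att[OF fX[OF that]] le[OF q, of z] VX(1) that fnrm[OF that] by (metis subsetD)
    qed
  qed
  then obtain l' where l': "\<And>q. q \<in> U \<Longrightarrow> (\<Sum>r\<in>U. \<bar>l' q r\<bar>) \<le> 1"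
    "\<And>q x. q \<in> U \<Longrightarrow> x \<in> V \<Longrightarrow> q x = (\<Sum>r\<in>U. l' q r * r (f x))"
    by metis
  define e where "e = (\<lambda>q t x. trajectory U l l' q t (\<lambda>r. r x))"
  have dom: "\<exists>r\<in>U. \<bar>trajectory U l l' q t \<phi>\<bar> \<le> \<bar>\<phi> r\<bar>" if "q \<in> U" for q t \<phi>
    using kernel_op_pow_le[OF U(1) l(1) that] kernel_op_pow_le[OF U(1) l'(1) that]
    by (simp add: trajectory_def)
  obtain p d where p: "p \<noteq> 0" "\<And>q \<phi> t. q \<in> U \<Longrightarrow> 0 \<le> t \<or> t \<le> - int d \<Longrightarrow>
      poly_shift p (\<lambda>t. trajectory U l l' q t \<phi>) t = 0"
    using trajectory_annihilator[OF U(1), of l l'] by blast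
  show thesis
  proof (rule that[of e p d])
    show "e q 0 x = q x" if "q \<in> U" for q x by (simp add: e_def trajectory_def)
    show "\<bar>e q t x\<bar> \<le> nrm X x" if "q \<in> U" "x \<in> carrier X" for q t x
      using dom[OF that(1), of t "\<lambda>r. r x"] le that(2) unfolding e_def by force
    show "poly_shift p (\<lambda>t. e q t x) t = 0" if "q \<in> U" "0 \<le> t \<or> t \<le> - int d" for q t x
      unfolding e_def using p(2) that by blast
    show "rat_linear_on (carrier X) (e q t)" if q: "q \<in> U" for q t
    proof -
      have pow: "(kernel_op U k ^^ n) (\<lambda>r. a * r x + b * r y) q =
          a * (kernel_op U k ^^ n) (\<lambda>r. r x) q + b * (kernel_op U k ^^ n) (\<lambda>r. r y) q"
        for k n a b and x y :: 'a
        using kernel_op_pow_sum[where U = U and l = k and n = n and q = q and I = "UNIV :: bool set"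
            and c = "\<lambda>i. if i then a else b" and \<phi> = "\<lambda>i r. if i then r x else r y"]
        by (simp add: UNIV_bool add.commute)
      have e: "trajectory U l l' q t (\<lambda>r. a * r x + b * r y) = a * e q t x + b * e q t y"
        for a b and x y :: 'a by (simp add: e_def trajectory_def pow)
      have cong: "trajectory U l l' q t \<phi> = trajectory U l l' q t \<psi>"
        if "\<And>r. r \<in> U \<Longrightarrow> \<phi> r = \<psi> r" for \<phi> \<psi>
        using kernel_op_pow_cong[of U \<phi> \<psi> q, OF that q] by (simp add: trajectory_def)
      have "e q t (x + y) = e q t x + e q t y" if "x \<in> carrier X" "y \<in> carrier X" for x y
        using cong[of "\<lambda>r. r (x + y)" "\<lambda>r. 1 * r x + 1 * r y"] lin that e[of 1 x 1 y]
        by (simp add: e_def rat_linear_on_def)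
      moreover have "e q t (c *\<^sub>Q x) = c * e q t x" if "x \<in> carrier X" for x c
        using cong[of "\<lambda>r. r (c *\<^sub>Q x)" "\<lambda>r. c * r x + 0 * r x"] lin that e[of c x 0 x]
        by (simp add: e_def rat_linear_on_def scaleQ_rat_def)
      ultimately show ?thesis by (simp add: rat_linear_on_def scaleQ_rat_def)
    qed
    show "e q (t + 1) x = e q t (f x)" if q: "q \<in> U" and x: "x \<in> V" for q t x
    proof (cases "0 \<le> t")
      case True
      have "nat (t + 1) = Suc (nat t)" using True by simp
      moreover have "kernel_op U l (\<lambda>r. r x) s = s (f x)" if "s \<in> U" for s
        using l(2)[OF that x] by (simp add: kernel_op_def)
      ultimately show ?thesis using True
          kernel_op_pow_cong[where U = U and l = l and q = q and n = "nat t"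
            and \<phi> = "kernel_op U l (\<lambda>r. r x)" and \<psi> = "\<lambda>s. s (f x)"] q
        by (simp add: e_def trajectory_def funpow_swap1 del: funpow.simps)
          (simp add: funpow_swap1)
    next
      case False
      define n where "n = nat (- t - 1)"
      have t: "t = - int (Suc n)" using False by (simp add: n_def)
      have "kernel_op U l' (\<lambda>r. r (f x)) s = s x" if "s \<in> U" for s
        using l'(2)[OF that x] by (simp add: kernel_op_def)
      then have "(kernel_op U l' ^^ n) (kernel_op U l' (\<lambda>r. r (f x))) q = (kernel_op U l' ^^ n) (\<lambda>s. s x) q"
        using kernel_op_pow_cong q by metis
      moreover have "nat (- t) = Suc n" "nat (- (t + 1)) = n" "t \<le> 0" "t + 1 \<le> 0" by (simp_all add: t)
      ultimately show ?thesis
        by (simp add: e_def trajectory_nonpos funpow_swap1)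
    qed
    show "\<exists>r\<in>U. \<exists>t'\<in>{- int N..0}.
      \<bar>\<Sum>i\<le>N. e q (t + int i) (xs i)\<bar> \<le> \<bar>\<Sum>i\<le>N. e r (t' + int i) (xs i)\<bar>"
      if q: "q \<in> U" for q t N xs
    proof -
      \<comment> \<open>The sum involves the times from \<open>t\<close> to \<open>t + N\<close>. If
        all are positive, it is a power of \<open>l\<close> applied to the sum starting at 0; if all
        are negative, it is a power of \<open>l'\<close> applied to the sum starting at
        \<open>- N\<close>, which ends at 0.\<close>
      consider "t \<in> {- int N..0}" | "t > 0" | "t < - int N" by force
      then show ?thesis
      proof cases
        case 2
        have e1: "e r (0 + int i) (xs i) = (kernel_op U l ^^ i) (\<lambda>s. s (xs i)) r" for r i
          by (simp add: e_def trajectory_def)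
        have e2: "e q (t + int i) (xs i) = (kernel_op U l ^^ nat t) ((kernel_op U l ^^ i) (\<lambda>s. s (xs i))) q" for i
        proof -
          have "nat (t + int i) = nat t + i" using 2 by simp
          then show ?thesis using 2 by (simp add: e_def trajectory_def funpow_add)
        qed
        have "(\<Sum>i\<le>N. e q (t + int i) (xs i)) = (kernel_op U l ^^ nat t) (\<lambda>r. \<Sum>i\<le>N. 1 * e r (0 + int i) (xs i)) q"
          unfolding e1 e2 kernel_op_pow_sum by simp
        then obtain r where "r \<in> U" "\<bar>\<Sum>i\<le>N. e q (t + int i) (xs i)\<bar> \<le> \<bar>\<Sum>i\<le>N. e r (0 + int i) (xs i)\<bar>"
          using kernel_op_pow_le[where U = U and l = l and q = q and n = "nat t"
              and \<phi> = "\<lambda>r. \<Sum>i\<le>N. 1 * e r (0 + int i) (xs i)"] U(1) l(1) q by auto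
        then show ?thesis by (intro bexI[of _ r] bexI[of _ 0]) simp_all
      next
        case 3
        have e1: "e r (- int N + int i) (xs i) = (kernel_op U l' ^^ (N - i)) (\<lambda>s. s (xs i)) r"
          if "i \<le> N" for r i
        proof -
          have "nat (- (- int N + int i)) = N - i" using that by simp
          then show ?thesis using that by (simp add: e_def trajectory_nonpos)
        qed
        have e2: "e q (t + int i) (xs i) =
            (kernel_op U l' ^^ nat (- t - int N)) ((kernel_op U l' ^^ (N - i)) (\<lambda>s. s (xs i))) q"
          if "i \<le> N" for i
        proof -
          have *: "nat (- (t + int i)) = nat (- t - int N) + (N - i)" "t + int i \<le> 0"
            using 3 that by simp_all
          show ?thesis unfolding e_def trajectory_nonpos[OF *(2)] *(1) funpow_add by simp
        qed
        have "(\<Sum>i\<le>N. e q (t + int i) (xs i)) =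
          (kernel_op U l' ^^ nat (- t - int N)) (\<lambda>r. \<Sum>i\<le>N. 1 * (kernel_op U l' ^^ (N - i)) (\<lambda>s. s (xs i)) r) q"
          unfolding kernel_op_pow_sum by (simp add: e2)
        then obtain r where "r \<in> U" "\<bar>\<Sum>i\<le>N. e q (t + int i) (xs i)\<bar>
            \<le> \<bar>\<Sum>i\<le>N. (kernel_op U l' ^^ (N - i)) (\<lambda>s. s (xs i)) r\<bar>"
          using kernel_op_pow_le[where U = U and l = l' and q = q and n = "nat (- t - int N)"
              and \<phi> = "\<lambda>r. \<Sum>i\<le>N. 1 * (kernel_op U l' ^^ (N - i)) (\<lambda>s. s (xs i)) r"] U(1) l'(1) q by auto
        moreover have "(\<Sum>i\<le>N. e r (- int N + int i) (xs i)) =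
            (\<Sum>i\<le>N. (kernel_op U l' ^^ (N - i)) (\<lambda>s. s (xs i)) r)" for r
          using e1 by (intro sum.cong) auto
        ultimately show ?thesis by (intro bexI[of _ r] bexI[of _ "- int N"]) simp_all
      qed (use q in blast)
    qed
  qed (fact p(1))
qed

section \<open>Isometric embeddings and dilations\<close>

lemma rat_linear_onD:
  assumes "rat_linear_on V f"
  shows "x \<in> V \<Longrightarrow> y \<in> V \<Longrightarrow> f (x + y) = f x + f y"
    and "x \<in> V \<Longrightarrow> f (c *\<^sub>Q x) = c *\<^sub>Q f x"
  using assms by (simp_all add: rat_linear_on_def)

lemma rat_linear_on_0:
  assumes "rat_linear_on V f" "rat_vector.subspace V"
  shows "f 0 = 0"
  using rat_linear_onD(2)[OF assms(1), of 0 0] rat_vector.subspace_0[OF assms(2)] by simp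

lemma rat_linear_on_diff:
  assumes "rat_linear_on V f" "rat_vector.subspace V" "x \<in> V" "y \<in> V"
  shows "f (x - y) = f x - f y"
proof -
  have "f (x - y) + f y = f x"
    using rat_linear_onD(1)[OF assms(1), of "x - y" y] assms rat_vector.subspace_diff by force
  then show ?thesis by (simp add: algebra_simps)
qed

lemma rat_linear_on_sum:
  assumes "rat_linear_on V f" "rat_vector.subspace V" "\<And>i. i \<in> I \<Longrightarrow> x i \<in> V"
  shows "f (\<Sum>i\<in>I. c i *\<^sub>Q x i) = (\<Sum>i\<in>I. c i *\<^sub>Q f (x i))"
  using assms(3)
proof (induction I rule: infinite_finite_induct)
  case (insert i I)
  have "c i *\<^sub>Q x i \<in> V" "(\<Sum>i\<in>I. c i *\<^sub>Q x i) \<in> V"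
    using insert.prems assms(2) by (auto intro!: rat_vector.subspace_scale rat_vector.subspace_sum)
  then show ?case
    using insert rat_linear_onD[OF assms(1)] by simp
qed (use rat_linear_on_0[OF assms(1,2)] in simp_all)

lemma rat_linear_on_subset: "rat_linear_on V f \<Longrightarrow> V' \<subseteq> V \<Longrightarrow> rat_linear_on V' f"
  unfolding rat_linear_on_def by blast

lemma subspace_image:
  assumes "rat_linear_on V f" "rat_vector.subspace V"
  shows "rat_vector.subspace (f ` V)"
  unfolding rat_vector.subspace_def
proof (intro conjI ballI allI)
  show "0 \<in> f ` V"
    using rat_linear_on_0[OF assms] rat_vector.subspace_0[OF assms(2)] by (metis imageI)
  show "x + y \<in> f ` V" if xy: "x \<in> f ` V" "y \<in> f ` V" for x y
  proof -
    from xy obtain a b where ab: "a \<in> V" "b \<in> V" "x = f a" "y = f b" by blast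
    then have "x + y = f (a + b)" using rat_linear_onD(1)[OF assms(1)] by simp
    then show ?thesis using ab rat_vector.subspace_add[OF assms(2)] by blast
  qed
  show "c *\<^sub>Q x \<in> f ` V" if x: "x \<in> f ` V" for c x
  proof -
    from x obtain a where a: "a \<in> V" "x = f a" by blast
    then have "c *\<^sub>Q x = f (c *\<^sub>Q a)" using rat_linear_onD(2)[OF assms(1)] by simp
    then show ?thesis using a rat_vector.subspace_scale[OF assms(2)] by blast
  qed
qed

lemma span_image_subset:
  assumes "rat_linear_on V f" "rat_vector.span B = V" "f ` B \<subseteq> rat_vector.span C"
  shows "f ` V \<subseteq> rat_vector.span C"
proof -
  have V: "rat_vector.subspace V" using assms(2) rat_vector.subspace_span by blast
  let ?W = "{x \<in> V. f x \<in> rat_vector.span C}"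
  have "rat_vector.subspace ?W"
    unfolding rat_vector.subspace_def
    using V assms(1) rat_linear_on_0[OF assms(1) V]
    by (auto simp: rat_linear_onD rat_vector.span_add rat_vector.span_scale rat_vector.span_zero
        rat_vector.subspace_0 rat_vector.subspace_add rat_vector.subspace_scale)
  moreover have "B \<subseteq> ?W" using assms(2,3) rat_vector.span_superset by blast
  ultimately have "rat_vector.span B \<subseteq> ?W" by (intro rat_vector.span_minimal)
  then show ?thesis using assms(2) by blast
qed

lemma rat_normed_spaceD:
  assumes "rat_normed_space X"
  shows "rat_vector.subspace (carrier X)"
    and "x \<in> carrier X \<Longrightarrow> 0 \<le> nrm X x"
    and "x \<in> carrier X \<Longrightarrow> nrm X x = 0 \<longleftrightarrow> x = 0"
    and "x \<in> carrier X \<Longrightarrow> y \<in> carrier X \<Longrightarrow> nrm X (x + y) \<le> nrm X x + nrm X y"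
    and "x \<in> carrier X \<Longrightarrow> nrm X (c *\<^sub>Q x) = \<bar>c\<bar> * nrm X x"
  using assms by (simp_all add: rat_normed_space_def)

lemma rat_normed_space_restrict:
  assumes "rat_normed_space X" "is_subspace_of V X"
  shows "rat_normed_space (X\<lparr>carrier := V\<rparr>)"
  using assms by (auto simp: rat_normed_space_def is_subspace_of_def subset_iff)

lemma isometric_embeddingI:
  assumes X: "rat_normed_space X" and f: "f \<in> carrier X \<rightarrow> carrier Y" "rat_linear_on (carrier X) f"
    "\<And>x. x \<in> carrier X \<Longrightarrow> nrm Y (f x) = nrm X x"
  shows "isometric_embedding X Y f"
proof -
  note V = rat_normed_spaceD(1)[OF X]
  have "inj_on f (carrier X)"
  proof (rule inj_onI)
    fix x y assume xy: "x \<in> carrier X" "y \<in> carrier X" "f x = f y"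
    then have d: "x - y \<in> carrier X" using V rat_vector.subspace_diff by blast
    have "f (x - y) = f 0"
      using rat_linear_on_diff[OF f(2) V xy(1,2)] rat_linear_on_0[OF f(2) V] xy(3) by simp
    then have "nrm X (x - y) = nrm X 0"
      using f(3)[OF d] f(3)[OF rat_vector.subspace_0[OF V]] by simp
    then show "x = y"
      using rat_normed_spaceD(3)[OF X d] rat_normed_spaceD(3)[OF X rat_vector.subspace_0[OF V]] by simp
  qed
  then show ?thesis using f by (simp add: isometric_embedding_def)
qed

lemma isometric_embeddingD:
  assumes "isometric_embedding X Y f"
  shows "x \<in> carrier X \<Longrightarrow> f x \<in> carrier Y"
    and "rat_linear_on (carrier X) f" and "inj_on f (carrier X)"
    and "x \<in> carrier X \<Longrightarrow> nrm Y (f x) = nrm X x"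
  using assms by (auto simp: isometric_embedding_def)

lemma isometric_embedding_compose:
  assumes f: "isometric_embedding X Y f" and g: "isometric_embedding Y Z g"
  shows "isometric_embedding X Z (g \<circ> f)"
  unfolding isometric_embedding_def
proof (intro conjI ballI)
  note F = isometric_embeddingD[OF f] and G = isometric_embeddingD[OF g]
  show "g \<circ> f \<in> carrier X \<rightarrow> carrier Z" using F(1) G(1) by auto
  show "rat_linear_on (carrier X) (g \<circ> f)"
    using F(1,2) G(2) by (simp add: rat_linear_on_def)
  show "inj_on (g \<circ> f) (carrier X)"
    using F(1,3) G(3) by (auto intro!: comp_inj_on inj_on_subset[of g "carrier Y"])
  show "nrm Z ((g \<circ> f) x) = nrm X x" if "x \<in> carrier X" for x
    using F(1,4) G(4) that by simp
qed

lemma isometric_embedding_inv: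
  assumes X: "rat_normed_space X" and f: "isometric_embedding X Y f"
    and V: "rat_vector.subspace V" "V \<subseteq> carrier X"
  shows "isometric_embedding (Y\<lparr>carrier := f ` V\<rparr>) (X\<lparr>carrier := V\<rparr>) (inv_into (carrier X) f)"
  unfolding isometric_embedding_def
proof (intro conjI ballI)
  note F = isometric_embeddingD[OF f]
  let ?h = "inv_into (carrier X) f"
  have h: "?h (f x) = x" if "x \<in> V" for x using F(3) V(2) that by (auto intro: inv_into_f_f)
  show "?h \<in> carrier (Y\<lparr>carrier := f ` V\<rparr>) \<rightarrow> carrier (X\<lparr>carrier := V\<rparr>)"
    using h by auto
  show "inj_on ?h (carrier (Y\<lparr>carrier := f ` V\<rparr>))" using h by (auto simp: inj_on_def)
  show "nrm (X\<lparr>carrier := V\<rparr>) (?h y) = nrm (Y\<lparr>carrier := f ` V\<rparr>) y"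
    if "y \<in> carrier (Y\<lparr>carrier := f ` V\<rparr>)" for y
    using that h F(4) V(2) by auto
  have "?h (f a + f b) = ?h (f a) + ?h (f b)" if "a \<in> V" "b \<in> V" for a b
  proof -
    have "f a + f b = f (a + b)" using rat_linear_onD(1)[OF F(2), of a b] that V(2) by (simp add: subset_iff)
    then show ?thesis using h that rat_vector.subspace_add[OF V(1)] by simp
  qed
  moreover have "?h (c *\<^sub>Q f a) = c *\<^sub>Q ?h (f a)" if "a \<in> V" for a c
  proof -
    have "c *\<^sub>Q f a = f (c *\<^sub>Q a)" using rat_linear_onD(2)[OF F(2), of a c] that V(2) by (simp add: subset_iff)
    then show ?thesis using h that rat_vector.subspace_scale[OF V(1)] by simp
  qed
  ultimately show "rat_linear_on (carrier (Y\<lparr>carrier := f ` V\<rparr>)) ?h"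
    by (auto simp: rat_linear_on_def)
qed

lemma partial_isometryD:
  assumes "partial_isometry X V W f"
  shows "rat_vector.subspace V" "V \<subseteq> carrier X" "rat_vector.subspace W" "W \<subseteq> carrier X"
    "rat_linear_on V f" "f ` V = W" "\<And>x. x \<in> V \<Longrightarrow> nrm X (f x) = nrm X x"
  using assms by (auto simp: partial_isometry_def is_subspace_of_def surj_isometry_def
      isometric_embedding_def)

lemma partial_isometryI:
  assumes X: "rat_normed_space X" and V: "rat_vector.subspace V" "V \<subseteq> carrier X"
    and f: "f ` V \<subseteq> carrier X" "rat_linear_on V f" "\<And>x. x \<in> V \<Longrightarrow> nrm X (f x) = nrm X x"
  shows "partial_isometry X V (f ` V) f"
proof -
  have VX: "is_subspace_of V X" using V by (simp add: is_subspace_of_def)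
  have "isometric_embedding (X\<lparr>carrier := V\<rparr>) (X\<lparr>carrier := f ` V\<rparr>) f"
    using rat_normed_space_restrict[OF X VX] by (rule isometric_embeddingI) (use f in auto)
  then show ?thesis
    using VX f subspace_image[OF f(2) V(1)]
    by (auto simp: partial_isometry_def surj_isometry_def is_subspace_of_def)
qed

text \<open>The dilation is a space of functions on \<open>int\<close> with values in
  \<open>'j \<Rightarrow> rat\<close>, while members of the class consist of rational sequences;
  conjugating \<open>g\<close> by the isometry \<open>k\<close> onto a copy moves the whole
  system.\<close>

lemma polyhedral_system_copy:
  assumes Y: "polyhedral_space Y" and g: "partial_isometry Y A B g"
  obtains S k where "S \<in> isometry_systems polyhedral_class" "surj_isometry Y (sys_space S) k"
    "sys_dom S = k ` A" "\<And>a. a \<in> A \<Longrightarrow> sys_map S (k a) = k (g a)"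
proof -
  obtain Y' k where Y': "Y' \<in> polyhedral_class" and k: "surj_isometry Y Y' k"
    using polyhedral_space_has_copy[OF Y] by blast
  have ke: "isometric_embedding Y Y' k" and kc: "k ` carrier Y = carrier Y'"
    using k by (simp_all add: surj_isometry_def)
  note K = isometric_embeddingD[OF ke] and G = partial_isometryD[OF g]
  have nY: "rat_normed_space Y" and nY': "rat_normed_space Y'"
    using Y Y' by (simp_all add: polyhedral_space_def polyhedral_class_def)
  define h where "h = inv_into (carrier Y) k"
  have h: "h (k x) = x" if "x \<in> carrier Y" for x using K(3) that by (simp add: h_def)
  define S where "S = \<lparr>sys_space = Y', sys_dom = k ` A,
    sys_cod = (k \<circ> g \<circ> h) ` k ` A, sys_map = k \<circ> g \<circ> h\<rparr>"
  have hl: "rat_linear_on (k ` A) h" "\<And>a. a \<in> A \<Longrightarrow> h (k a) = a"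
    using isometric_embeddingD(2)[OF isometric_embedding_inv[OF nY ke G(1,2)]] h G(2)
    by (auto simp: h_def)
  have gA: "g a \<in> carrier Y" if "a \<in> A" for a using G(4,6) that by blast
  have "partial_isometry Y' (k ` A) ((k \<circ> g \<circ> h) ` k ` A) (k \<circ> g \<circ> h)"
  proof (rule partial_isometryI[OF nY'])
    show "rat_vector.subspace (k ` A)"
      using subspace_image rat_linear_on_subset[OF K(2) G(2)] G(1) by blast
    show "k ` A \<subseteq> carrier Y'" using K(1) G(2) by blast
    show "(k \<circ> g \<circ> h) ` k ` A \<subseteq> carrier Y'" using hl gA K(1) by auto
    show "rat_linear_on (k ` A) (k \<circ> g \<circ> h)"
      using hl gA G(5) K(2) by (auto simp: rat_linear_on_def)
    show "nrm Y' ((k \<circ> g \<circ> h) x) = nrm Y' x" if "x \<in> k ` A" for x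
      using that hl(2) gA K(4) G(2,7) by (auto simp: subset_iff)
  qed
  then have "S \<in> isometry_systems polyhedral_class"
    using Y' by (simp add: S_def isometry_systems_def)
  then show thesis using k hl(2) by (intro that[of S k]) (auto simp: S_def)
qed

text \<open>
  Each index \<open>j\<close> gives a sequence of functionals that is compatible with \<open>f\<close>, so
  \<open>x \<mapsto> (row j t x)\<close> intertwines \<open>f\<close> with the shift of \<open>t\<close>. The hypothesis \<open>window\<close> says that the
  supremum norm on combinations of \<open>Suc M\<close> shifts is attained in a fixed finite window, which
  makes it polyhedral although the shift needs all \<open>t\<close>.
\<close>

lemma polyhedral_dilation:
  fixes X :: "'a::rat_vector rat_nspace" and row :: "'j \<Rightarrow> int \<Rightarrow> 'a \<Rightarrow> rat"
  assumes X: "rat_normed_space X" "rat_finite_dim (carrier X)" and f: "partial_isometry X V W f"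
    and J: "finite J" "J \<noteq> {}"
    and lin: "\<And>j t. j \<in> J \<Longrightarrow> rat_linear_on (carrier X) (row j t)"
    and le: "\<And>j t x. j \<in> J \<Longrightarrow> x \<in> carrier X \<Longrightarrow> \<bar>row j t x\<bar> \<le> nrm X x"
    and att: "\<And>x. x \<in> carrier X \<Longrightarrow> \<exists>j\<in>J. nrm X x \<le> \<bar>row j 0 x\<bar>"
    and eqv: "\<And>j t x. j \<in> J \<Longrightarrow> x \<in> V \<Longrightarrow> row j (t + 1) x = row j t (f x)"
    and window: "\<And>j t xs. j \<in> J \<Longrightarrow> xs \<in> UNIV \<rightarrow> carrier X \<Longrightarrow> \<exists>j'\<in>J. \<exists>t'\<in>{-R..R}.
      \<bar>\<Sum>i\<le>Suc M. row j (t + int i) (xs i)\<bar> \<le> \<bar>\<Sum>i\<le>Suc M. row j' (t' + int i) (xs i)\<bar>"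
  shows "\<exists>S \<alpha>. S \<in> isometry_systems polyhedral_class \<and> isometric_embedding X (sys_space S) \<alpha> \<and>
    \<alpha> ` V \<subseteq> sys_dom S \<and> (\<forall>a\<in>V. \<alpha> (f a) = sys_map S (\<alpha> a)) \<and>
    (\<forall>v\<in>carrier X. \<exists>y. y 0 = \<alpha> v \<and>
      (\<forall>i<Suc M. y i \<in> sys_dom S \<and> sys_map S (y i) = y (Suc i)) \<and>
      (\<forall>\<beta> c. nrm (sys_space S) (\<Sum>i\<le>Suc M. \<beta> i *\<^sub>Q y i) \<le> c \<longleftrightarrow>
        (\<forall>j\<in>J. \<forall>t. \<bar>\<Sum>i\<le>Suc M. \<beta> i * row j (t + int i) v\<bar> \<le> c)))"
proof -
  let ?N = "Suc M" and ?P = "UNIV \<rightarrow> carrier X :: (nat \<Rightarrow> 'a) set"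
  note XS = rat_normed_spaceD(1)[OF X(1)] and F = partial_isometryD[OF f]
  have X0: "0 \<in> carrier X" using XS by (rule rat_vector.subspace_0)
  have row0: "row j t 0 = 0" if "j \<in> J" for j t using rat_linear_on_0[OF lin[OF that] XS] .
  have radd: "row j t (x + y) = row j t x + row j t y"
    if "j \<in> J" "x \<in> carrier X" "y \<in> carrier X" for j t x y
    using rat_linear_onD(1)[OF lin[OF that(1)] that(2,3)] .
  have rscale: "row j t (c *\<^sub>Q x) = c * row j t x" if "j \<in> J" "x \<in> carrier X" for j t x c
    using rat_linear_onD(2)[OF lin[OF that(1)] that(2)] by (simp add: scaleQ_rat_def)
  \<comment> \<open>\<open>\<Phi> xs\<close> is the sum over the slots \<open>i\<close> of the
    \<open>i\<close>-th shift of the sequence of rows at \<open>xs i\<close>. The carrier of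
    \<open>Y\<close> is thus the sum of \<open>Suc M + 1\<close> successive shifts of the copy of
    \<open>X\<close>.\<close>
  define \<Phi> :: "(nat \<Rightarrow> 'a) \<Rightarrow> int \<Rightarrow> 'j \<Rightarrow> rat"
    where "\<Phi> xs = (\<lambda>t j. if j \<in> J then \<Sum>i\<le>?N. row j (t + int i) (xs i) else 0)" for xs
  define \<delta> :: "nat \<Rightarrow> 'a \<Rightarrow> nat \<Rightarrow> 'a" where "\<delta> i x = (\<lambda>k. if k = i then x else 0)" for i x
  define Y where "Y = \<lparr>carrier = \<Phi> ` ?P,
    nrm = (\<lambda>y :: int \<Rightarrow> 'j \<Rightarrow> rat. Max ((\<lambda>(t, j). \<bar>y t j\<bar>) ` ({-R..R} \<times> J)))\<rparr>"
  define g :: "(int \<Rightarrow> 'j \<Rightarrow> rat) \<Rightarrow> int \<Rightarrow> 'j \<Rightarrow> rat" where "g y = (\<lambda>t. y (t + 1))" for y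
  have fin: "finite ({-R..R} \<times> J)" using J by simp
  have ne: "{-R..R} \<times> J \<noteq> {}" using window[of _ "\<lambda>_. 0"] J X0 by blast
  have sum_app: "(\<Sum>i\<in>I. h i) t j = (\<Sum>i\<in>I. h i t j)" for I :: "nat set" and h and t :: int and j :: 'j
    by (induction I rule: infinite_finite_induct) simp_all
  have \<delta>P: "\<delta> i x \<in> ?P" if "x \<in> carrier X" for i x using that X0 by (simp add: \<delta>_def)
  \<comment> \<open>The maximum over the window is therefore the supremum over all times. This is
    what makes \<open>g\<close> norm-preserving, since moving the time only permutes the
    bounds.\<close>
  have nle: "nrm Y y \<le> c \<longleftrightarrow> (\<forall>j\<in>J. \<forall>t. \<bar>y t j\<bar> \<le> c)" if y: "y \<in> carrier Y" for y c
  proof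
    assume c: "nrm Y y \<le> c"
    obtain xs where xs: "xs \<in> ?P" "y = \<Phi> xs" using y by (auto simp: Y_def)
    show "\<forall>j\<in>J. \<forall>t. \<bar>y t j\<bar> \<le> c"
    proof (intro ballI allI)
      fix j t assume j: "j \<in> J"
      obtain j' t' where "j' \<in> J" "t' \<in> {-R..R}" "\<bar>y t j\<bar> \<le> \<bar>y t' j'\<bar>"
        using window[OF j xs(1), of t] j by (auto simp: xs(2) \<Phi>_def)
      moreover have "\<bar>y t' j'\<bar> \<le> nrm Y y" if "j' \<in> J" "t' \<in> {-R..R}" for j' t'
        unfolding Y_def using fin that by (auto intro!: Max_ge)
      ultimately show "\<bar>y t j\<bar> \<le> c" using c by fastforce
    qed
  next
    assume "\<forall>j\<in>J. \<forall>t. \<bar>y t j\<bar> \<le> c"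
    then show "nrm Y y \<le> c" unfolding Y_def using fin ne by auto
  qed
  have \<Phi>_add: "\<Phi> xs + \<Phi> ys = \<Phi> (\<lambda>i. xs i + ys i)" if "xs \<in> ?P" "ys \<in> ?P" for xs ys
    using that by (auto simp: \<Phi>_def fun_eq_iff sum.distrib Pi_iff radd)
  have \<Phi>_scale: "c *\<^sub>Q \<Phi> xs = \<Phi> (\<lambda>i. c *\<^sub>Q xs i)" if "xs \<in> ?P" for xs c
    using that by (auto simp: \<Phi>_def fun_eq_iff sum_distrib_left distrib_left Pi_iff rscale
        scaleQ_fun_def scaleQ_rat_def)
  have \<Phi>0: "\<Phi> (\<lambda>_. 0) = 0" by (auto simp: \<Phi>_def fun_eq_iff row0)
  have YS: "rat_vector.subspace (carrier Y)"
    unfolding rat_vector.subspace_def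
  proof (intro conjI ballI allI)
    show "0 \<in> carrier Y" using \<Phi>0 X0 by (auto simp: Y_def image_iff intro!: bexI[of _ "\<lambda>_. 0"])
    show "x + y \<in> carrier Y" if "x \<in> carrier Y" "y \<in> carrier Y" for x y
      using that \<Phi>_add rat_vector.subspace_add[OF XS] by (auto simp: Y_def Pi_iff)
    show "c *\<^sub>Q x \<in> carrier Y" if "x \<in> carrier Y" for c x
      using that \<Phi>_scale rat_vector.subspace_scale[OF XS] by (auto simp: Y_def Pi_iff)
  qed
  have nabs: "\<bar>y t j\<bar> \<le> nrm Y y" if "y \<in> carrier Y" "j \<in> J" for y t j
    using nle[OF that(1), of "nrm Y y"] that(2) by blast
  have nY: "rat_normed_space Y"
    unfolding rat_normed_space_def
  proof (intro conjI ballI allI YS)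
    fix x assume x: "x \<in> carrier Y"
    show pos: "0 \<le> nrm Y x" using nabs[OF x] J(2) by (meson abs_ge_zero all_not_in_conv order_trans)
    show "nrm Y x = 0 \<longleftrightarrow> x = 0"
    proof
      assume "nrm Y x = 0"
      then have "x t j = 0" if "j \<in> J" for t j using nabs[OF x that, of t] by simp
      moreover have "x t j = 0" if "j \<notin> J" for t j using x that by (auto simp: Y_def \<Phi>_def)
      ultimately show "x = 0" by (auto simp: fun_eq_iff)
    next
      assume "x = 0"
      then have "nrm Y x \<le> 0" using nle[OF x, of 0] by simp
      then show "nrm Y x = 0" using pos by simp
    qed
    show "nrm Y (x + y) \<le> nrm Y x + nrm Y y" if y: "y \<in> carrier Y" for y
    proof -
      have "\<bar>(x + y) t j\<bar> \<le> nrm Y x + nrm Y y" if "j \<in> J" for t j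
        using nabs[OF x that, of t] nabs[OF y that, of t] by simp
      then show ?thesis using nle rat_vector.subspace_add[OF YS x y] by blast
    qed
    show "nrm Y (c *\<^sub>Q x) = \<bar>c\<bar> * nrm Y x" for c
    proof (rule antisym)
      have *: "nrm Y (c *\<^sub>Q x) \<le> \<bar>c\<bar> * nrm Y x" if x: "x \<in> carrier Y" for c x
      proof -
        have "\<bar>(c *\<^sub>Q x) t j\<bar> \<le> \<bar>c\<bar> * nrm Y x" if "j \<in> J" for t j
          using nabs[OF x that, of t]
          by (simp add: scaleQ_fun_def scaleQ_rat_def abs_mult mult_left_mono)
        then show ?thesis using nle rat_vector.subspace_scale[OF YS x] by blast
      qed
      show "nrm Y (c *\<^sub>Q x) \<le> \<bar>c\<bar> * nrm Y x" using *[OF x] .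
      show "\<bar>c\<bar> * nrm Y x \<le> nrm Y (c *\<^sub>Q x)"
      proof (cases "c = 0")
        case True
        then show ?thesis using nabs[OF rat_vector.subspace_scale[OF YS x, of c]] J(2)
          by (metis abs_ge_zero abs_zero all_not_in_conv mult_zero_left order_trans)
      next
        case False
        have "nrm Y (inverse c *\<^sub>Q (c *\<^sub>Q x)) \<le> \<bar>inverse c\<bar> * nrm Y (c *\<^sub>Q x)"
          using *[OF rat_vector.subspace_scale[OF YS x]] .
        then have "nrm Y x \<le> \<bar>inverse c\<bar> * nrm Y (c *\<^sub>Q x)"
          using False by (simp add: scaleQ_scaleQ scaleQ_one)
        then have "\<bar>c\<bar> * nrm Y x \<le> \<bar>c\<bar> * (\<bar>inverse c\<bar> * nrm Y (c *\<^sub>Q x))"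
          by (rule mult_left_mono) simp
        then show ?thesis using False by (simp add: abs_mult[symmetric] mult.assoc[symmetric])
      qed
    qed
  qed
  obtain S0 where S0: "finite S0" "rat_vector.span S0 = carrier X"
    using X(2) by (auto simp: rat_finite_dim_def)
  have \<Phi>_\<delta>: "\<Phi> (\<delta> i x) = (\<lambda>t j. if j \<in> J \<and> i \<le> ?N then row j (t + int i) x else 0)" for i x
  proof -
    have "(\<Sum>k\<le>?N. row j (t + int k) (\<delta> i x k)) = (\<Sum>k\<le>?N. if k = i then row j (t + int i) x else 0)"
      if "j \<in> J" for t j
      by (intro sum.cong) (auto simp: \<delta>_def row0[OF that])
    then show ?thesis by (auto simp: \<Phi>_def fun_eq_iff)
  qed
  have fdY: "rat_finite_dim (carrier Y)"
    unfolding rat_finite_dim_def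
  proof (intro exI conjI antisym)
    let ?B = "(\<lambda>(i, s). \<Phi> (\<delta> i s)) ` ({..?N} \<times> S0)"
    show "finite ?B" using S0 by simp
    have "?B \<subseteq> carrier Y"
      using \<delta>P S0(2) rat_vector.span_superset[of S0] by (auto simp: Y_def)
    then show "rat_vector.span ?B \<subseteq> carrier Y" using YS by (rule rat_vector.span_minimal)
    show "carrier Y \<subseteq> rat_vector.span ?B"
    proof
      fix y assume "y \<in> carrier Y"
      then obtain xs where xs: "xs \<in> ?P" "y = \<Phi> xs" by (auto simp: Y_def)
      have "y = (\<Sum>i\<le>?N. \<Phi> (\<delta> i (xs i)))"
        by (auto simp: fun_eq_iff sum_app \<Phi>_\<delta> xs(2)) (simp_all add: \<Phi>_def)
      also have "\<dots> \<in> rat_vector.span ?B"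
      proof (rule rat_vector.span_sum)
        fix i assume i: "i \<in> {..?N}"
        have "(\<lambda>x. \<Phi> (\<delta> i x)) ` carrier X \<subseteq> rat_vector.span ?B"
        proof (rule span_image_subset[OF _ S0(2)])
          show "rat_linear_on (carrier X) (\<lambda>x. \<Phi> (\<delta> i x))"
            by (auto simp: rat_linear_on_def \<Phi>_\<delta> radd rscale fun_eq_iff scaleQ_fun_def scaleQ_rat_def)
          show "(\<lambda>x. \<Phi> (\<delta> i x)) ` S0 \<subseteq> rat_vector.span ?B"
            using i by (auto intro!: rat_vector.span_base)
        qed
        then show "\<Phi> (\<delta> i (xs i)) \<in> rat_vector.span ?B" using xs(1) by blast
      qed
      finally show "y \<in> rat_vector.span ?B" .
    qed
  qed
  have pY: "polyhedral_space Y"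
    unfolding polyhedral_space_def
  proof (intro conjI nY fdY exI[of _ "(\<lambda>(t, j) y. y t j) ` ({-R..R} \<times> J)"])
    show "\<forall>y\<in>carrier Y. nrm Y y = Max ((\<lambda>u. \<bar>u y\<bar>) ` (\<lambda>(t, j) y. y t j) ` ({-R..R} \<times> J))"
      by (simp add: Y_def image_image case_prod_beta)
  qed (use fin ne in \<open>auto simp: rat_linear_on_def scaleQ_fun_def scaleQ_rat_def\<close>)
  \<comment> \<open>An empty last slot leaves room for one more shift. As \<open>g\<close> acts on
    functions, different representations by \<open>\<Phi>\<close> cause no ambiguity. Since
    \<open>?N\<close> is a successor, slot 0 is never the last one, so the copy of \<open>X\<close>
    lies in \<open>A\<close>.\<close>
  define A where "A = \<Phi> ` {xs \<in> ?P. xs ?N = 0}"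
  have AY: "A \<subseteq> carrier Y" by (auto simp: A_def Y_def)
  have g\<Phi>: "g (\<Phi> xs) = \<Phi> (\<lambda>i. case i of 0 \<Rightarrow> 0 | Suc k \<Rightarrow> xs k)" if "xs ?N = 0" for xs
  proof -
    have "(\<Sum>i\<le>?N. row j (t + 1 + int i) (xs i)) =
        (\<Sum>i\<le>?N. row j (t + int i) (case i of 0 \<Rightarrow> 0 | Suc k \<Rightarrow> xs k))" if j: "j \<in> J" for t j
    proof -
      have "(\<Sum>i\<le>?N. row j (t + 1 + int i) (xs i)) = (\<Sum>i\<le>M. row j (t + 1 + int i) (xs i))"
        using \<open>xs ?N = 0\<close> row0[OF j] by simp
      then show ?thesis by (subst sum.atMost_Suc_shift) (simp add: row0[OF j] add.assoc)
    qed
    then show ?thesis by (auto simp: \<Phi>_def g_def fun_eq_iff)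
  qed
  have gY: "g y \<in> carrier Y" if "y \<in> A" for y
    using that X0 g\<Phi> by (auto simp: A_def Y_def Pi_iff intro!: imageI split: nat.splits)
  have glin: "rat_linear_on A g" by (simp add: rat_linear_on_def g_def fun_eq_iff scaleQ_fun_def)
  have gn: "nrm Y (g y) = nrm Y y" if y: "y \<in> A" for y
  proof (rule antisym)
    have y': "y \<in> carrier Y" using y AY by blast
    show "nrm Y (g y) \<le> nrm Y y"
      using nle[OF gY[OF y]] nabs[OF y'] by (simp add: g_def)
    have "\<bar>y t j\<bar> \<le> nrm Y (g y)" if "j \<in> J" for t j
      using nabs[OF gY[OF y] that, of "t - 1"] by (simp add: g_def)
    then show "nrm Y y \<le> nrm Y (g y)" using nle[OF y'] by blast
  qed
  have "rat_vector.subspace A"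
    unfolding rat_vector.subspace_def
  proof (intro conjI ballI allI)
    show "0 \<in> A" using \<Phi>0 X0 by (auto simp: A_def image_iff intro!: exI[of _ "\<lambda>_. 0"])
    show "x + y \<in> A" if "x \<in> A" "y \<in> A" for x y
      using that \<Phi>_add rat_vector.subspace_add[OF XS] by (auto simp: A_def Pi_iff)
    show "c *\<^sub>Q x \<in> A" if "x \<in> A" for c x
      using that \<Phi>_scale rat_vector.subspace_scale[OF XS] by (auto simp: A_def Pi_iff)
  qed
  then have "partial_isometry Y A (g ` A) g"
    using AY gY glin gn by (intro partial_isometryI[OF nY]) auto
  then obtain S k where S: "S \<in> isometry_systems polyhedral_class" "surj_isometry Y (sys_space S) k"
    "sys_dom S = k ` A" "\<And>a. a \<in> A \<Longrightarrow> sys_map S (k a) = k (g a)"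
    using polyhedral_system_copy[OF pY] by metis
  have ke: "isometric_embedding Y (sys_space S) k" using S(2) by (simp add: surj_isometry_def)
  note K = isometric_embeddingD[OF ke]
  define \<alpha> where "\<alpha> = (\<lambda>x. k (\<Phi> (\<delta> 0 x)))"
  have e0: "isometric_embedding X Y (\<lambda>x. \<Phi> (\<delta> 0 x))"
  proof (rule isometric_embeddingI[OF X(1)])
    show m: "(\<lambda>x. \<Phi> (\<delta> 0 x)) \<in> carrier X \<rightarrow> carrier Y" using \<delta>P by (auto simp: Y_def)
    show "rat_linear_on (carrier X) (\<lambda>x. \<Phi> (\<delta> 0 x))"
      by (auto simp: rat_linear_on_def \<Phi>_\<delta> radd rscale fun_eq_iff scaleQ_fun_def scaleQ_rat_def)
    fix x assume x: "x \<in> carrier X"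
    then have y: "\<Phi> (\<delta> 0 x) \<in> carrier Y" using m by blast
    show "nrm Y (\<Phi> (\<delta> 0 x)) = nrm X x"
    proof (rule antisym)
      show "nrm Y (\<Phi> (\<delta> 0 x)) \<le> nrm X x" using nle[OF y] le x by (simp add: \<Phi>_\<delta>)
      obtain j where j: "j \<in> J" "nrm X x \<le> \<bar>row j 0 x\<bar>" using att[OF x] by blast
      then show "nrm X x \<le> nrm Y (\<Phi> (\<delta> 0 x))" using nabs[OF y j(1), of 0] by (simp add: \<Phi>_\<delta>)
    qed
  qed
  have \<alpha>: "isometric_embedding X (sys_space S) \<alpha>"
    using isometric_embedding_compose[OF e0 ke] by (simp add: \<alpha>_def comp_def)
  have \<delta>A: "\<Phi> (\<delta> i x) \<in> A" if "x \<in> carrier X" "i < ?N" for x i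
    using \<delta>P[OF that(1), of i] that(2) by (auto simp: A_def \<delta>_def)
  have g\<delta>: "g (\<Phi> (\<delta> i x)) = \<Phi> (\<delta> (Suc i) x)" if "i < ?N" for x i
    using that by (auto simp: \<Phi>_\<delta> g_def fun_eq_iff add.assoc)
  show ?thesis
  proof (intro exI conjI ballI)
    show "S \<in> isometry_systems polyhedral_class" by fact
    show "isometric_embedding X (sys_space S) \<alpha>" by fact
    show "\<alpha> ` V \<subseteq> sys_dom S" using \<delta>A F(2) by (auto simp: S(3) \<alpha>_def)
    show "\<alpha> (f a) = sys_map S (\<alpha> a)" if a: "a \<in> V" for a
    proof -
      \<comment> \<open>Here \<open>eqv\<close> identifies \<open>a\<close> in slot 1 with
        \<open>f a\<close> in slot 0, which makes the shift extend \<open>f\<close>.\<close>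
      have "g (\<Phi> (\<delta> 0 a)) = \<Phi> (\<delta> 0 (f a))"
        using eqv a by (auto simp: \<Phi>_\<delta> g_def fun_eq_iff)
      then show ?thesis using S(4)[OF \<delta>A[of a 0]] a F(2) by (auto simp: \<alpha>_def)
    qed
    fix v assume v: "v \<in> carrier X"
    let ?y = "\<lambda>i. k (\<Phi> (\<delta> i v))"
    show "?y 0 = \<alpha> v" by (simp add: \<alpha>_def)
    show "\<forall>i<?N. ?y i \<in> sys_dom S \<and> sys_map S (?y i) = ?y (Suc i)"
      using \<delta>A[OF v] g\<delta> S(4) by (auto simp: S(3))
    show "\<forall>\<beta> c. nrm (sys_space S) (\<Sum>i\<le>?N. \<beta> i *\<^sub>Q ?y i) \<le> c \<longleftrightarrow>
        (\<forall>j\<in>J. \<forall>t. \<bar>\<Sum>i\<le>?N. \<beta> i * row j (t + int i) v\<bar> \<le> c)"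
    proof (intro allI)
      fix \<beta> c
      have m: "\<Phi> (\<delta> i v) \<in> carrier Y" for i using \<delta>P[OF v] by (auto simp: Y_def)
      then have m': "(\<Sum>i\<le>?N. \<beta> i *\<^sub>Q \<Phi> (\<delta> i v)) \<in> carrier Y"
        by (intro rat_vector.subspace_sum[OF YS] rat_vector.subspace_scale[OF YS])
      have "nrm (sys_space S) (\<Sum>i\<le>?N. \<beta> i *\<^sub>Q ?y i) = nrm Y (\<Sum>i\<le>?N. \<beta> i *\<^sub>Q \<Phi> (\<delta> i v))"
        using rat_linear_on_sum[OF K(2) YS, where I = "{..?N}" and c = \<beta> and x = "\<lambda>i. \<Phi> (\<delta> i v)"]
          m K(4)[OF m'] by simp
      moreover have "(\<Sum>i\<le>?N. \<beta> i *\<^sub>Q \<Phi> (\<delta> i v)) t j = (\<Sum>i\<le>?N. \<beta> i * row j (t + int i) v)"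
        if "j \<in> J" for t j
        unfolding sum_app using that
        by (intro sum.cong) (auto simp: \<Phi>_\<delta> scaleQ_fun_def scaleQ_rat_def)
      ultimately show "nrm (sys_space S) (\<Sum>i\<le>?N. \<beta> i *\<^sub>Q ?y i) \<le> c \<longleftrightarrow>
        (\<forall>j\<in>J. \<forall>t. \<bar>\<Sum>i\<le>?N. \<beta> i * row j (t + int i) v\<bar> \<le> c)"
        using nle[OF m'] by simp
    qed
  qed
qed

section \<open>Orbit norms are not determined by finite-dimensional data\<close>

text \<open>The support of \<open>h\<close> lies strictly between \<open>-L\<close> and 0, so of
  points at mutual distance at least \<open>L\<close> at most one meets it and nothing
  accumulates.\<close>

lemma abs_sum_separated_le:
  fixes h :: "int \<Rightarrow> rat" and a :: "'i \<Rightarrow> int"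
  assumes sep: "\<And>i j. i \<in> I \<Longrightarrow> j \<in> I \<Longrightarrow> i \<noteq> j \<Longrightarrow> L \<le> \<bar>a i - a j\<bar>"
    and h: "\<And>t. 0 \<le> t \<or> t \<le> - L \<Longrightarrow> h t = 0" and c: "\<And>t. \<bar>h t\<bar> \<le> c"
  shows "\<bar>\<Sum>i\<in>I. h (a i)\<bar> \<le> c"
proof (cases "\<exists>i\<in>I. h (a i) \<noteq> 0")
  case True
  then obtain i where i: "i \<in> I" "h (a i) \<noteq> 0" by blast
  then have "\<not> (0 \<le> a i \<or> a i \<le> - L)" using h by blast
  then have ai: "- L < a i" "a i < 0" by auto
  have "h (a j) = 0" if j: "j \<in> I - {i}" for j
  proof (rule ccontr)
    assume "h (a j) \<noteq> 0"
    then have "\<not> (0 \<le> a j \<or> a j \<le> - L)" using h by blast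
    then show False using sep[of i j] i(1) j ai by auto
  qed
  then have "(\<Sum>j\<in>I - {i}. h (a j)) = 0" by (intro sum.neutral) blast
  then have "(\<Sum>j\<in>I. h (a j)) = h (a i) \<or> infinite I"
    using i(1) sum.remove[of I i "\<lambda>j. h (a j)"] by auto
  then show ?thesis using c[of "a i"] abs_ge_zero[of "h (a i)"] by auto
next
  case False
  then show ?thesis using order_trans[OF abs_ge_zero c[of 0]] by (simp add: sum.neutral)
qed

lemma poly_shift_abs_le:
  assumes "\<And>t. \<bar>s t\<bar> \<le> c"
  shows "\<bar>poly_shift p s t\<bar> \<le> (\<Sum>j\<le>degree p. \<bar>coeff p j\<bar>) * c"
proof -
  have "\<bar>poly_shift p s t\<bar> \<le> (\<Sum>j\<le>degree p. \<bar>coeff p j * s (t + int j)\<bar>)"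
    unfolding poly_shift_def by (rule sum_abs)
  also have "\<dots> \<le> (\<Sum>j\<le>degree p. \<bar>coeff p j\<bar> * c)"
    unfolding abs_mult using assms by (intro sum_mono mult_left_mono) auto
  finally show ?thesis by (simp add: sum_distrib_right)
qed

text \<open>Applied entirely within the constant part, the recurrence says that the coefficients sum
  to zero; one step later only the leading coefficient meets \<open>s 1\<close>.\<close>

lemma recurrence_from_constant:
  assumes p: "p \<noteq> 0" and s: "\<And>t. t \<le> 0 \<Longrightarrow> s t = (1 :: rat)" and rec: "\<And>t. poly_shift p s t = 0"
  shows "s 1 = 1"
proof -
  let ?n = "degree p"
  have "poly_shift p s (- int ?n) = (\<Sum>j\<le>?n. coeff p j)"
    unfolding poly_shift_def by (intro sum.cong) (auto simp: s)
  then have 1: "(\<Sum>j<?n. coeff p j) + coeff p ?n = 0"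
    using rec[of "- int ?n"] by (simp add: lessThan_Suc_atMost[symmetric])
  have "poly_shift p s (1 - int ?n) = (\<Sum>j<?n. coeff p j * s (1 - int ?n + int j)) + coeff p ?n * s 1"
    unfolding poly_shift_def by (simp add: lessThan_Suc_atMost[symmetric])
  also have "(\<Sum>j<?n. coeff p j * s (1 - int ?n + int j)) = (\<Sum>j<?n. coeff p j)"
    by (intro sum.cong) (auto simp: s)
  finally have "coeff p ?n * s 1 = coeff p ?n * 1" using 1 rec[of "1 - int ?n"] by linarith
  moreover have "coeff p ?n \<noteq> 0" using p by simp
  ultimately show ?thesis by (metis mult_left_cancel)
qed

text \<open>
  The pair \<open>v, f v\<close> spans a copy of the plane with norm \<open>max \<bar>a + b\<bar> \<bar>a\<bar>\<close>. A functional \<open>u\<close> of norm one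
  with \<open>u v = 1\<close> and \<open>u (f v) = 0\<close> is forced to take the value 1 on all preimages of \<open>v\<close>, and
  so its values along the orbit of \<open>v\<close> are not recurrent.
\<close>

definition wandering_vector :: "'a::rat_vector rat_nspace \<Rightarrow> 'a \<Rightarrow> 'a \<Rightarrow> bool"
  where "wandering_vector X v w \<longleftrightarrow>
    nrm X v \<le> 1 \<and> nrm X w \<le> 1 \<and> nrm X (2 *\<^sub>Q v - w) = 2 \<and> nrm X (2 *\<^sub>Q w - v) \<le> 1"

text \<open>As \<open>s 0 = 1 + s 1 / 2\<close>, the bound \<open>s 0 \<le> 1\<close> gives
  \<open>s 1 \<le> 0\<close>, and \<open>2 * s 1 - s 0 \<ge> -1\<close> gives
  \<open>s 1 \<ge> 0\<close>. Going backward, from \<open>s t = 1\<close> the step inequality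
  \<open>2 - s (t - 1) \<le> 1\<close> leaves only the value 1 for the predecessor.\<close>

lemma wandering_sequence:
  fixes s :: "int \<Rightarrow> rat"
  assumes b: "\<And>t. t \<le> 1 \<Longrightarrow> \<bar>s t\<bar> \<le> 1" and d: "\<And>t. t \<le> 0 \<Longrightarrow> \<bar>2 * s (t + 1) - s t\<bar> \<le> 1"
    and 2: "2 * s 0 - s 1 = 2"
  shows "s (- int k) = 1" and "s 1 = 0"
proof -
  have s0: "s 0 = 1" using b[of 0] d[of 0] 2 by (simp add: abs_le_iff)
  then show "s 1 = 0" using 2 by simp
  show "s (- int k) = 1"
  proof (induction k)
    case (Suc k)
    have "\<bar>2 * s (- int k) - s (- int (Suc k))\<bar> \<le> 1" using d[of "- int (Suc k)"] by simp
    then show ?case using Suc b[of "- int (Suc k)"] by (simp add: abs_le_iff)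
  qed (use s0 in simp)
qed

text \<open>\<open>\<alpha>\<close> is an embedding of the system on \<open>X\<close> with map
  \<open>f\<close>, spelled out because \<open>system_embedding\<close> needs both systems over one
  type whereas \<open>X\<close> may lie in another. The sequence \<open>y\<close> follows the orbit
  of \<open>v\<close> for \<open>N\<close> steps inside \<open>S\<close>, even when that orbit
  leaves \<open>V\<close> in \<open>X\<close>.\<close>

definition orbit_extension ::
    "'a::rat_vector rat_nspace \<Rightarrow> 'a set \<Rightarrow> ('a \<Rightarrow> 'a) \<Rightarrow> 'a \<Rightarrow> nat \<Rightarrow>
      (nat \<Rightarrow> rat) isometry_system \<Rightarrow> ('a \<Rightarrow> nat \<Rightarrow> rat) \<Rightarrow> (nat \<Rightarrow> nat \<Rightarrow> rat) \<Rightarrow> bool"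
  where "orbit_extension X V f v N S \<alpha> y \<longleftrightarrow>
    S \<in> isometry_systems polyhedral_class \<and> isometric_embedding X (sys_space S) \<alpha> \<and>
    \<alpha> ` V \<subseteq> sys_dom S \<and> (\<forall>a\<in>V. \<alpha> (f a) = sys_map S (\<alpha> a)) \<and>
    y 0 = \<alpha> v \<and> (\<forall>i<N. y i \<in> sys_dom S \<and> sys_map S (y i) = y (Suc i))"

text \<open>
  Both extensions have the rows \<open>e q\<close> of \<open>partial_isometry_trajectories\<close>; the second has one more row
  \<open>\<omega>\<close>. Each \<open>p(shift) e q\<close> vanishes outside a bounded window, so \<open>p\<close> times a sum of \<open>m\<close> widely
  spaced shifts is bounded on the rows \<open>e q\<close> independently of \<open>m\<close>. The row \<open>\<omega>\<close> is a sum of \<open>m\<close> spaced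
  copies of \<open>p(shift) e q\<close>, which is legitimate since their supports are disjoint, and on it the
  same combination is proportional to \<open>m\<close>.
\<close>

lemma orbit_norm_not_determined:
  fixes X :: "'a::rat_vector rat_nspace"
  assumes X: "polyhedral_space X" and f: "partial_isometry X V W f"
    and v: "v \<in> V" and wv: "wandering_vector X v (f v)"
  shows "\<exists>N \<beta> S\<^sub>1 \<alpha>\<^sub>1 y\<^sub>1 S\<^sub>2 \<alpha>\<^sub>2 y\<^sub>2.
    orbit_extension X V f v N S\<^sub>1 \<alpha>\<^sub>1 y\<^sub>1 \<and> orbit_extension X V f v N S\<^sub>2 \<alpha>\<^sub>2 y\<^sub>2 \<and>
    nrm (sys_space S\<^sub>1) (\<Sum>i\<le>N. \<beta> i *\<^sub>Q y\<^sub>1 i) \<noteq> nrm (sys_space S\<^sub>2) (\<Sum>i\<le>N. \<beta> i *\<^sub>Q y\<^sub>2 i)"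
proof -
  have nX: "rat_normed_space X" and fdX: "rat_finite_dim (carrier X)"
    using X by (simp_all add: polyhedral_space_def)
  note XS = rat_normed_spaceD(1)[OF nX] and F = partial_isometryD[OF f]
  obtain U :: "('a \<Rightarrow> rat) set" where U: "finite U" "U \<noteq> {}"
    and Ulin: "\<And>u. u \<in> U \<Longrightarrow> rat_linear_on (carrier X) u"
    and Unrm: "\<And>x. x \<in> carrier X \<Longrightarrow> nrm X x = Max ((\<lambda>u. \<bar>u x\<bar>) ` U)"
    using X unfolding polyhedral_space_def by blast
  obtain e :: "('a \<Rightarrow> rat) \<Rightarrow> int \<Rightarrow> 'a \<Rightarrow> rat" and p d
    where e0: "\<And>q x. q \<in> U \<Longrightarrow> e q 0 x = q x"
      and elin: "\<And>q t. q \<in> U \<Longrightarrow> rat_linear_on (carrier X) (e q t)"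
      and ele: "\<And>q t x. q \<in> U \<Longrightarrow> x \<in> carrier X \<Longrightarrow> \<bar>e q t x\<bar> \<le> nrm X x"
      and eqv: "\<And>q t x. q \<in> U \<Longrightarrow> x \<in> V \<Longrightarrow> e q (t + 1) x = e q t (f x)"
      and ewin: "\<And>q t N xs. q \<in> U \<Longrightarrow> \<exists>r\<in>U. \<exists>t'\<in>{- int N..0}.
        \<bar>\<Sum>i\<le>N. e q (t + int i) (xs i)\<bar> \<le> \<bar>\<Sum>i\<le>N. e r (t' + int i) (xs i)\<bar>"
      and p: "p \<noteq> 0"
      and kill: "\<And>q t x. q \<in> U \<Longrightarrow> 0 \<le> t \<or> t \<le> - int d \<Longrightarrow> poly_shift p (\<lambda>t. e q t x) t = 0"
    using partial_isometry_trajectories[OF U Ulin Unrm f] by blast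
  have att: "\<exists>u\<in>U. \<bar>u x\<bar> = nrm X x" if "x \<in> carrier X" for x
  proof -
    have "Max ((\<lambda>u. \<bar>u x\<bar>) ` U) \<in> (\<lambda>u. \<bar>u x\<bar>) ` U" using U by (intro Max_in) auto
    then show ?thesis using Unrm[OF that] by auto
  qed
  have vX: "v \<in> carrier X" "f v \<in> carrier X" using v F(2,4,6) by auto
  have dX: "2 *\<^sub>Q x - y \<in> carrier X" if "x \<in> carrier X" "y \<in> carrier X" for x y
    using that XS by (intro rat_vector.subspace_diff rat_vector.subspace_scale)
  have ed: "e q t (2 *\<^sub>Q x - y) = 2 * e q t x - e q t y"
    if "q \<in> U" "x \<in> carrier X" "y \<in> carrier X" for q t x y
    using rat_linear_on_diff[OF elin[OF that(1)] XS, of "2 *\<^sub>Q x" y] that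
      rat_linear_onD(2)[OF elin[OF that(1)] that(2)] rat_vector.subspace_scale[OF XS]
    by (simp add: scaleQ_rat_def)
  have nv: "nrm X v \<le> 1" "nrm X (2 *\<^sub>Q v - f v) = 2" "nrm X (2 *\<^sub>Q f v - v) \<le> 1"
    using wv by (simp_all add: wandering_vector_def)
  \<comment> \<open>Any contractive row of bounded support that is compatible with \<open>f\<close>
    may be adjoined to the rows \<open>e q\<close>. Both extensions arise in this way, the first
    with the zero row.\<close>
  have extend: "\<exists>S \<alpha> y. orbit_extension X V f v (Suc M) S \<alpha> y \<and>
      (\<forall>\<beta> c. nrm (sys_space S) (\<Sum>i\<le>Suc M. \<beta> i *\<^sub>Q y i) \<le> c \<longleftrightarrow>
        (\<forall>q\<in>U. \<forall>t. \<bar>\<Sum>i\<le>Suc M. \<beta> i * e q (t + int i) v\<bar> \<le> c) \<and>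
        (\<forall>t. \<bar>\<Sum>i\<le>Suc M. \<beta> i * \<omega> (t + int i) v\<bar> \<le> c))"
    if \<omega>: "\<And>t. rat_linear_on (carrier X) (\<omega> t)"
      "\<And>t x. x \<in> carrier X \<Longrightarrow> \<bar>\<omega> t x\<bar> \<le> nrm X x"
      "\<And>t x. x \<in> V \<Longrightarrow> \<omega> (t + 1) x = \<omega> t (f x)"
      "\<And>t x. t < - R \<or> R < t \<Longrightarrow> \<omega> t x = 0" for \<omega> :: "int \<Rightarrow> 'a \<Rightarrow> rat" and R M
  proof -
    define J where "J = insert None (Some ` U)"
    define row where "row j = (case j of None \<Rightarrow> \<omega> | Some q \<Rightarrow> e q)" for j
    \<comment> \<open>Wide enough for \<open>ewin\<close>, whose times lie in
      \<open>{- int (Suc M)..0}\<close>, and for every \<open>t\<close> such that one of the times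
      from \<open>t\<close> to \<open>t + Suc M\<close> meets the support of
      \<open>\<omega>\<close>.\<close>
    define R' where "R' = \<bar>R\<bar> + int (Suc M)"
    have "\<exists>S \<alpha>. S \<in> isometry_systems polyhedral_class \<and> isometric_embedding X (sys_space S) \<alpha> \<and>
      \<alpha> ` V \<subseteq> sys_dom S \<and> (\<forall>a\<in>V. \<alpha> (f a) = sys_map S (\<alpha> a)) \<and>
      (\<forall>v\<in>carrier X. \<exists>y. y 0 = \<alpha> v \<and>
        (\<forall>i<Suc M. y i \<in> sys_dom S \<and> sys_map S (y i) = y (Suc i)) \<and>
        (\<forall>\<beta> c. nrm (sys_space S) (\<Sum>i\<le>Suc M. \<beta> i *\<^sub>Q y i) \<le> c \<longleftrightarrow>
          (\<forall>j\<in>J. \<forall>t. \<bar>\<Sum>i\<le>Suc M. \<beta> i * row j (t + int i) v\<bar> \<le> c)))"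
    proof (rule polyhedral_dilation[OF nX fdX f, where R = R'])
      show "finite J" "J \<noteq> {}" using U by (simp_all add: J_def)
      show "rat_linear_on (carrier X) (row j t)" if "j \<in> J" for j t
        using that \<omega>(1) elin by (auto simp: J_def row_def)
      show "\<bar>row j t x\<bar> \<le> nrm X x" if "j \<in> J" "x \<in> carrier X" for j t x
        using that \<omega>(2) ele by (auto simp: J_def row_def)
      show "\<exists>j\<in>J. nrm X x \<le> \<bar>row j 0 x\<bar>" if x: "x \<in> carrier X" for x
      proof -
        obtain u where "u \<in> U" "\<bar>u x\<bar> = nrm X x" using att[OF x] by blast
        then show ?thesis using e0 by (intro bexI[of _ "Some u"]) (auto simp: J_def row_def)
      qed
      show "row j (t + 1) x = row j t (f x)" if "j \<in> J" "x \<in> V" for j t x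
        using that \<omega>(3) eqv by (auto simp: J_def row_def)
      show "\<exists>j'\<in>J. \<exists>t'\<in>{- R'..R'}. \<bar>\<Sum>i\<le>Suc M. row j (t + int i) (xs i)\<bar>
          \<le> \<bar>\<Sum>i\<le>Suc M. row j' (t' + int i) (xs i)\<bar>" if j: "j \<in> J" for j t xs
      proof (cases j)
        case (Some q)
        then have q: "q \<in> U" using j by (auto simp: J_def)
        obtain r t' where r: "r \<in> U" "t' \<in> {- int (Suc M)..0}"
          "\<bar>\<Sum>i\<le>Suc M. e q (t + int i) (xs i)\<bar> \<le> \<bar>\<Sum>i\<le>Suc M. e r (t' + int i) (xs i)\<bar>"
          using ewin[OF q] by blast
        show ?thesis
        proof (intro bexI[of _ "Some r"] bexI[of _ t'])
          show "\<bar>\<Sum>i\<le>Suc M. row j (t + int i) (xs i)\<bar> \<le> \<bar>\<Sum>i\<le>Suc M. row (Some r) (t' + int i) (xs i)\<bar>"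
            using r(3) Some by (simp only: row_def option.case)
        qed (use r in \<open>auto simp: J_def R'_def\<close>)
      next
        case None
        show ?thesis
        proof (cases "t \<in> {- R'..R'}")
          case True
          then show ?thesis using j by (intro bexI[of _ j] bexI[of _ t]) simp_all
        next
          case False
          have "row j (t + int i) (xs i) = 0" if "i \<in> {..Suc M}" for i
          proof -
            have "t < - R' \<or> R' < t" using False by auto
            then have "t + int i < - R \<or> R < t + int i"
              using that abs_ge_self[of R] abs_ge_minus_self[of R] by (auto simp: R'_def)
            then show ?thesis using None \<omega>(4) by (simp add: row_def)
          qed
          then have "(\<Sum>i\<le>Suc M. row j (t + int i) (xs i)) = 0" by (intro sum.neutral) blast
          moreover have "0 \<in> {- R'..R'}" by (simp add: R'_def)
          ultimately show ?thesis using j by (intro bexI[of _ j] bexI[of _ 0]) simp_all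
        qed
      qed
    qed
    then obtain S \<alpha> where S: "S \<in> isometry_systems polyhedral_class"
      "isometric_embedding X (sys_space S) \<alpha>" "\<alpha> ` V \<subseteq> sys_dom S"
      "\<forall>a\<in>V. \<alpha> (f a) = sys_map S (\<alpha> a)"
      and all: "\<forall>v\<in>carrier X. \<exists>y. y 0 = \<alpha> v \<and>
        (\<forall>i<Suc M. y i \<in> sys_dom S \<and> sys_map S (y i) = y (Suc i)) \<and>
        (\<forall>\<beta> c. nrm (sys_space S) (\<Sum>i\<le>Suc M. \<beta> i *\<^sub>Q y i) \<le> c \<longleftrightarrow>
          (\<forall>j\<in>J. \<forall>t. \<bar>\<Sum>i\<le>Suc M. \<beta> i * row j (t + int i) v\<bar> \<le> c))" by blast
    from bspec[OF all vX(1)] obtain y where y: "y 0 = \<alpha> v"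
      "\<forall>i<Suc M. y i \<in> sys_dom S \<and> sys_map S (y i) = y (Suc i)"
      "\<forall>\<beta> c. nrm (sys_space S) (\<Sum>i\<le>Suc M. \<beta> i *\<^sub>Q y i) \<le> c \<longleftrightarrow>
          (\<forall>j\<in>J. \<forall>t. \<bar>\<Sum>i\<le>Suc M. \<beta> i * row j (t + int i) v\<bar> \<le> c)"
      by (elim exE conjE)
    have **: "orbit_extension X V f v (Suc M) S \<alpha> y"
      using S y(1,2) by (simp add: orbit_extension_def)
    have split: "(\<forall>j\<in>J. P (row j)) \<longleftrightarrow> (\<forall>q\<in>U. P (e q)) \<and> P \<omega>" for P
      by (auto simp: J_def row_def)
    have *: "(\<forall>j\<in>J. \<forall>t. \<bar>\<Sum>i\<le>Suc M. \<beta> i * row j (t + int i) v\<bar> \<le> c) \<longleftrightarrow>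
        (\<forall>q\<in>U. \<forall>t. \<bar>\<Sum>i\<le>Suc M. \<beta> i * e q (t + int i) v\<bar> \<le> c) \<and>
        (\<forall>t. \<bar>\<Sum>i\<le>Suc M. \<beta> i * \<omega> (t + int i) v\<bar> \<le> c)" for \<beta> c
      by (rule split)
    show ?thesis using ** y(3) unfolding * by (intro exI[of _ S] exI[of _ \<alpha>] exI[of _ y] conjI)
  qed
  obtain q where q: "q \<in> U" "\<bar>q (2 *\<^sub>Q v - f v)\<bar> = 2"
    using att[OF dX[OF vX]] nv(2) by auto
  define \<eta> where "\<eta> = poly_shift p (\<lambda>t. e q t v)"
  \<comment> \<open>Were \<open>\<eta>\<close> zero, \<open>p\<close> would be a recurrence for
    \<open>q\<close> along the orbit of \<open>v\<close>. Up to the sign \<open>\<sigma>\<close>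
    these values are 1 at all nonpositive times and 0 at time 1, which
    \<open>recurrence_from_constant\<close> forbids.\<close>
  have "\<exists>t. \<eta> t \<noteq> 0"
  proof (rule ccontr)
    assume "\<not> ?thesis"
    then have rec: "poly_shift p (\<lambda>t. e q t v) t = 0" for t by (simp add: \<eta>_def)
    define \<sigma> :: rat where "\<sigma> = (if 0 \<le> q (2 *\<^sub>Q v - f v) then 1 else - 1)"
    define s where "s t = \<sigma> * e q t v" for t
    have step: "e q (t + 1) v = e q t (f v)" for t using eqv[OF q(1) v] .
    have abs\<sigma>: "\<bar>\<sigma> * a\<bar> = \<bar>a\<bar>" for a by (simp add: \<sigma>_def)
    have b: "\<bar>s t\<bar> \<le> 1" for t
      using ele[OF q(1) vX(1), of t] nv(1) unfolding s_def abs\<sigma> by linarith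
    have d: "\<bar>2 * s (t + 1) - s t\<bar> \<le> 1" for t
    proof -
      have "2 * s (t + 1) - s t = \<sigma> * e q t (2 *\<^sub>Q f v - v)"
        unfolding s_def step ed[OF q(1) vX(2,1)] by (simp add: algebra_simps)
      then show ?thesis
        using ele[OF q(1) dX[OF vX(2,1)], of t] nv(3) abs\<sigma> by (metis order_trans)
    qed
    have "2 * s 0 - s 1 = \<sigma> * e q 0 (2 *\<^sub>Q v - f v)"
      using step[of 0] unfolding s_def ed[OF q(1) vX] by (simp add: algebra_simps)
    then have 2: "2 * s 0 - s 1 = 2" using q(2) by (auto simp: e0[OF q(1)] \<sigma>_def abs_if split: if_splits)
    note ws = wandering_sequence[of s, OF b d 2]
    have "s t = 1" if "t \<le> 0" for t using ws(1)[of "nat (- t)"] that by simp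
    moreover have "poly_shift p s t = 0" for t
      using poly_shift_mult_seq[of p \<sigma> "\<lambda>t. e q t v" t] rec[of t] by (simp add: s_def[abs_def])
    ultimately have "s 1 = 1" using recurrence_from_constant[OF p] by blast
    then show False using ws(2) by simp
  qed
  then obtain t1 where t1: "\<eta> t1 \<noteq> 0" by blast
  have \<eta>0: "\<eta> t = 0" if "0 \<le> t \<or> t \<le> - int d" for t using kill[OF q(1) that] by (simp add: \<eta>_def)
  \<comment> \<open>This is \<open>p^2\<close> in the shift applied to \<open>e q\<close> at
    \<open>v\<close>: one factor comes from the combination \<open>Q * p\<close>, the other from the
    construction of \<open>\<omega>\<close>.\<close>
  define w where "w = poly_shift p \<eta>"
  obtain t0 where t0: "w t0 \<noteq> 0"
    using poly_shift_nonzero[OF p, of 0 \<eta>] t1 \<eta>0 unfolding w_def by force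
  \<comment> \<open>Applying \<open>p\<close> once more widens the support by at most
    \<open>degree p\<close>, so both \<open>\<eta>\<close> and \<open>w\<close> live strictly
    between \<open>-L\<close> and 0.\<close>
  define L where "L = int (d + degree p)"
  have w0: "w t = 0" if "0 \<le> t \<or> t \<le> - L" for t
    unfolding w_def poly_shift_def
  proof (rule sum.neutral, intro ballI)
    fix j assume "j \<in> {..degree p}"
    then have "0 \<le> t + int j \<or> t + int j \<le> - int d" using that by (auto simp: L_def)
    then show "coeff p j * \<eta> (t + int j) = 0" using \<eta>0 by simp
  qed
  have "\<not> (0 \<le> t0 \<or> t0 \<le> - L)" using t0 w0 by blast
  then have t0L: "- L < t0" "t0 < 0" by auto
  have killL: "poly_shift p (\<lambda>t. e r t x) t = 0" if "r \<in> U" "0 \<le> t \<or> t \<le> - L" for r t x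
    using kill[OF that(1), of t x] that(2) by (auto simp: L_def)
  define c where "c = (\<Sum>j\<le>degree p. \<bar>coeff p j\<bar>)"
  have "\<bar>coeff p (degree p)\<bar> \<le> c" unfolding c_def by (rule member_le_sum) auto
  moreover have "0 < \<bar>coeff p (degree p)\<bar>" using p by simp
  ultimately have c: "0 < c" by linarith
  have pe: "\<bar>poly_shift p (\<lambda>t. e r t x) t\<bar> \<le> c * nrm X x" if "r \<in> U" "x \<in> carrier X" for r x t
    unfolding c_def using ele that by (intro poly_shift_abs_le) blast
  \<comment> \<open>Chosen so that the combination on \<open>\<omega>\<close>, of size
    \<open>m * \<bar>w t0\<bar> / c\<close>, exceeds the bound \<open>c\<close> valid on the rows
    \<open>e q\<close>.\<close>
  obtain m :: nat where m: "c * c / \<bar>w t0\<bar> < of_nat m" using reals_Archimedean2 by blast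
  then have m: "c * c < of_nat m * \<bar>w t0\<bar>" using t0 by (simp add: pos_divide_less_eq)
  \<comment> \<open>The powers of the shift in \<open>Q\<close> are \<open>L\<close> apart, and
    \<open>\<omega>\<close> uses the same spacing in the opposite direction; so the \<open>m\<close>
    terms of \<open>Q\<close> read the \<open>m\<close> copies in \<open>\<omega>\<close> all at the
    same relative time \<open>t0\<close>.\<close>
  define Q where "Q = (\<Sum>i<m. monom (1::rat) (i * nat L))"
  have Q: "poly_shift (Q * p) s t = (\<Sum>i<m. poly_shift p s (t + int i * L))" for s t
    using t0L by (simp add: poly_shift_mult Q_def poly_shift_sum poly_shift_monom)
  define M where "M = degree (Q * p)"
  have M: "(\<Sum>i\<le>Suc M. coeff (Q * p) i * s (t + int i)) = poly_shift (Q * p) s t" for s t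
    by (rule poly_shift_altdef[symmetric]) (simp add: M_def)
  have sep: "L \<le> \<bar>(b + int i * L) - (b + int j * L)\<bar>" if "i \<noteq> j" for i j :: nat and b
  proof -
    have "\<bar>(b + int i * L) - (b + int j * L)\<bar> = \<bar>int i - int j\<bar> * L"
      using t0L by (simp add: left_diff_distrib[symmetric] abs_mult)
    moreover have "1 * L \<le> \<bar>int i - int j\<bar> * L" using that t0L by (intro mult_right_mono) auto
    ultimately show ?thesis by simp
  qed
  have small: "\<bar>\<Sum>i\<le>Suc M. coeff (Q * p) i * e r (t + int i) v\<bar> \<le> c" if r: "r \<in> U" for r t
    unfolding M[of "\<lambda>t. e r t v"] Q
  proof (rule abs_sum_separated_le)
    show "L \<le> \<bar>(t + int i * L) - (t + int j * L)\<bar>" if "i \<noteq> j" for i j using sep[OF that] .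
    show "\<bar>poly_shift p (\<lambda>t. e r t v) t'\<bar> \<le> c" for t'
    proof -
      have "c * nrm X v \<le> c * 1" using c nv(1) by (intro mult_left_mono) auto
      then show ?thesis using pe[OF r vX(1), of t'] by linarith
    qed
  qed (rule killL[OF r])
  \<comment> \<open>At each time at most one of the copies contributes, and it is bounded by
    \<open>c\<close> times the norm of \<open>x\<close>; division by \<open>c\<close> makes the row
    contractive.\<close>
  define \<omega> where "\<omega> t x = 1 / c * (\<Sum>i<m. poly_shift p (\<lambda>t. e q t x) (t + - (int i * L)))" for t x
  have \<omega>lin: "rat_linear_on (carrier X) (\<omega> t)" for t
  proof -
    have "poly_shift p (\<lambda>t. e q t (x + y)) t = poly_shift p (\<lambda>t. e q t x) t + poly_shift p (\<lambda>t. e q t y) t"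
      if "x \<in> carrier X" "y \<in> carrier X" for x y t
      using rat_linear_onD(1)[OF elin[OF q(1)] that]
      by (simp add: poly_shift_def sum.distrib distrib_left)
    moreover have "poly_shift p (\<lambda>t. e q t (b *\<^sub>Q x)) t = b * poly_shift p (\<lambda>t. e q t x) t"
      if "x \<in> carrier X" for b x t
      using rat_linear_onD(2)[OF elin[OF q(1)] that]
      by (simp add: poly_shift_mult_seq scaleQ_rat_def)
    ultimately show ?thesis
      by (simp add: rat_linear_on_def \<omega>_def sum.distrib distrib_left sum_distrib_left scaleQ_rat_def
          mult.left_commute)
  qed
  have \<omega>le: "\<bar>\<omega> t x\<bar> \<le> nrm X x" if x: "x \<in> carrier X" for t x
  proof -
    have "\<bar>\<Sum>i<m. poly_shift p (\<lambda>t. e q t x) (t + - (int i * L))\<bar> \<le> c * nrm X x"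
    proof (rule abs_sum_separated_le)
      show "L \<le> \<bar>(t + - (int i * L)) - (t + - (int j * L))\<bar>" if "i \<noteq> j" for i j
        using sep[OF that, of 0] by linarith
    qed (use killL[OF q(1)] pe[OF q(1) x] in auto)
    then have "\<bar>1 / c\<bar> * \<bar>\<Sum>i<m. poly_shift p (\<lambda>t. e q t x) (t + - (int i * L))\<bar> \<le> \<bar>1 / c\<bar> * (c * nrm X x)"
      by (rule mult_left_mono) simp
    then show ?thesis using c unfolding \<omega>_def abs_mult by simp
  qed
  have \<omega>eqv: "\<omega> (t + 1) x = \<omega> t (f x)" if "x \<in> V" for t x
  proof -
    have "poly_shift p (\<lambda>t. e q t x) (t + 1 + k) = poly_shift p (\<lambda>t. e q t (f x)) (t + k)" for k
      using eqv[OF q(1) that] poly_shift_translate[of p "\<lambda>t. e q t x" 1 "t + k"]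
      by (simp add: algebra_simps)
    then show ?thesis by (simp only: \<omega>_def)
  qed
  have \<omega>0: "\<omega> t x = 0" if t: "t < - (int m * L + L) \<or> int m * L + L < t" for t x
  proof -
    have "poly_shift p (\<lambda>t. e q t x) (t + - (int i * L)) = 0" if i: "i < m" for i
    proof (rule killL[OF q(1)])
      have "0 \<le> int i * L" "int i * L \<le> int m * L" using i t0L by (auto intro: mult_right_mono)
      then show "0 \<le> t + - (int i * L) \<or> t + - (int i * L) \<le> - L" using t t0L by linarith
    qed
    then show ?thesis by (simp add: \<omega>_def)
  qed
  have big: "(\<Sum>i\<le>Suc M. coeff (Q * p) i * \<omega> (t0 + int i) v) = of_nat m * w t0 / c"
  proof -
    have "poly_shift p (\<lambda>t. \<omega> t v) t = 1 / c * (\<Sum>i<m. w (t + - (int i * L)))" for t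
      unfolding \<omega>_def poly_shift_mult_seq poly_shift_sum_seq
      unfolding w_def \<eta>_def by (simp only: poly_shift_translate)
    then have "(\<Sum>i\<le>Suc M. coeff (Q * p) i * \<omega> (t0 + int i) v) =
        (\<Sum>j<m. 1 / c * (\<Sum>i<m. w (t0 + int j * L + - (int i * L))))"
      unfolding M[of "\<lambda>t. \<omega> t v"] Q by simp
    also have "\<dots> = (\<Sum>j<m. 1 / c * w t0)"
    proof (rule sum.cong)
      fix j assume j: "j \<in> {..<m}"
      \<comment> \<open>Any index other than \<open>j\<close> moves \<open>t0\<close> by at least
        \<open>L\<close>, out of the interval that contains the support of \<open>w\<close>.\<close>
      have "(\<Sum>i<m. w (t0 + int j * L + - (int i * L))) = (\<Sum>i<m. if i = j then w t0 else 0)"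
      proof (rule sum.cong)
        show "w (t0 + int j * L + - (int i * L)) = (if i = j then w t0 else 0)" for i
        proof (cases "i = j")
          case False
          then have "L \<le> \<bar>int j * L - int i * L\<bar>" using sep[of j i 0] by simp
          then have "0 \<le> t0 + int j * L + - (int i * L) \<or> t0 + int j * L + - (int i * L) \<le> - L"
            using t0L by linarith
          then show ?thesis using False w0 by simp
        qed simp
      qed simp
      then show "1 / c * (\<Sum>i<m. w (t0 + int j * L + - (int i * L))) = 1 / c * w t0" using j by simp
    qed simp
    finally show ?thesis by simp
  qed
  obtain S\<^sub>1 \<alpha>\<^sub>1 y\<^sub>1 where 1: "orbit_extension X V f v (Suc M) S\<^sub>1 \<alpha>\<^sub>1 y\<^sub>1"
    "\<And>\<beta> c. nrm (sys_space S\<^sub>1) (\<Sum>i\<le>Suc M. \<beta> i *\<^sub>Q y\<^sub>1 i) \<le> c \<longleftrightarrow>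
      (\<forall>q\<in>U. \<forall>t. \<bar>\<Sum>i\<le>Suc M. \<beta> i * e q (t + int i) v\<bar> \<le> c) \<and>
      (\<forall>t. \<bar>\<Sum>i\<le>Suc M. \<beta> i * (\<lambda>_ _. 0) (t + int i) v\<bar> \<le> c)"
    using extend[of "\<lambda>_ _. 0" 0 M] rat_normed_spaceD(2)[OF nX]
    by (auto simp: rat_linear_on_def scaleQ_rat_def simp del: sum.atMost_Suc)
  obtain S\<^sub>2 \<alpha>\<^sub>2 y\<^sub>2 where 2: "orbit_extension X V f v (Suc M) S\<^sub>2 \<alpha>\<^sub>2 y\<^sub>2"
    "\<And>\<beta> c. nrm (sys_space S\<^sub>2) (\<Sum>i\<le>Suc M. \<beta> i *\<^sub>Q y\<^sub>2 i) \<le> c \<longleftrightarrow>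
      (\<forall>q\<in>U. \<forall>t. \<bar>\<Sum>i\<le>Suc M. \<beta> i * e q (t + int i) v\<bar> \<le> c) \<and>
      (\<forall>t. \<bar>\<Sum>i\<le>Suc M. \<beta> i * \<omega> (t + int i) v\<bar> \<le> c)"
    using extend[of \<omega>, OF \<omega>lin \<omega>le \<omega>eqv \<omega>0] by blast
  have "nrm (sys_space S\<^sub>1) (\<Sum>i\<le>Suc M. coeff (Q * p) i *\<^sub>Q y\<^sub>1 i) \<le> c"
    using 1(2) small c by simp
  moreover have "\<not> nrm (sys_space S\<^sub>2) (\<Sum>i\<le>Suc M. coeff (Q * p) i *\<^sub>Q y\<^sub>2 i) \<le> c"
  proof
    assume "nrm (sys_space S\<^sub>2) (\<Sum>i\<le>Suc M. coeff (Q * p) i *\<^sub>Q y\<^sub>2 i) \<le> c"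
    then have "\<bar>\<Sum>i\<le>Suc M. coeff (Q * p) i * \<omega> (t0 + int i) v\<bar> \<le> c"
      unfolding 2(2) by (elim conjE allE)
    then have "\<bar>of_nat m * w t0 / c\<bar> \<le> c" by (simp only: big)
    then have "of_nat m * \<bar>w t0\<bar> \<le> c * c" using c by (simp add: abs_mult pos_divide_le_eq)
    then show False using m by simp
  qed
  ultimately have "nrm (sys_space S\<^sub>1) (\<Sum>i\<le>Suc M. coeff (Q * p) i *\<^sub>Q y\<^sub>1 i) \<noteq>
      nrm (sys_space S\<^sub>2) (\<Sum>i\<le>Suc M. coeff (Q * p) i *\<^sub>Q y\<^sub>2 i)" by metis
  with 1(1) 2(1) show ?thesis by (intro exI conjI)
qed

section \<open>Failure of the Hrushovski and weak amalgamation properties\<close>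

text \<open>The maximum-norm plane with \<open>v = (1, 1)\<close> and \<open>f v = (1, 0)\<close>,
  so that \<open>a v + b f v\<close> has coordinates \<open>a + b\<close> and \<open>a\<close>. The
  map \<open>f\<close> keeps only the first coordinate; it is isometric on the line through
  \<open>v\<close> because both coordinates agree there.\<close>

lemma wandering_partial_isometry:
  obtains X V W f v where "X \<in> polyhedral_class" "partial_isometry X V W f" "v \<in> V"
    "wandering_vector X v (f v)"
proof -
  define X :: "(nat \<Rightarrow> rat) rat_nspace"
    where "X = \<lparr>carrier = {x. \<forall>n\<ge>2. x n = 0}, nrm = (\<lambda>x. max \<bar>x 0\<bar> \<bar>x 1\<bar>)\<rparr>"
  define e :: "nat \<Rightarrow> nat \<Rightarrow> rat" where "e i = (\<lambda>n. if n = i then 1 else 0)" for i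
  define f :: "(nat \<Rightarrow> rat) \<Rightarrow> nat \<Rightarrow> rat" where "f x = x 0 *\<^sub>Q e 0" for x
  define v where "v = e 0 + e 1"
  define V where "V = rat_vector.span {v}"
  note app = scaleQ_fun_def scaleQ_rat_def
  have XS: "rat_vector.subspace (carrier X)"
    by (auto simp: X_def rat_vector.subspace_def app)
  have nX: "rat_normed_space X"
    unfolding rat_normed_space_def
  proof (intro conjI ballI allI XS)
    fix x assume x: "x \<in> carrier X"
    show "0 \<le> nrm X x" by (simp add: X_def le_max_iff_disj)
    show "nrm X x = 0 \<longleftrightarrow> x = 0"
    proof
      assume "nrm X x = 0"
      then have "\<bar>x 0\<bar> \<le> 0" "\<bar>x 1\<bar> \<le> 0" unfolding X_def by (simp_all add: max_def split: if_splits)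
      then have "x n = 0" for n using x by (cases "n = 0"; cases "n = 1") (auto simp: X_def)
      then show "x = 0" by (auto simp: fun_eq_iff)
    qed (simp add: X_def)
    show "nrm X (x + y) \<le> nrm X x + nrm X y" for y
      by (auto simp: X_def intro: order_trans[OF abs_triangle_ineq] add_mono)
    show "nrm X (c *\<^sub>Q x) = \<bar>c\<bar> * nrm X x" for c
      by (simp add: X_def app abs_mult max_mult_distrib_left)
  qed
  have eX: "e 0 \<in> carrier X" "e 1 \<in> carrier X" by (auto simp: X_def e_def)
  have "carrier X = rat_vector.span {e 0, e 1}"
  proof
    show "rat_vector.span {e 0, e 1} \<subseteq> carrier X" using eX XS by (intro rat_vector.span_minimal) auto
    show "carrier X \<subseteq> rat_vector.span {e 0, e 1}"
    proof
      fix x assume x: "x \<in> carrier X"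
      have "x n = (x 0 *\<^sub>Q e 0 + x 1 *\<^sub>Q e 1) n" for n
        using x by (cases "n = 0"; cases "n = 1") (auto simp: X_def e_def app)
      then have "x = x 0 *\<^sub>Q e 0 + x 1 *\<^sub>Q e 1" by blast
      then show "x \<in> rat_vector.span {e 0, e 1}"
        by (metis insertI1 insertI2 rat_vector.span_add rat_vector.span_base rat_vector.span_scale)
    qed
  qed
  then have "rat_finite_dim (carrier X)"
    unfolding rat_finite_dim_def by (intro exI[of _ "{e 0, e 1}"]) simp
  then have "X \<in> polyhedral_class"
    unfolding polyhedral_class_def polyhedral_space_def using nX
    by (auto intro!: exI[of _ "{\<lambda>x. x 0, \<lambda>x. x 1}"] simp: rat_linear_on_def app X_def)
  moreover have "partial_isometry X V (f ` V) f"
  proof (rule partial_isometryI[OF nX])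
    show "rat_vector.subspace V" by (simp add: V_def rat_vector.subspace_span)
    have "v \<in> carrier X" using eX rat_vector.subspace_add[OF XS] by (simp add: v_def)
    then show VX: "V \<subseteq> carrier X" unfolding V_def using XS by (intro rat_vector.span_minimal) auto
    show "f ` V \<subseteq> carrier X" using eX rat_vector.subspace_scale[OF XS] by (auto simp: f_def)
    show "rat_linear_on V f"
      by (auto simp: rat_linear_on_def f_def fun_eq_iff algebra_simps app)
    show "nrm X (f x) = nrm X x" if "x \<in> V" for x
      using that unfolding V_def rat_vector.span_singleton
      by (auto simp: X_def f_def v_def e_def app)
  qed
  moreover have "v \<in> V" by (simp add: V_def rat_vector.span_base)
  moreover have "wandering_vector X v (f v)"
    by (simp add: wandering_vector_def X_def f_def v_def e_def app)
  ultimately show thesis by (rule that)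
qed

lemma wandering_vector_isometric:
  assumes X: "rat_normed_space X" and \<alpha>: "isometric_embedding X Y \<alpha>"
    and "v \<in> carrier X" "w \<in> carrier X" "wandering_vector X v w"
  shows "wandering_vector Y (\<alpha> v) (\<alpha> w)"
proof -
  note XS = rat_normed_spaceD(1)[OF X] and A = isometric_embeddingD[OF \<alpha>]
  have "nrm Y (2 *\<^sub>Q \<alpha> a - \<alpha> b) = nrm X (2 *\<^sub>Q a - b)" if "a \<in> carrier X" "b \<in> carrier X" for a b
  proof -
    have a: "2 *\<^sub>Q a \<in> carrier X" using rat_vector.subspace_scale[OF XS that(1)] .
    have "\<alpha> (2 *\<^sub>Q a - b) = 2 *\<^sub>Q \<alpha> a - \<alpha> b"
      using rat_linear_on_diff[OF A(2) XS a that(2)] rat_linear_onD(2)[OF A(2) that(1)] by simp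
    then show ?thesis using A(4)[OF rat_vector.subspace_diff[OF XS a that(2)]] by simp
  qed
  then show ?thesis using assms(3-5) A(4) by (simp add: wandering_vector_def)
qed

text \<open>Surjectivity supplies the past of the orbit, finite dimension a monic linear relation,
  and injectivity carries the relation to all times; the contradiction is then with
  \<open>recurrence_from_constant\<close>.\<close>

lemma no_wandering_vector_of_isometry:
  fixes B :: "'a::rat_vector rat_nspace"
  assumes B: "polyhedral_space B" and g: "surj_isometry B B g" and v: "v \<in> carrier B"
  shows "\<not> wandering_vector B v (g v)"
proof
  assume wv: "wandering_vector B v (g v)"
  have nB: "rat_normed_space B" and fdB: "rat_finite_dim (carrier B)"
    using B by (simp_all add: polyhedral_space_def)
  have ge: "isometric_embedding B B g" and gB: "g ` carrier B = carrier B"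
    using g by (simp_all add: surj_isometry_def)
  note BS = rat_normed_spaceD(1)[OF nB] and G = isometric_embeddingD[OF ge]
  obtain U :: "('a \<Rightarrow> rat) set" where U: "finite U" "U \<noteq> {}"
    and Ulin: "\<And>u. u \<in> U \<Longrightarrow> rat_linear_on (carrier B) u"
    and Unrm: "\<And>x. x \<in> carrier B \<Longrightarrow> nrm B x = Max ((\<lambda>u. \<bar>u x\<bar>) ` U)"
    using B unfolding polyhedral_space_def by blast
  define h where "h = inv_into (carrier B) g"
  have h: "h x \<in> carrier B" "g (h x) = x" if "x \<in> carrier B" for x
    using gB that by (auto simp: h_def inv_into_into f_inv_into_f)
  define x :: "int \<Rightarrow> 'a" where "x t = (if 0 \<le> t then (g ^^ nat t) v else (h ^^ nat (- t)) v)" for t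
  have xB: "x t \<in> carrier B" for t
  proof -
    have "(g ^^ n) v \<in> carrier B \<and> (h ^^ n) v \<in> carrier B" for n
      using v G(1) h(1) by (induction n) auto
    then show ?thesis by (simp add: x_def)
  qed
  have gx: "g (x t) = x (t + 1)" for t
  proof (cases "0 \<le> t")
    case True
    then have "nat (t + 1) = Suc (nat t)" by simp
    then show ?thesis using True by (simp add: x_def)
  next
    case False
    then have "nat (- t) = Suc (nat (- t - 1))" by simp
    then have "x t = h (x (t + 1))" using False by (auto simp: x_def)
    then show ?thesis using h(2)[OF xB] by simp
  qed
  obtain S0 where S0: "finite S0" "rat_vector.span S0 = carrier B"
    using fdB by (auto simp: rat_finite_dim_def)
  obtain n c where nc: "x (int n) = (\<Sum>j<n. c j *\<^sub>Q x (int j))"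
    using linear_recurrence[OF S0(1), of "\<lambda>i. x (int i)"] xB S0(2) by auto
  define p where "p = monom 1 n - (\<Sum>j<n. monom (c j) j)"
  have cp: "coeff p j = (if j = n then 1 else if j < n then - c j else 0)" for j
  proof -
    have "(\<Sum>i<n. coeff (monom (c i) i) j) = (\<Sum>i<n. if i = j then c j else 0)"
      by (intro sum.cong) auto
    then show ?thesis by (simp add: p_def coeff_sum)
  qed
  have "p \<noteq> 0" using cp[of n] by auto
  have "degree p = n"
    using cp by (intro antisym degree_le le_degree) auto
  \<comment> \<open>\<open>r t\<close> is the defect of the recurrence at time \<open>t\<close>. It
    vanishes at 0 and is moved along by \<open>g\<close>, so it vanishes at all later times by
    linearity and at all earlier ones by injectivity.\<close>
  define r where "r t = (\<Sum>j\<le>n. coeff p j *\<^sub>Q x (t + int j))" for t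
  have rB: "r t \<in> carrier B" for t
    unfolding r_def using xB by (intro rat_vector.subspace_sum[OF BS] rat_vector.subspace_scale[OF BS])
  have gr: "g (r t) = r (t + 1)" for t
    unfolding r_def using rat_linear_on_sum[OF G(2) BS, of "{..n}" "\<lambda>j. x (t + int j)"] xB
    by (simp add: gx add.commute add.left_commute)
  have g0: "g 0 = 0" using rat_linear_on_0[OF G(2) BS] .
  have r0: "r 0 = 0"
  proof -
    have "r 0 = x (int n) + (\<Sum>j<n. coeff p j *\<^sub>Q x (int j))"
      by (simp add: r_def lessThan_Suc_atMost[symmetric] cp scaleQ_one)
    also have "(\<Sum>j<n. coeff p j *\<^sub>Q x (int j)) = - (\<Sum>j<n. c j *\<^sub>Q x (int j))"
      by (simp add: cp sum_negf)
    finally show ?thesis using nc by simp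
  qed
  have r: "r t = 0" for t
  proof (induction t rule: int_induct[where k = 0])
    case (step2 i)
    have "g (r (i - 1)) = g 0" using gr[of "i - 1"] step2 g0 by simp
    then show ?case using G(3) rB rat_vector.subspace_0[OF BS] by (auto dest: inj_onD)
  qed (use r0 gr g0 in \<open>auto simp flip: gr\<close>)
  have le: "\<bar>u y\<bar> \<le> nrm B y" if "u \<in> U" "y \<in> carrier B" for u y using U that by (simp add: Unrm)
  have dB: "2 *\<^sub>Q a - b \<in> carrier B" if "a \<in> carrier B" "b \<in> carrier B" for a b
    using that BS by (intro rat_vector.subspace_diff rat_vector.subspace_scale)
  have nx: "nrm B (x t) = nrm B v" "nrm B (2 *\<^sub>Q x (t + 1) - x t) = nrm B (2 *\<^sub>Q g v - v)" for t
  proof -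
    have gd: "g (2 *\<^sub>Q x (t + 1) - x t) = 2 *\<^sub>Q x (t + 1 + 1) - x (t + 1)" for t
      using rat_linear_on_diff[OF G(2) BS rat_vector.subspace_scale[OF BS xB] xB]
        rat_linear_onD(2)[OF G(2) xB] by (simp add: gx)
    have "nrm B (x t) = nrm B v \<and> nrm B (2 *\<^sub>Q x (t + 1) - x t) = nrm B (2 *\<^sub>Q g v - v)"
    proof (induction t rule: int_induct[where k = 0])
      case base
      then show ?case using gx[of 0] by (simp add: x_def)
    next
      case (step1 i)
      then show ?case
        using G(4)[OF xB, of i] G(4)[OF dB[OF xB xB], of "i + 1" i] by (simp add: gx gd)
    next
      case (step2 i)
      then show ?case
        using G(4)[OF xB, of "i - 1"] G(4)[OF dB[OF xB xB], of i "i - 1"] gd[of "i - 1"]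
        by (simp add: gx)
    qed
    then show "nrm B (x t) = nrm B v" "nrm B (2 *\<^sub>Q x (t + 1) - x t) = nrm B (2 *\<^sub>Q g v - v)"
      by simp_all
  qed
  have x01: "x 0 = v" "x 1 = g v" using gx[of 0] by (simp_all add: x_def)
  have "Max ((\<lambda>u. \<bar>u (2 *\<^sub>Q x 0 - x 1)\<bar>) ` U) \<in> (\<lambda>u. \<bar>u (2 *\<^sub>Q x 0 - x 1)\<bar>) ` U"
    using U by (intro Max_in) auto
  then obtain q where q: "q \<in> U" "\<bar>q (2 *\<^sub>Q x 0 - x 1)\<bar> = 2"
    using Unrm[OF dB[OF xB xB], of 0 1] wv by (auto simp: x01 wandering_vector_def)
  define \<sigma> :: rat where "\<sigma> = (if 0 \<le> q (2 *\<^sub>Q x 0 - x 1) then 1 else - 1)"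
  have abs\<sigma>: "\<bar>\<sigma> * a\<bar> = \<bar>a\<bar>" for a by (simp add: \<sigma>_def)
  define s where "s t = \<sigma> * q (x t)" for t
  have qd: "q (2 *\<^sub>Q x i - x j) = 2 * q (x i) - q (x j)" for i j
    using rat_linear_on_diff[OF Ulin[OF q(1)] BS rat_vector.subspace_scale[OF BS xB] xB]
      rat_linear_onD(2)[OF Ulin[OF q(1)] xB] by (simp add: scaleQ_rat_def)
  have b: "\<bar>s t\<bar> \<le> 1" for t
    using le[OF q(1) xB, of t] nx(1)[of t] wv unfolding s_def abs\<sigma> wandering_vector_def by linarith
  have d: "\<bar>2 * s (t + 1) - s t\<bar> \<le> 1" for t
  proof -
    have "2 * s (t + 1) - s t = \<sigma> * q (2 *\<^sub>Q x (t + 1) - x t)"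
      unfolding s_def qd by (simp add: algebra_simps)
    then show ?thesis
      using le[OF q(1) dB[OF xB xB], of "t + 1" t] nx(2)[of t] wv abs\<sigma>
      unfolding wandering_vector_def by (metis order_trans)
  qed
  have "2 * s 0 - s 1 = \<sigma> * q (2 *\<^sub>Q x 0 - x 1)"
    unfolding s_def qd by (simp add: algebra_simps)
  then have 2: "2 * s 0 - s 1 = 2" using q(2) by (auto simp: \<sigma>_def abs_if split: if_splits)
  note ws = wandering_sequence[of s, OF b d 2]
  have "s t = 1" if "t \<le> 0" for t using ws(1)[of "nat (- t)"] that by simp
  moreover have "poly_shift p s t = 0" for t
  proof -
    have "poly_shift p s t = \<sigma> * (\<Sum>j\<le>n. coeff p j * q (x (t + int j)))"
      unfolding poly_shift_def \<open>degree p = n\<close> s_def sum_distrib_left by (simp add: mult.left_commute)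
    also have "(\<Sum>j\<le>n. coeff p j * q (x (t + int j))) = q (r t)"
      unfolding r_def using rat_linear_on_sum[OF Ulin[OF q(1)] BS, of "{..n}" "\<lambda>j. x (t + int j)"] xB
      by (simp add: scaleQ_rat_def)
    finally show ?thesis using r[of t] rat_linear_on_0[OF Ulin[OF q(1)] BS] by simp
  qed
  ultimately have "s 1 = 1" using recurrence_from_constant[OF \<open>p \<noteq> 0\<close>] by blast
  then show False using ws(2) by simp
qed

lemma not_one_hrushovski: "\<not> one_hrushovski_property polyhedral_class"
proof
  assume H: "one_hrushovski_property polyhedral_class"
  obtain X V W f v where X: "X \<in> polyhedral_class" "partial_isometry X V W f" "v \<in> V"
    "wandering_vector X v (f v)" by (rule wandering_partial_isometry)
  obtain B g where B: "B \<in> polyhedral_class" "sub_nspace X B" "surj_isometry B B g"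
    "\<forall>x\<in>V. g x = f x"
    using H X(1,2) unfolding one_hrushovski_property_def by blast
  note F = partial_isometryD[OF X(2)]
  have nX: "rat_normed_space X" using X(1) by (simp add: polyhedral_class_def polyhedral_space_def)
  have "isometric_embedding X B (\<lambda>x. x)"
    using B(2) by (intro isometric_embeddingI[OF nX]) (auto simp: sub_nspace_def rat_linear_on_def)
  moreover have "v \<in> carrier X" "f v \<in> carrier X" using X(3) F(2,4,6) by auto
  ultimately have "wandering_vector B v (g v)" "v \<in> carrier B"
    using wandering_vector_isometric[OF nX _ _ _ X(4), of B "\<lambda>x. x"] B(2,4) X(3)
    by (auto simp: sub_nspace_def)
  then show False
    using no_wandering_vector_of_isometry[OF _ B(3)] B(1) by (simp add: polyhedral_class_def)
qed

text \<open>Whatever \<open>A'\<close> is chosen over the wandering plane, the image of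
  \<open>v\<close> is still wandering in it, so \<open>A'\<close> has two extensions with different
  orbit norms. In an amalgam the two images of \<open>v\<close> agree and \<open>sys_map D\<close>
  generates both orbits from them, so the orbits and their norms would coincide.\<close>

lemma not_weak_amalgamation:
  "\<not> weak_amalgamation_property (isometry_systems polyhedral_class) system_embedding
    (\<lambda>S. carrier (sys_space S))"
proof
  assume H: "weak_amalgamation_property (isometry_systems polyhedral_class) system_embedding
    (\<lambda>S :: (nat \<Rightarrow> rat) isometry_system. carrier (sys_space S))"
  let ?K = "isometry_systems polyhedral_class"
  obtain X V W f v where X: "X \<in> polyhedral_class" "partial_isometry X V W f" "v \<in> V"
    "wandering_vector X v (f v)" by (rule wandering_partial_isometry)
  note F = partial_isometryD[OF X(2)]
  have vX: "v \<in> carrier X" "f v \<in> carrier X" using X(3) F(2,4,6) by auto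
  have nX: "rat_normed_space X" using X(1) by (simp add: polyhedral_class_def polyhedral_space_def)
  define A where "A = \<lparr>sys_space = X, sys_dom = V, sys_cod = W, sys_map = f\<rparr>"
  have "A \<in> ?K" using X by (simp add: A_def isometry_systems_def)
  from bspec[OF H[unfolded weak_amalgamation_property_def] this]
  obtain A' \<phi> where A': "A' \<in> ?K" "system_embedding A A' \<phi>"
    and am0: "\<forall>B\<in>?K. \<forall>C\<in>?K. \<forall>\<alpha> \<beta>. system_embedding A' B \<alpha> \<and> system_embedding A' C \<beta> \<longrightarrow>
      (\<exists>D\<in>?K. \<exists>\<gamma> \<delta>. system_embedding B D \<gamma> \<and> system_embedding C D \<delta> \<and>
        (\<forall>x\<in>carrier (sys_space A). (\<gamma> \<circ> \<alpha> \<circ> \<phi>) x = (\<delta> \<circ> \<beta> \<circ> \<phi>) x))"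
    by (elim bexE exE conjE)
  have am: "\<exists>D\<in>?K. \<exists>\<gamma> \<delta>. system_embedding B D \<gamma> \<and> system_embedding C D \<delta> \<and>
        (\<forall>x\<in>carrier X. (\<gamma> \<circ> \<alpha> \<circ> \<phi>) x = (\<delta> \<circ> \<beta> \<circ> \<phi>) x)"
    if "B \<in> ?K" "C \<in> ?K" "system_embedding A' B \<alpha>" "system_embedding A' C \<beta>" for B C \<alpha> \<beta>
    using am0[rule_format, OF that(1,2) conjI[OF that(3,4)]] by (simp add: A_def)
  have pA': "polyhedral_space (sys_space A')"
    "partial_isometry (sys_space A') (sys_dom A') (sys_cod A') (sys_map A')"
    using A'(1) by (simp_all add: isometry_systems_def polyhedral_class_def)
  have \<phi>: "isometric_embedding X (sys_space A') \<phi>" "\<phi> v \<in> sys_dom A'" "\<phi> (f v) = sys_map A' (\<phi> v)"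
    using A'(2) X(3) by (auto simp: system_embedding_def A_def)
  have "wandering_vector (sys_space A') (\<phi> v) (sys_map A' (\<phi> v))"
    using wandering_vector_isometric[OF nX \<phi>(1) vX X(4)] \<phi>(3) by simp
  from orbit_norm_not_determined[OF pA' \<phi>(2) this]
  obtain N \<beta> S\<^sub>1 \<alpha>\<^sub>1 y\<^sub>1 S\<^sub>2 \<alpha>\<^sub>2 y\<^sub>2 where
    S1: "orbit_extension (sys_space A') (sys_dom A') (sys_map A') (\<phi> v) N S\<^sub>1 \<alpha>\<^sub>1 y\<^sub>1" and
    S2: "orbit_extension (sys_space A') (sys_dom A') (sys_map A') (\<phi> v) N S\<^sub>2 \<alpha>\<^sub>2 y\<^sub>2" and
    ne: "nrm (sys_space S\<^sub>1) (\<Sum>i\<le>N. \<beta> i *\<^sub>Q y\<^sub>1 i) \<noteq> nrm (sys_space S\<^sub>2) (\<Sum>i\<le>N. \<beta> i *\<^sub>Q y\<^sub>2 i)"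
    by (elim exE conjE)
  have K: "S\<^sub>1 \<in> ?K" "S\<^sub>2 \<in> ?K" "system_embedding A' S\<^sub>1 \<alpha>\<^sub>1" "system_embedding A' S\<^sub>2 \<alpha>\<^sub>2"
    using S1 S2 by (simp_all add: orbit_extension_def system_embedding_def)
  from am[OF K] obtain D \<gamma> \<delta> where D: "D \<in> ?K" "system_embedding S\<^sub>1 D \<gamma>" "system_embedding S\<^sub>2 D \<delta>"
    and eq: "\<forall>x\<in>carrier X. (\<gamma> \<circ> \<alpha>\<^sub>1 \<circ> \<phi>) x = (\<delta> \<circ> \<alpha>\<^sub>2 \<circ> \<phi>) x"
    by (elim bexE exE conjE)
  have orb: "\<epsilon> (y i) = (sys_map D ^^ i) (\<epsilon> (\<alpha> (\<phi> v))) \<and> y i \<in> carrier (sys_space S)"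
    if S: "orbit_extension (sys_space A') (sys_dom A') (sys_map A') (\<phi> v) N S \<alpha> y"
      and \<epsilon>: "system_embedding S D \<epsilon>" and i: "i \<le> N" for S \<alpha> y \<epsilon> i
    using i
  proof (induction i)
    case 0
    have "\<phi> v \<in> carrier (sys_space A')" using isometric_embeddingD(1)[OF \<phi>(1) vX(1)] .
    then show ?case using S isometric_embeddingD(1)[of "sys_space A'" "sys_space S" \<alpha>]
      by (simp add: orbit_extension_def)
  next
    case (Suc i)
    have y: "y i \<in> sys_dom S" "sys_map S (y i) = y (Suc i)" using S Suc.prems by (auto simp: orbit_extension_def)
    have P: "partial_isometry (sys_space S) (sys_dom S) (sys_cod S) (sys_map S)"
      using S by (simp add: orbit_extension_def isometry_systems_def)
    have "sys_map S (y i) \<in> sys_cod S"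
      using imageI[OF y(1), of "sys_map S"] unfolding partial_isometryD(6)[OF P] .
    then have "y (Suc i) \<in> carrier (sys_space S)"
      unfolding y(2) by (rule subsetD[OF partial_isometryD(4)[OF P]])
    moreover have "\<epsilon> (y (Suc i)) = sys_map D (\<epsilon> (y i))"
      using \<epsilon> y by (metis system_embedding_def)
    ultimately show ?case using Suc by simp
  qed
  have nrm_eq: "nrm (sys_space S) (\<Sum>i\<le>N. \<beta> i *\<^sub>Q y i) = nrm (sys_space D) (\<Sum>i\<le>N. \<beta> i *\<^sub>Q \<epsilon> (y i))"
    if S: "orbit_extension (sys_space A') (sys_dom A') (sys_map A') (\<phi> v) N S \<alpha> y"
      and \<epsilon>: "system_embedding S D \<epsilon>" for S \<alpha> y \<epsilon>
  proof -
    have E: "isometric_embedding (sys_space S) (sys_space D) \<epsilon>" using \<epsilon> by (simp add: system_embedding_def)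
    have "rat_normed_space (sys_space S)"
      using S by (simp add: orbit_extension_def isometry_systems_def polyhedral_class_def polyhedral_space_def)
    note SS = rat_normed_spaceD(1)[OF this]
    have m: "y i \<in> carrier (sys_space S)" if "i \<in> {..N}" for i using orb[OF S \<epsilon>] that by simp
    then have m': "(\<Sum>i\<le>N. \<beta> i *\<^sub>Q y i) \<in> carrier (sys_space S)"
      by (intro rat_vector.subspace_sum[OF SS] rat_vector.subspace_scale[OF SS]) simp
    have "\<epsilon> (\<Sum>i\<le>N. \<beta> i *\<^sub>Q y i) = (\<Sum>i\<le>N. \<beta> i *\<^sub>Q \<epsilon> (y i))"
      using rat_linear_on_sum[OF isometric_embeddingD(2)[OF E] SS m] .
    then show ?thesis using isometric_embeddingD(4)[OF E m'] by simp
  qed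
  have "\<gamma> (y\<^sub>1 i) = \<delta> (y\<^sub>2 i)" if "i \<le> N" for i
    using orb[OF S1 D(2) that] orb[OF S2 D(3) that] eq vX(1) by simp
  then have "(\<Sum>i\<le>N. \<beta> i *\<^sub>Q \<gamma> (y\<^sub>1 i)) = (\<Sum>i\<le>N. \<beta> i *\<^sub>Q \<delta> (y\<^sub>2 i))" by (intro sum.cong) auto
  then show False using ne nrm_eq[OF S1 D(2)] nrm_eq[OF S2 D(3)] by simp
qed

section \<open>Ultrahomogeneity of the rational Gurarii space\<close>

lemma rat_finite_dim_span: "finite B \<Longrightarrow> rat_finite_dim (rat_vector.span B)"
  by (auto simp: rat_finite_dim_def)

lemma rat_finite_dim_subspace:
  assumes W: "rat_finite_dim W" and V: "rat_vector.subspace V" "V \<subseteq> W"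
  shows "rat_finite_dim V"
proof -
  obtain S where S: "finite S" "rat_vector.span S = W" using W by (auto simp: rat_finite_dim_def)
  obtain B where B: "B \<subseteq> V" "rat_vector.independent B" "V \<subseteq> rat_vector.span B"
    using rat_vector.maximal_independent_subset by metis
  have "B \<subseteq> rat_vector.span S" using B(1) V(2) S(2) by simp
  then have "finite B" using rat_vector.independent_span_bound[OF S(1) B(2)] by simp
  moreover have "rat_vector.span B = V"
    using B(3) rat_vector.span_minimal[OF B(1) V(1)] by (rule subset_antisym[rotated])
  ultimately show ?thesis by (auto simp: rat_finite_dim_def)
qed

lemma rat_finite_dim_image:
  assumes f: "rat_linear_on V f" and V: "rat_finite_dim V" "rat_vector.subspace V"
  shows "rat_finite_dim (f ` V)"
proof -
  obtain S where S: "finite S" "rat_vector.span S = V" using V(1) by (auto simp: rat_finite_dim_def)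
  have "f ` V \<subseteq> rat_vector.span (f ` S)"
    by (rule span_image_subset[OF f S(2)]) (rule rat_vector.span_superset)
  moreover have "rat_vector.span (f ` S) \<subseteq> f ` V"
    using S(2) rat_vector.span_superset[of S] subspace_image[OF f V(2)]
    by (intro rat_vector.span_minimal) auto
  ultimately show ?thesis using S(1) unfolding rat_finite_dim_def by blast
qed

lemma polyhedral_space_pullback:
  assumes Y: "rat_normed_space Y" "rat_finite_dim (carrier Y)"
    and X: "polyhedral_space X" and f: "isometric_embedding Y X f"
  shows "polyhedral_space Y"
proof -
  obtain U :: "('b \<Rightarrow> rat) set" where U: "finite U" "U \<noteq> {}"
    "\<forall>u\<in>U. rat_linear_on (carrier X) u" "\<forall>x\<in>carrier X. nrm X x = Max ((\<lambda>u. \<bar>u x\<bar>) ` U)"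
    using X unfolding polyhedral_space_def by blast
  note F = isometric_embeddingD[OF f]
  show ?thesis
    unfolding polyhedral_space_def
  proof (intro conjI Y exI[of _ "(\<lambda>u. u \<circ> f) ` U"])
    show "\<forall>u\<in>(\<lambda>u. u \<circ> f) ` U. rat_linear_on (carrier Y) u"
      using U(3) F(1,2) by (simp add: rat_linear_on_def)
    show "\<forall>x\<in>carrier Y. nrm Y x = Max ((\<lambda>u. \<bar>u x\<bar>) ` (\<lambda>u. u \<circ> f) ` U)"
      using U(4) F(1,4) by (simp add: image_image)
  qed (use U in auto)
qed

lemma isometric_embedding_restrict:
  assumes "isometric_embedding X Y f" "V \<subseteq> carrier X" "f ` V \<subseteq> W"
  shows "isometric_embedding (X\<lparr>carrier := V\<rparr>) (Y\<lparr>carrier := W\<rparr>) f"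
  using assms rat_linear_on_subset[of "carrier X" f V] inj_on_subset[of f "carrier X" V]
  by (auto simp: isometric_embedding_def)

lemma isometric_embedding_into_supspace:
  assumes "isometric_embedding X (Y\<lparr>carrier := W\<rparr>) f" "W \<subseteq> carrier Y"
  shows "isometric_embedding X Y f"
  using assms by (auto simp: isometric_embedding_def)

context
  fixes G :: "'g::rat_vector rat_nspace"
  assumes G: "rational_gurarii_space G"
begin

lemma gurarii_normed: "rat_normed_space G" and gurarii_countable: "countable (carrier G)"
  using G by (simp_all add: rational_gurarii_space_def)

lemmas gurarii_clauses = G[unfolded rational_gurarii_space_def, THEN conjunct2, THEN conjunct2]

lemma gurarii_subspace_copy:
  assumes "is_subspace_of V G" "rat_finite_dim V"
  obtains X h where "X \<in> polyhedral_class" "surj_isometry (G\<lparr>carrier := V\<rparr>) X h"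
  using gurarii_clauses[THEN conjunct1, rule_format, OF conjI[OF assms]]
  by (elim bexE exE) (rule that)

lemma gurarii_contains_copy:
  assumes "X \<in> polyhedral_class"
  obtains h where "isometric_embedding X G h"
proof -
  obtain V f where V: "is_subspace_of V G" "surj_isometry (G\<lparr>carrier := V\<rparr>) X f"
    using gurarii_clauses[THEN conjunct2, THEN conjunct1, rule_format, OF assms] by (elim exE conjE)
  have fe: "isometric_embedding (G\<lparr>carrier := V\<rparr>) X f" and fV: "f ` V = carrier X"
    using V(2) by (simp_all add: surj_isometry_def)
  have "isometric_embedding (X\<lparr>carrier := f ` V\<rparr>) (G\<lparr>carrier := V\<rparr>) (inv_into V f)"
    using isometric_embedding_inv[OF rat_normed_space_restrict[OF gurarii_normed V(1)] fe, of V] V(1)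
    by (simp add: is_subspace_of_def)
  then have "isometric_embedding (X\<lparr>carrier := f ` V\<rparr>) G (inv_into V f)"
    by (rule isometric_embedding_into_supspace) (use V(1) in \<open>simp add: is_subspace_of_def\<close>)
  then show thesis using that fV by simp
qed

text \<open>The extension property as defined speaks of literal subspaces within the class; here
  \<open>C\<close> lies in \<open>G\<close> and sits in \<open>D\<close> only through
  \<open>\<alpha>\<close>. Its image is again polyhedral, and \<open>p\<close> composed with the
  inverse of \<open>\<alpha>\<close> is the map to be extended.\<close>

lemma gurarii_extension:
  assumes C: "is_subspace_of C G" "rat_finite_dim C" and D: "D \<in> polyhedral_class"
    and \<alpha>: "isometric_embedding (G\<lparr>carrier := C\<rparr>) D \<alpha>"
    and p: "isometric_embedding (G\<lparr>carrier := C\<rparr>) G p"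
  obtains \<beta> where "isometric_embedding D G \<beta>" "\<And>x. x \<in> C \<Longrightarrow> \<beta> (\<alpha> x) = p x"
proof -
  define A where "A = D\<lparr>carrier := \<alpha> ` C\<rparr>"
  have CG: "rat_vector.subspace C" "C \<subseteq> carrier G" using C(1) by (simp_all add: is_subspace_of_def)
  have nC: "rat_normed_space (G\<lparr>carrier := C\<rparr>)" by (rule rat_normed_space_restrict[OF gurarii_normed C(1)])
  have nD: "rat_normed_space D" and pD: "polyhedral_space D"
    using D by (simp_all add: polyhedral_class_def polyhedral_space_def)
  note A = isometric_embeddingD[OF \<alpha>]
  have lin: "rat_linear_on C \<alpha>" using A(2) by simp
  have AD: "\<alpha> ` C \<subseteq> carrier D" using A(1) by auto
  have nA: "rat_normed_space A"
    unfolding A_def using nD subspace_image[OF lin CG(1)] AD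
    by (intro rat_normed_space_restrict) (auto simp: is_subspace_of_def)
  have "polyhedral_space A"
  proof (rule polyhedral_space_pullback[OF nA _ pD])
    show "rat_finite_dim (carrier A)" using rat_finite_dim_image[OF lin C(2) CG(1)] by (simp add: A_def)
    show "isometric_embedding A D (\<lambda>x. x)"
      using AD by (intro isometric_embeddingI[OF nA]) (auto simp: A_def rat_linear_on_def)
  qed
  then have Ac: "A \<in> polyhedral_class" by (simp add: polyhedral_class_def)
  have "isometric_embedding A (G\<lparr>carrier := C\<rparr>) (inv_into C \<alpha>)"
    using isometric_embedding_inv[OF nC \<alpha>, of C] CG(1) by (simp add: A_def)
  then have e: "isometric_embedding A G (p \<circ> inv_into C \<alpha>)"
    using p by (rule isometric_embedding_compose)
  have "sub_nspace A D" using AD by (simp add: sub_nspace_def A_def)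
  from gurarii_clauses[THEN conjunct2, THEN conjunct2, rule_format, OF Ac D conjI[OF this e]]
  obtain \<beta> where \<beta>: "isometric_embedding D G \<beta>"
    "\<forall>x\<in>carrier A. \<beta> x = (p \<circ> inv_into C \<alpha>) x"
    by (elim exE conjE)
  show thesis
  proof (rule that[OF \<beta>(1)])
    show "\<beta> (\<alpha> x) = p x" if "x \<in> C" for x
      using \<beta>(2) A(3) that by (simp add: A_def)
  qed
qed

definition finite_partial_isometry :: "'g set \<Rightarrow> ('g \<Rightarrow> 'g) \<Rightarrow> bool"
  where "finite_partial_isometry V p \<longleftrightarrow>
    is_subspace_of V G \<and> rat_finite_dim V \<and> isometric_embedding (G\<lparr>carrier := V\<rparr>) G p"

text \<open>The span of \<open>V\<close> and \<open>x\<close> is replaced by a copy \<open>X\<close>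
  in the class; there \<open>p\<close> becomes an embedding of the copy of \<open>V\<close>, which
  the extension property prolongs to \<open>X\<close>.\<close>

lemma finite_partial_isometry_forth:
  assumes p: "finite_partial_isometry V p" and x: "x \<in> carrier G"
  obtains V' p' where "finite_partial_isometry V' p'" "V \<subseteq> V'" "x \<in> V'" "\<And>a. a \<in> V \<Longrightarrow> p' a = p a"
proof -
  have V: "is_subspace_of V G" "rat_finite_dim V" "isometric_embedding (G\<lparr>carrier := V\<rparr>) G p"
    using p by (simp_all add: finite_partial_isometry_def)
  obtain B where B: "finite B" "rat_vector.span B = V" using V(2) by (auto simp: rat_finite_dim_def)
  define V' where "V' = rat_vector.span (insert x B)"
  have VV': "V \<subseteq> V'" unfolding V'_def B(2)[symmetric] by (rule rat_vector.span_mono) auto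
  have xV': "x \<in> V'" unfolding V'_def by (rule rat_vector.span_base) simp
  have "insert x B \<subseteq> carrier G"
    using x V(1) B(2) rat_vector.span_superset[of B] by (auto simp: is_subspace_of_def)
  then have V': "is_subspace_of V' G"
    unfolding V'_def is_subspace_of_def
    using rat_normed_spaceD(1)[OF gurarii_normed] rat_vector.span_minimal rat_vector.subspace_span by blast
  have fV': "rat_finite_dim V'" using B(1) by (simp add: V'_def rat_finite_dim_span)
  obtain X h where X: "X \<in> polyhedral_class" "surj_isometry (G\<lparr>carrier := V'\<rparr>) X h"
    by (rule gurarii_subspace_copy[OF V' fV'])
  have h: "isometric_embedding (G\<lparr>carrier := V'\<rparr>) X h" using X(2) by (simp add: surj_isometry_def)
  then have "isometric_embedding (G\<lparr>carrier := V\<rparr>) X h"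
    using isometric_embedding_restrict[OF h, of V "carrier X"] VV' isometric_embeddingD(1)[OF h] by auto
  then obtain \<beta> where \<beta>: "isometric_embedding X G \<beta>" "\<And>a. a \<in> V \<Longrightarrow> \<beta> (h a) = p a"
    using gurarii_extension[OF V(1,2) X(1) _ V(3)] by metis
  show thesis
  proof (rule that[of V' "\<beta> \<circ> h"])
    show "finite_partial_isometry V' (\<beta> \<circ> h)"
      using V' fV' isometric_embedding_compose[OF h \<beta>(1)] by (simp add: finite_partial_isometry_def)
  qed (use VV' xV' \<beta>(2) in auto)
qed

lemma finite_partial_isometry_inverse:
  assumes p: "finite_partial_isometry V p"
  shows "finite_partial_isometry (p ` V) (inv_into V p)"
proof -
  have V: "is_subspace_of V G" "rat_finite_dim V" "isometric_embedding (G\<lparr>carrier := V\<rparr>) G p"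
    using p by (simp_all add: finite_partial_isometry_def)
  have VG: "rat_vector.subspace V" "V \<subseteq> carrier G" using V(1) by (simp_all add: is_subspace_of_def)
  note P = isometric_embeddingD[OF V(3)]
  have lin: "rat_linear_on V p" using P(2) by simp
  have "isometric_embedding (G\<lparr>carrier := p ` V\<rparr>) (G\<lparr>carrier := V\<rparr>) (inv_into V p)"
    using isometric_embedding_inv[OF rat_normed_space_restrict[OF gurarii_normed V(1)] V(3), of V] VG
    by simp
  then have "isometric_embedding (G\<lparr>carrier := p ` V\<rparr>) G (inv_into V p)"
    by (rule isometric_embedding_into_supspace) (rule VG(2))
  then show ?thesis
    using subspace_image[OF lin VG(1)] P(1) rat_finite_dim_image[OF lin V(2) VG(1)]
    by (auto simp: finite_partial_isometry_def is_subspace_of_def)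
qed

lemma finite_partial_isometry_back:
  assumes p: "finite_partial_isometry V p" and y: "y \<in> carrier G"
  obtains V' p' where "finite_partial_isometry V' p'" "V \<subseteq> V'" "y \<in> p' ` V'" "\<And>a. a \<in> V \<Longrightarrow> p' a = p a"
proof -
  obtain W q where q: "finite_partial_isometry W q" "p ` V \<subseteq> W" "y \<in> W"
    "\<And>b. b \<in> p ` V \<Longrightarrow> q b = inv_into V p b"
    using finite_partial_isometry_forth[OF finite_partial_isometry_inverse[OF p] y] by metis
  have ip: "inj_on p V" and iq: "inj_on q W"
    using p q(1) by (auto simp: finite_partial_isometry_def isometric_embedding_def)
  have qp: "q (p a) = a" if "a \<in> V" for a using q(4) that ip by simp
  show thesis
  proof (rule that[OF finite_partial_isometry_inverse[OF q(1)]])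
    show "V \<subseteq> q ` W" using qp q(2) by (metis image_subset_iff rev_image_eqI subsetI)
    show "y \<in> inv_into W q ` q ` W" using q(3) iq by force
    show "inv_into W q a = p a" if "a \<in> V" for a
      using inv_into_f_f[OF iq, of "p a"] qp[OF that] q(2) that by auto
  qed
qed

lemma isometry_group_carrier:
  "g \<in> carrier (isometry_group G) \<longleftrightarrow> g \<in> extensional (carrier G) \<and> surj_isometry G G g"
  by (auto simp: isometry_group_def Bij_def bij_betw_def surj_isometry_def isometric_embedding_def)

text \<open>Back-and-forth along an enumeration of the countable carrier: step \<open>n\<close> puts
  \<open>enum n\<close> into both the domain and the range, so the union of the stages is total and
  onto.\<close>

lemma gurarii_ultrahomogeneous:
  assumes p: "finite_partial_isometry V p"
  obtains g where "g \<in> carrier (isometry_group G)" "\<And>x. x \<in> V \<Longrightarrow> g x = p x"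
proof -
  define enum where "enum = from_nat_into (carrier G)"
  have ne: "carrier G \<noteq> {}"
    using rat_vector.subspace_0[OF rat_normed_spaceD(1)[OF gurarii_normed]] by blast
  have enum: "enum n \<in> carrier G" for n using ne by (simp add: enum_def from_nat_into)
  have enum_surj: "\<exists>n. x = enum n" if "x \<in> carrier G" for x
    using gurarii_countable that by (metis enum_def from_nat_into_surj)
  \<comment> \<open>The clause at \<open>n = 0\<close> pins the first stage to
    \<open>(V, p)\<close>, so that the limit extends \<open>p\<close>.\<close>
  define P :: "nat \<Rightarrow> 'g set \<times> ('g \<Rightarrow> 'g) \<Rightarrow> bool"
    where "P n z \<longleftrightarrow> finite_partial_isometry (fst z) (snd z) \<and> (n = 0 \<longrightarrow> z = (V, p))" for n z
  define R :: "nat \<Rightarrow> 'g set \<times> ('g \<Rightarrow> 'g) \<Rightarrow> 'g set \<times> ('g \<Rightarrow> 'g) \<Rightarrow> bool"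
    where "R n z z' \<longleftrightarrow> fst z \<subseteq> fst z' \<and> (\<forall>a\<in>fst z. snd z' a = snd z a) \<and>
      enum n \<in> fst z' \<and> enum n \<in> snd z' ` fst z'" for n z z'
  have "\<exists>z. \<forall>n. P n (z n) \<and> R n (z n) (z (Suc n))"
  proof (rule dependent_nat_choice)
    show "\<exists>z. P 0 z" using p by (auto simp: P_def)
    fix z n assume "P n z"
    then have "finite_partial_isometry (fst z) (snd z)" by (simp add: P_def)
    then obtain V1 p1 where 1: "finite_partial_isometry V1 p1" "fst z \<subseteq> V1" "enum n \<in> V1"
      "\<And>a. a \<in> fst z \<Longrightarrow> p1 a = snd z a"
      using finite_partial_isometry_forth enum by metis
    obtain V2 p2 where 2: "finite_partial_isometry V2 p2" "V1 \<subseteq> V2" "enum n \<in> p2 ` V2"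
      "\<And>a. a \<in> V1 \<Longrightarrow> p2 a = p1 a"
      using finite_partial_isometry_back[OF 1(1) enum] by metis
    show "\<exists>z'. P (Suc n) z' \<and> R n z z'"
      using 1 2 by (intro exI[of _ "(V2, p2)"]) (auto simp: P_def R_def)
  qed
  then obtain z where z: "\<And>n. P n (z n)" "\<And>n. R n (z n) (z (Suc n))" by blast
  define W q where "W n = fst (z n)" and "q n = snd (z n)" for n
  have Wq: "finite_partial_isometry (W n) (q n)" for n using z(1)[of n] by (simp add: P_def W_def q_def)
  have W0: "W 0 = V" "q 0 = p" using z(1)[of 0] by (simp_all add: P_def W_def q_def)
  have step: "W n \<subseteq> W (Suc n)" "a \<in> W n \<Longrightarrow> q (Suc n) a = q n a"
    "enum n \<in> W (Suc n)" "enum n \<in> q (Suc n) ` W (Suc n)" for n a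
    using z(2)[of n] by (simp_all add: R_def W_def q_def)
  have mono: "W m \<subseteq> W n \<and> (\<forall>a\<in>W m. q n a = q m a)" if "m \<le> n" for m n
    using that
  proof (induction n rule: dec_induct)
    case (step n)
    then show ?case using \<open>W n \<subseteq> W (Suc n)\<close> \<open>\<And>a. a \<in> W n \<Longrightarrow> q (Suc n) a = q n a\<close> by auto
  qed auto
  have WG: "W n \<subseteq> carrier G" for n using Wq[of n] by (simp add: finite_partial_isometry_def is_subspace_of_def)
  have cover: "\<exists>n. x \<in> W n" if "x \<in> carrier G" for x using enum_surj[OF that] step(3) by blast
  \<comment> \<open>All stages containing \<open>x\<close> agree at it by \<open>mono\<close>. The
    default \<open>undefined\<close> outside the carrier makes \<open>g\<close> extensional, as
    elements of \<open>BijGroup\<close> are.\<close>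
  define g where "g x = (if x \<in> carrier G then q (SOME n. x \<in> W n) x else undefined)" for x
  have g: "g x = q n x" if "x \<in> W n" for x n
  proof -
    have "x \<in> W (SOME n. x \<in> W n)" using that by (rule someI)
    then have "q (SOME n. x \<in> W n) x = q n x"
      using mono[of n "SOME n. x \<in> W n"] mono[of "SOME n. x \<in> W n" n] that by (metis nle_le)
    then show ?thesis using WG that by (auto simp: g_def)
  qed
  have common: "\<exists>n. x \<in> W n \<and> y \<in> W n" if xy: "x \<in> carrier G" "y \<in> carrier G" for x y
  proof -
    obtain m n where mn: "x \<in> W m" "y \<in> W n" using cover[OF xy(1)] cover[OF xy(2)] by blast
    have "W m \<subseteq> W (max m n)" "W n \<subseteq> W (max m n)" using mono by simp_all
    then show ?thesis using mn by blast
  qed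
  have Q: "rat_vector.subspace (W n)" "rat_linear_on (W n) (q n)" "x \<in> W n \<Longrightarrow> q n x \<in> carrier G"
    "x \<in> W n \<Longrightarrow> nrm G (q n x) = nrm G x" for n x
    using Wq[of n] by (auto simp: finite_partial_isometry_def is_subspace_of_def isometric_embedding_def)
  have "isometric_embedding G G g"
  proof (rule isometric_embeddingI[OF gurarii_normed])
    show "g \<in> carrier G \<rightarrow> carrier G" using cover g Q(3) by (metis Pi_I)
    show "nrm G (g x) = nrm G x" if "x \<in> carrier G" for x using cover[OF that] g Q(4) by metis
    show "rat_linear_on (carrier G) g"
      unfolding rat_linear_on_def
    proof (intro conjI ballI allI)
      fix x y assume "x \<in> carrier G" "y \<in> carrier G"
      then obtain n where n: "x \<in> W n" "y \<in> W n" using common by blast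
      then show "g (x + y) = g x + g y"
        using rat_vector.subspace_add[OF Q(1) n] rat_linear_onD(1)[OF Q(2) n] n by (simp add: g[of _ n])
    next
      fix c x assume "x \<in> carrier G"
      then obtain n where n: "x \<in> W n" using cover by blast
      then show "g (c *\<^sub>Q x) = c *\<^sub>Q g x"
        using rat_vector.subspace_scale[OF Q(1) n] rat_linear_onD(2)[OF Q(2) n] n by (simp add: g[of _ n])
    qed
  qed
  moreover have "g ` carrier G = carrier G"
  proof
    show "g ` carrier G \<subseteq> carrier G" using isometric_embeddingD(1)[OF calculation] by blast
    show "carrier G \<subseteq> g ` carrier G"
    proof
      fix y assume "y \<in> carrier G"
      then obtain n where "y \<in> q n ` W n" using enum_surj step(4) by metis
      then obtain x where "x \<in> W n" "y = q n x" by blast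
      then have "y = g x" "x \<in> carrier G" using g WG by auto
      then show "y \<in> g ` carrier G" by (rule image_eqI)
    qed
  qed
  ultimately have "g \<in> carrier (isometry_group G)"
    by (simp add: isometry_group_carrier surj_isometry_def extensional_def g_def)
  then show thesis using that g[of _ 0] W0 by simp
qed

end

section \<open>The topology of pointwise convergence\<close>

lemma openin_product_discrete:
  "openin (product_topology (\<lambda>_. discrete_topology C) I) S \<longleftrightarrow>
    S \<subseteq> (I \<rightarrow>\<^sub>E C) \<and> (\<forall>g\<in>S. \<exists>F. finite F \<and> F \<subseteq> I \<and> {g' \<in> I \<rightarrow>\<^sub>E C. \<forall>x\<in>F. g' x = g x} \<subseteq> S)"
  (is "?L \<longleftrightarrow> ?R")
proof
  assume L: ?L
  have "S \<subseteq> (I \<rightarrow>\<^sub>E C)" using openin_subset[OF L] by simp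
  moreover have "\<exists>F. finite F \<and> F \<subseteq> I \<and> {g' \<in> I \<rightarrow>\<^sub>E C. \<forall>x\<in>F. g' x = g x} \<subseteq> S" if g: "g \<in> S" for g
  proof -
    obtain U where U: "finite {i \<in> I. U i \<noteq> C}" "g \<in> Pi\<^sub>E I U" "Pi\<^sub>E I U \<subseteq> S"
      using L g unfolding openin_product_topology_alt by fastforce
    have "{g' \<in> I \<rightarrow>\<^sub>E C. \<forall>x\<in>{i \<in> I. U i \<noteq> C}. g' x = g x} \<subseteq> Pi\<^sub>E I U"
    proof
      fix g' assume g': "g' \<in> {g' \<in> I \<rightarrow>\<^sub>E C. \<forall>x\<in>{i \<in> I. U i \<noteq> C}. g' x = g x}"
      have "g' i \<in> U i" if i: "i \<in> I" for i
      proof (cases "U i = C")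
        case False
        then have "g' i = g i" using g' i by blast
        then show ?thesis using U(2) i by (simp add: PiE_mem)
      qed (use g' i in \<open>auto simp: PiE_mem\<close>)
      then show "g' \<in> Pi\<^sub>E I U" using g' by (auto simp: PiE_iff)
    qed
    then have "{g' \<in> I \<rightarrow>\<^sub>E C. \<forall>x\<in>{i \<in> I. U i \<noteq> C}. g' x = g x} \<subseteq> S"
      using U(3) by (rule subset_trans)
    then show ?thesis using U(1) by (intro exI[of _ "{i \<in> I. U i \<noteq> C}"] conjI) simp_all
  qed
  ultimately show ?R by blast
next
  assume R: ?R
  show ?L
    unfolding openin_product_topology_alt
  proof
    fix g assume g: "g \<in> S"
    then obtain F where F: "finite F" "F \<subseteq> I" "{g' \<in> I \<rightarrow>\<^sub>E C. \<forall>x\<in>F. g' x = g x} \<subseteq> S" using R by meson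
    have gE: "g \<in> I \<rightarrow>\<^sub>E C" using R g by blast
    let ?U = "\<lambda>i. if i \<in> F then {g i} else C"
    have "{i \<in> I. ?U i \<noteq> topspace (discrete_topology C)} \<subseteq> F" by auto
    then have "finite {i \<in> I. ?U i \<noteq> topspace (discrete_topology C)}" using F(1) finite_subset by blast
    moreover have "\<forall>i\<in>I. openin (discrete_topology C) (?U i)" using gE by (auto simp: PiE_mem)
    moreover have "g \<in> Pi\<^sub>E I ?U" using gE by (auto simp: PiE_iff)
    moreover have "Pi\<^sub>E I ?U \<subseteq> S"
    proof
      fix g' assume g': "g' \<in> Pi\<^sub>E I ?U"
      have "g' x = g x" if "x \<in> F" for x using PiE_mem[OF g', of x] that F(2) by auto
      moreover have "g' x \<in> C" if "x \<in> I" for x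
        using PiE_mem[OF g' that] PiE_mem[OF gE that] by (simp split: if_splits)
      ultimately have "g' \<in> {g' \<in> I \<rightarrow>\<^sub>E C. \<forall>x\<in>F. g' x = g x}"
        using g' by (simp add: PiE_iff)
      then show "g' \<in> S" using F(3) by blast
    qed
    ultimately show "\<exists>U. finite {i \<in> I. U i \<noteq> topspace (discrete_topology C)} \<and>
        (\<forall>i\<in>I. openin (discrete_topology C) (U i)) \<and> g \<in> Pi\<^sub>E I U \<and> Pi\<^sub>E I U \<subseteq> S"
      by (intro exI[of _ ?U] conjI)
  qed
qed

section \<open>Conjugacy classes of the isometry group\<close>

lemma isometry_group_subset_PiE: "carrier (isometry_group G) \<subseteq> (carrier G \<rightarrow>\<^sub>E carrier G)"
  by (auto simp: isometry_group_def Bij_def bij_betw_def PiE_def)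

lemma openin_isometry_group:
  "openin (isometry_group_topology G) S \<longleftrightarrow>
    S \<subseteq> carrier (isometry_group G) \<and> (\<forall>g\<in>S. \<exists>F. finite F \<and> F \<subseteq> carrier G \<and>
      {g' \<in> carrier (isometry_group G). \<forall>x\<in>F. g' x = g x} \<subseteq> S)"
  (is "?L \<longleftrightarrow> ?R")
proof
  let ?A = "carrier (isometry_group G)" and ?E = "carrier G \<rightarrow>\<^sub>E carrier G"
  assume ?L
  then obtain T where T: "openin (product_topology (\<lambda>_. discrete_topology (carrier G)) (carrier G)) T"
    "S = T \<inter> ?A"
    by (auto simp: isometry_group_topology_def openin_subtopology)
  have "\<exists>F. finite F \<and> F \<subseteq> carrier G \<and> {g' \<in> ?A. \<forall>x\<in>F. g' x = g x} \<subseteq> S" if g: "g \<in> S" for g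
  proof -
    have "g \<in> T" using g T(2) by blast
    then obtain F where F: "finite F" "F \<subseteq> carrier G" "{g' \<in> ?E. \<forall>x\<in>F. g' x = g x} \<subseteq> T"
      using T(1) unfolding openin_product_discrete by meson
    have "{g' \<in> ?A. \<forall>x\<in>F. g' x = g x} \<subseteq> S"
      using F(3) isometry_group_subset_PiE[of G] unfolding T(2) by blast
    then show ?thesis using F by blast
  qed
  then show ?R using T(2) by blast
next
  let ?A = "carrier (isometry_group G)" and ?E = "carrier G \<rightarrow>\<^sub>E carrier G"
  let ?P = "product_topology (\<lambda>_. discrete_topology (carrier G)) (carrier G)"
  assume R: ?R
  define N where "N g F = {g' \<in> ?E. \<forall>x\<in>F. g' x = g x}" for g F
  have N: "openin ?P (N g F)" if "finite F" "F \<subseteq> carrier G" for g F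
  proof -
    have sub: "N g F \<subseteq> ?E" by (auto simp: N_def)
    have ex: "\<exists>F'. finite F' \<and> F' \<subseteq> carrier G \<and> {g' \<in> ?E. \<forall>x\<in>F'. g' x = g1 x} \<subseteq> N g F"
      if "g1 \<in> N g F" for g1
      using that \<open>finite F\<close> \<open>F \<subseteq> carrier G\<close> by (intro exI[of _ F]) (auto simp: N_def)
    show ?thesis unfolding openin_product_discrete by (intro conjI ballI sub ex)
  qed
  have "\<forall>g\<in>S. \<exists>F. finite F \<and> F \<subseteq> carrier G \<and> {g' \<in> ?A. \<forall>x\<in>F. g' x = g x} \<subseteq> S" using R by blast
  from bchoice[OF this] obtain F where
    "\<forall>g\<in>S. finite (F g) \<and> F g \<subseteq> carrier G \<and> {g' \<in> ?A. \<forall>x\<in>F g. g' x = g x} \<subseteq> S"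
    by (elim exE)
  then have F: "finite (F g)" "F g \<subseteq> carrier G" "{g' \<in> ?A. \<forall>x\<in>F g. g' x = g x} \<subseteq> S"
    if "g \<in> S" for g using that by simp_all
  have "openin ?P (\<Union>g\<in>S. N g (F g))" using N F(1,2) by (intro openin_Union) auto
  moreover have "S = (\<Union>g\<in>S. N g (F g)) \<inter> ?A"
  proof
    show "S \<subseteq> (\<Union>g\<in>S. N g (F g)) \<inter> ?A"
      using R isometry_group_subset_PiE[of G] by (auto simp: N_def)
    show "(\<Union>g\<in>S. N g (F g)) \<inter> ?A \<subseteq> S" using F(3) by (fastforce simp: N_def)
  qed
  ultimately show ?L by (auto simp: isometry_group_topology_def openin_subtopology)
qed

lemma openin_isometry_group_agree:
  assumes "finite F" "F \<subseteq> carrier G"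
  shows "openin (isometry_group_topology G) {g \<in> carrier (isometry_group G). \<forall>x\<in>F. g x = g0 x}"
  unfolding openin_isometry_group
  using assms by (intro conjI ballI exI[of _ F]) auto

text \<open>The group is a countable intersection of open sets of self-maps of a countable discrete
  set: additivity, homogeneity and preservation of the norm at given arguments are decided by
  finitely many values, and hitting a given \<open>y\<close> by one. Injectivity follows from the
  norm. Complete metrizability opens the way to Baire's theorem.\<close>

lemma completely_metrizable_isometry_group:
  fixes G :: "'g::rat_vector rat_nspace"
  assumes nG: "rat_normed_space G" and cG: "countable (carrier G)"
  shows "completely_metrizable_space (isometry_group_topology G)"
proof -
  let ?C = "carrier G"
  let ?P = "product_topology (\<lambda>_. discrete_topology ?C) ?C" and ?E = "?C \<rightarrow>\<^sub>E ?C"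
  note GS = rat_normed_spaceD(1)[OF nG]
  define A where "A x y = {g \<in> ?E. g (x + y) = g x + g y}" for x y
  define B where "B c x = {g \<in> ?E. g (c *\<^sub>Q x) = c *\<^sub>Q g x}" for c x
  define N where "N x = {g \<in> ?E. nrm G (g x) = nrm G x}" for x
  define S where "S y = {g \<in> ?E. \<exists>x\<in>?C. g x = y}" for y
  define K where "K = insert ?E ((\<lambda>(x, y). A x y) ` (?C \<times> ?C) \<union> (\<lambda>(c, x). B c x) ` (UNIV \<times> ?C) \<union>
    N ` ?C \<union> S ` ?C)"
  have op: "openin ?P T"
    if "T \<subseteq> ?E" "\<And>g. g \<in> T \<Longrightarrow> \<exists>F. finite F \<and> F \<subseteq> ?C \<and> (\<forall>g'\<in>?E. (\<forall>x\<in>F. g' x = g x) \<longrightarrow> g' \<in> T)" for T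
    unfolding openin_product_discrete
  proof (intro conjI ballI that(1))
    fix g assume "g \<in> T"
    from that(2)[OF this] obtain F where "finite F" "F \<subseteq> ?C"
      "\<forall>g'\<in>?E. (\<forall>x\<in>F. g' x = g x) \<longrightarrow> g' \<in> T" by (elim exE conjE)
    then show "\<exists>F. finite F \<and> F \<subseteq> ?C \<and> {g' \<in> ?E. \<forall>x\<in>F. g' x = g x} \<subseteq> T"
      by (intro exI[of _ F]) auto
  qed
  have "openin ?P T" if T: "T \<in> K" for T
  proof -
    consider "T = ?E" | x y where "x \<in> ?C" "y \<in> ?C" "T = A x y" | c x where "x \<in> ?C" "T = B c x"
      | x where "x \<in> ?C" "T = N x" | y where "y \<in> ?C" "T = S y"
      using T unfolding K_def by auto
    then show ?thesis
    proof cases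
      case 1
      then show ?thesis by (intro op) auto
    next
      case (2 x y)
      show ?thesis
      proof (rule op)
        fix g assume g: "g \<in> T"
        have "x + y \<in> ?C" using rat_vector.subspace_add[OF GS 2(1,2)] .
        then show "\<exists>F. finite F \<and> F \<subseteq> ?C \<and> (\<forall>g'\<in>?E. (\<forall>x\<in>F. g' x = g x) \<longrightarrow> g' \<in> T)"
          using g 2 by (intro exI[of _ "{x, y, x + y}"]) (simp add: A_def)
      qed (simp add: 2 A_def)
    next
      case (3 c x)
      show ?thesis
      proof (rule op)
        fix g assume g: "g \<in> T"
        have "c *\<^sub>Q x \<in> ?C" using rat_vector.subspace_scale[OF GS 3(1)] .
        then show "\<exists>F. finite F \<and> F \<subseteq> ?C \<and> (\<forall>g'\<in>?E. (\<forall>x\<in>F. g' x = g x) \<longrightarrow> g' \<in> T)"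
          using g 3 by (intro exI[of _ "{x, c *\<^sub>Q x}"]) (simp add: B_def)
      qed (simp add: 3 B_def)
    next
      case (4 x)
      show ?thesis
      proof (rule op)
        fix g assume g: "g \<in> T"
        then show "\<exists>F. finite F \<and> F \<subseteq> ?C \<and> (\<forall>g'\<in>?E. (\<forall>x\<in>F. g' x = g x) \<longrightarrow> g' \<in> T)"
          using 4 by (intro exI[of _ "{x}"]) (simp add: N_def)
      qed (simp add: 4 N_def)
    next
      case (5 y)
      show ?thesis
      proof (rule op)
        fix g assume "g \<in> T"
        then obtain x where "x \<in> ?C" "g x = y" using 5 by (auto simp: S_def)
        then show "\<exists>F. finite F \<and> F \<subseteq> ?C \<and> (\<forall>g'\<in>?E. (\<forall>x\<in>F. g' x = g x) \<longrightarrow> g' \<in> T)"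
          using 5 by (intro exI[of _ "{x}"]) (auto simp: S_def)
      qed (simp add: 5 S_def)
    qed
  qed
  then have "gdelta_in ?P T" if "T \<in> K" for T using that open_imp_gdelta_in by blast
  moreover have "countable K"
    unfolding K_def using cG
    by (intro countable_insert countable_Un countable_image countable_SIGMA) auto
  ultimately have "gdelta_in ?P (\<Inter>K)" by (intro gdelta_in_Inter) (auto simp: K_def)
  moreover have "\<Inter>K = carrier (isometry_group G)"
  proof (intro equalityI subsetI)
    fix g assume g: "g \<in> \<Inter>K"
    have gE: "g \<in> ?E" using g by (simp add: K_def)
    have mem: "g \<in> A x y" "g \<in> N x" "g \<in> S x" if "x \<in> ?C" "y \<in> ?C" for x y
      using g that by (auto simp: K_def)
    have memB: "g \<in> B c x" if "x \<in> ?C" for c x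
    proof -
      have "(\<lambda>(c, x). B c x) (c, x) \<in> K" unfolding K_def using that by blast
      then show ?thesis using g by simp
    qed
    have "isometric_embedding G G g"
    proof (rule isometric_embeddingI[OF nG])
      show "rat_linear_on ?C g" using mem(1) memB by (simp add: rat_linear_on_def A_def B_def)
      show "nrm G (g x) = nrm G x" if "x \<in> ?C" for x using mem(2)[OF that that] by (simp add: N_def)
    qed (use gE in auto)
    moreover have "g ` ?C = ?C" using gE mem(3) by (auto simp: S_def image_iff) metis
    ultimately show "g \<in> carrier (isometry_group G)"
      using gE by (auto simp: isometry_group_def Bij_def bij_betw_def surj_isometry_def
          isometric_embedding_def PiE_def)
  next
    fix g assume g: "g \<in> carrier (isometry_group G)"
    then have gE: "g \<in> ?E" using isometry_group_subset_PiE by blast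
    have s: "rat_linear_on ?C g" "\<And>x. x \<in> ?C \<Longrightarrow> nrm G (g x) = nrm G x" "g ` ?C = ?C"
      using g by (auto simp: isometry_group_def surj_isometry_def isometric_embedding_def)
    have "\<exists>x\<in>?C. g x = y" if "y \<in> ?C" for y using s(3) that by (metis imageE)
    then show "g \<in> \<Inter>K"
      using gE s by (auto simp: K_def A_def B_def N_def S_def rat_linear_on_def)
  qed
  moreover have "completely_metrizable_space ?P"
    unfolding completely_metrizable_space_product_topology
    using countable_subset[OF _ cG, of "{i \<in> ?C. \<not> (\<exists>a. topspace (discrete_topology ?C) \<subseteq> {a})}"]
    by (auto simp: completely_metrizable_space_discrete_topology)
  ultimately show ?thesis
    unfolding isometry_group_topology_def by (metis completely_metrizable_space_gdelta_in)
qed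

text \<open>Conjugacy in a form free of inverses, which carries the orbit of a vector
  \<open>w\<close> under \<open>h\<close> to the orbit of \<open>k w\<close> under
  \<open>g\<close>.\<close>

lemma conjugacy_class_isometry_groupD:
  assumes nG: "rat_normed_space G" and h: "h \<in> carrier (isometry_group G)"
    and g: "g \<in> conjugacy_class (isometry_group G) h"
  obtains k where "k \<in> carrier (isometry_group G)" "\<And>x. x \<in> carrier G \<Longrightarrow> g (k x) = k (h x)"
proof -
  interpret group "isometry_group G" by (rule group_isometry_group[OF nG])
  let ?I = "isometry_group G"
  obtain k where k: "k \<in> carrier ?I" "g = k \<otimes>\<^bsub>?I\<^esub> h \<otimes>\<^bsub>?I\<^esub> inv\<^bsub>?I\<^esub> k"
    using g h by (auto simp: conjugacy_class_def orbit_def)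
  have gk: "g \<otimes>\<^bsub>?I\<^esub> k = k \<otimes>\<^bsub>?I\<^esub> h" "g \<in> carrier ?I" using k h by (simp_all add: m_assoc)
  have mult: "(a \<otimes>\<^bsub>?I\<^esub> b) x = a (b x)" if "a \<in> carrier ?I" "b \<in> carrier ?I" "x \<in> carrier G" for a b x
    using that by (simp add: isometry_group_def BijGroup_def compose_eq)
  have "g (k x) = k (h x)" if "x \<in> carrier G" for x
    using mult[OF gk(2) k(1) that] mult[OF k(1) h that] gk(1) by simp
  then show thesis using that k(1) by blast
qed

section \<open>Realising extensions in the Gurarii space, and the category argument\<close>

context
  fixes G :: "'g::rat_vector rat_nspace"
  assumes G: "rational_gurarii_space G"
begin

text \<open>\<open>sys_space S\<close> embeds back into \<open>G\<close> over \<open>C\<close>,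
  where \<open>sys_map S\<close> becomes a finite partial isometry of \<open>G\<close>, and
  ultrahomogeneity extends that to \<open>g\<close>. As the embedding undoes \<open>\<alpha>\<close>
  on \<open>C\<close>, \<open>g\<close> extends \<open>f\<close> itself and the first
  \<open>N\<close> steps of the orbit of \<open>v\<close> are the image of \<open>y\<close>.\<close>

lemma gurarii_orbit_realization:
  assumes C: "is_subspace_of C G" "rat_finite_dim C" and V: "rat_vector.subspace V" "V \<subseteq> C"
    and f: "f ` V \<subseteq> C" and v: "v \<in> V"
    and S: "orbit_extension (G\<lparr>carrier := C\<rparr>) V f v N S \<alpha> y"
  shows "\<exists>g\<in>carrier (isometry_group G). (\<forall>x\<in>V. g x = f x) \<and>
    nrm G (\<Sum>i\<le>N. \<beta> i *\<^sub>Q (g ^^ i) v) = nrm (sys_space S) (\<Sum>i\<le>N. \<beta> i *\<^sub>Q y i)"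
proof -
  let ?D = "sys_space S" and ?P = "sys_dom S" and ?m = "sys_map S"
  have \<alpha>: "isometric_embedding (G\<lparr>carrier := C\<rparr>) ?D \<alpha>" "\<alpha> ` V \<subseteq> ?P"
    "\<And>a. a \<in> V \<Longrightarrow> \<alpha> (f a) = ?m (\<alpha> a)"
    and y: "y 0 = \<alpha> v" "\<And>i. i < N \<Longrightarrow> y i \<in> ?P \<and> ?m (y i) = y (Suc i)"
    and D: "?D \<in> polyhedral_class" and pm: "partial_isometry ?D ?P (sys_cod S) ?m"
    using S by (auto simp: orbit_extension_def isometry_systems_def)
  have CG: "C \<subseteq> carrier G" using C(1) by (simp add: is_subspace_of_def)
  have nG: "rat_normed_space G" by (rule gurarii_normed[OF G])
  have nD: "rat_normed_space ?D" "rat_finite_dim (carrier ?D)"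
    using D by (simp_all add: polyhedral_class_def polyhedral_space_def)
  note M = partial_isometryD[OF pm]
  have "isometric_embedding (G\<lparr>carrier := C\<rparr>) G (\<lambda>x. x)"
    using CG by (auto simp: isometric_embedding_def rat_linear_on_def inj_on_def)
  then obtain \<epsilon> where \<epsilon>: "isometric_embedding ?D G \<epsilon>" "\<And>x. x \<in> C \<Longrightarrow> \<epsilon> (\<alpha> x) = x"
    using gurarii_extension[OF G C D \<alpha>(1)] by metis
  note E = isometric_embeddingD[OF \<epsilon>(1)]
  define W where "W = \<epsilon> ` ?P"
  define q where "q = \<epsilon> \<circ> ?m \<circ> inv_into (carrier ?D) \<epsilon>"
  have q: "q (\<epsilon> x) = \<epsilon> (?m x)" if "x \<in> ?P" for x using E(3) M(2) that by (auto simp: q_def)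
  have lin: "rat_linear_on ?P \<epsilon>" using E(2) M(2) by (rule rat_linear_on_subset)
  have WG: "is_subspace_of W G"
    using subspace_image[OF lin M(1)] E(1) M(2) by (auto simp: W_def is_subspace_of_def)
  have me: "isometric_embedding (?D\<lparr>carrier := ?P\<rparr>) (?D\<lparr>carrier := sys_cod S\<rparr>) ?m"
    using pm by (simp add: partial_isometry_def surj_isometry_def)
  have 1: "isometric_embedding (G\<lparr>carrier := W\<rparr>) (?D\<lparr>carrier := ?P\<rparr>) (inv_into (carrier ?D) \<epsilon>)"
    unfolding W_def by (rule isometric_embedding_inv[OF nD(1) \<epsilon>(1) M(1,2)])
  have 2: "isometric_embedding (?D\<lparr>carrier := ?P\<rparr>) ?D ?m"
    using me M(4) by (rule isometric_embedding_into_supspace)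
  have "isometric_embedding (G\<lparr>carrier := W\<rparr>) G q"
    using isometric_embedding_compose[OF 1 isometric_embedding_compose[OF 2 \<epsilon>(1)]]
    by (simp add: q_def comp_assoc)
  moreover have "rat_finite_dim W"
    unfolding W_def using rat_finite_dim_image[OF lin _ M(1)] rat_finite_dim_subspace[OF nD(2) M(1,2)] by blast
  ultimately have "finite_partial_isometry G W q"
    using WG by (simp add: finite_partial_isometry_def[OF G])
  then obtain g where g: "g \<in> carrier (isometry_group G)" "\<And>x. x \<in> W \<Longrightarrow> g x = q x"
    using gurarii_ultrahomogeneous[OF G] by metis
  show ?thesis
  proof (intro bexI[OF _ g(1)] conjI ballI)
    show "g x = f x" if x: "x \<in> V" for x
    proof -
      have ax: "\<alpha> x \<in> ?P" using \<alpha>(2) x by blast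
      have "x = \<epsilon> (\<alpha> x)" using \<epsilon>(2) V(2) x by auto
      then have "x \<in> W" using ax by (simp add: W_def)
      then have "g x = q (\<epsilon> (\<alpha> x))" using g(2) \<open>x = \<epsilon> (\<alpha> x)\<close> by simp
      also have "\<dots> = \<epsilon> (\<alpha> (f x))" using q[OF ax] \<alpha>(3)[OF x] by simp
      also have "\<dots> = f x" using \<epsilon>(2) f x by auto
      finally show ?thesis .
    qed
    have orb: "(g ^^ i) v = \<epsilon> (y i) \<and> y i \<in> carrier ?D" if "i \<le> N" for i
      using that
    proof (induction i)
      case 0
      then show ?case using y(1) \<epsilon>(2) v V(2) isometric_embeddingD(1)[OF \<alpha>(1), of v] by auto
    next
      case (Suc i)
      have yi: "y i \<in> ?P" "?m (y i) = y (Suc i)" using y(2)[of i] Suc.prems by simp_all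
      have "?m (y i) \<in> sys_cod S" using imageI[OF yi(1), of ?m] unfolding M(6) .
      then have "y (Suc i) \<in> carrier ?D" unfolding yi(2) by (rule subsetD[OF M(4)])
      moreover have "\<epsilon> (y i) \<in> W" using yi(1) by (simp add: W_def)
      ultimately show ?case using Suc g(2) q[OF yi(1)] yi(2) by simp
    qed
    have nDS: "rat_vector.subspace (carrier ?D)" by (rule rat_normed_spaceD(1)[OF nD(1)])
    have m: "y i \<in> carrier ?D" if "i \<in> {..N}" for i using orb that by simp
    have m': "(\<Sum>i\<le>N. \<beta> i *\<^sub>Q y i) \<in> carrier ?D"
      using m by (intro rat_vector.subspace_sum[OF nDS] rat_vector.subspace_scale[OF nDS]) simp
    have "(\<Sum>i\<le>N. \<beta> i *\<^sub>Q (g ^^ i) v) = (\<Sum>i\<le>N. \<beta> i *\<^sub>Q \<epsilon> (y i))" using orb by (intro sum.cong) auto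
    also have "\<dots> = \<epsilon> (\<Sum>i\<le>N. \<beta> i *\<^sub>Q y i)" 
      using rat_linear_on_sum[OF E(2) nDS, where x = y and I = "{..N}" and c = \<beta>] m by simp
    finally show "nrm G (\<Sum>i\<le>N. \<beta> i *\<^sub>Q (g ^^ i) v) = nrm ?D (\<Sum>i\<le>N. \<beta> i *\<^sub>Q y i)"
      using E(4)[OF m'] by simp
  qed
qed

lemma gurarii_wandering_isometry:
  obtains v g where "v \<in> carrier G" "g \<in> carrier (isometry_group G)" "wandering_vector G v (g v)"
proof -
  obtain X V W f v where X: "X \<in> polyhedral_class" "partial_isometry X V W f" "v \<in> V"
    "wandering_vector X v (f v)" by (rule wandering_partial_isometry)
  note F = partial_isometryD[OF X(2)]
  have nX: "rat_normed_space X" "rat_finite_dim (carrier X)"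
    using X(1) by (simp_all add: polyhedral_class_def polyhedral_space_def)
  have vX: "v \<in> carrier X" "f v \<in> carrier X" using X(3) F(2,4,6) by auto
  obtain h where h: "isometric_embedding X G h" by (rule gurarii_contains_copy[OF G X(1)])
  note H = isometric_embeddingD[OF h]
  have lin: "rat_linear_on V h" using H(2) F(2) by (rule rat_linear_on_subset)
  have fe: "isometric_embedding (X\<lparr>carrier := V\<rparr>) (X\<lparr>carrier := W\<rparr>) f"
    using X(2) by (simp add: partial_isometry_def surj_isometry_def)
  have 1: "isometric_embedding (G\<lparr>carrier := h ` V\<rparr>) (X\<lparr>carrier := V\<rparr>) (inv_into (carrier X) h)"
    by (rule isometric_embedding_inv[OF nX(1) h F(1,2)])
  have 2: "isometric_embedding (X\<lparr>carrier := V\<rparr>) X f"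
    using fe F(4) by (rule isometric_embedding_into_supspace)
  have "isometric_embedding (G\<lparr>carrier := h ` V\<rparr>) G (h \<circ> f \<circ> inv_into (carrier X) h)"
    using isometric_embedding_compose[OF 1 isometric_embedding_compose[OF 2 h]] by (simp add: comp_assoc)
  moreover have "rat_finite_dim (h ` V)"
    using rat_finite_dim_image[OF lin _ F(1)] rat_finite_dim_subspace[OF nX(2) F(1,2)] by blast
  ultimately have "finite_partial_isometry G (h ` V) (h \<circ> f \<circ> inv_into (carrier X) h)"
    using subspace_image[OF lin F(1)] H(1) F(2)
    by (auto simp: finite_partial_isometry_def[OF G] is_subspace_of_def)
  then obtain g where g: "g \<in> carrier (isometry_group G)"
    "\<And>x. x \<in> h ` V \<Longrightarrow> g x = (h \<circ> f \<circ> inv_into (carrier X) h) x"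
    using gurarii_ultrahomogeneous[OF G] by metis
  have "g (h v) = h (f v)" using g(2)[of "h v"] X(3) H(3) vX(1) by simp
  then have "wandering_vector G (h v) (g (h v))"
    using wandering_vector_isometric[OF nX(1) h vX X(4)] by simp
  then show thesis using that H(1)[OF vX(1)] g(1) by blast
qed

text \<open>The conjugating element may be any member of the group, but the norms along the orbit of
  \<open>v\<close> depend only on the vector \<open>w\<close> that it sends to \<open>v\<close>. As
  \<open>carrier G\<close> is countable, this cuts the part of the class in \<open>O0\<close> into
  countably many pieces, and Baire's theorem leaves one of them dense in a nonempty open
  set.\<close>

lemma isometry_group_no_comeager_conjugacy_class:
  assumes h: "h \<in> carrier (isometry_group G)"
  shows "\<not> comeager_in (isometry_group_topology G) (conjugacy_class (isometry_group G) h)"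
proof
  let ?T = "isometry_group_topology G" and ?A = "carrier (isometry_group G)"
  let ?Cl = "conjugacy_class (isometry_group G) h"
  assume "comeager_in ?T ?Cl"
  then obtain F where F: "countable F" "\<And>N. N \<in> F \<Longrightarrow> nowhere_dense_in ?T N" "?A - ?Cl = \<Union>F"
    by (auto simp: comeager_in_def meager_in_def topspace_isometry_group_topology)
  have nG: "rat_normed_space G" and cG: "countable (carrier G)"
    using gurarii_normed[OF G] gurarii_countable[OF G] .
  note GS = rat_normed_spaceD(1)[OF nG]
  have AD: "isometric_embedding G G k" "k ` carrier G = carrier G" if "k \<in> ?A" for k
    using that by (simp_all add: isometry_group_carrier[OF G] surj_isometry_def)
  obtain v g0 where v: "v \<in> carrier G" and g0: "g0 \<in> ?A" and wv: "wandering_vector G v (g0 v)"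
    by (rule gurarii_wandering_isometry)
  \<comment> \<open>Prescribing the value at \<open>v\<close> keeps \<open>v\<close> wandering for
    every element of this open set.\<close>
  define O0 where "O0 = {g \<in> ?A. \<forall>x\<in>{v}. g x = g0 x}"
  have O0: "openin ?T O0" unfolding O0_def using v by (intro openin_isometry_group_agree) auto
  \<comment> \<open>The elements \<open>k h k\<^sup>-\<^sup>1\<close> with \<open>k w = v\<close>. On such a set the norms of all combinations of the orbit of
    \<open>v\<close> are constant, because \<open>k\<close> carries the orbit of \<open>w\<close> under \<open>h\<close> to it.\<close>
  define Cw where "Cw w = {g \<in> O0. \<exists>k\<in>?A. k w = v \<and> (\<forall>x\<in>carrier G. g (k x) = k (h x))}" for w
  have Cw_top: "Cw w \<subseteq> topspace ?T" for w
    by (auto simp: Cw_def O0_def topspace_isometry_group_topology)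
  have "\<exists>w\<in>carrier G. ?T interior_of (?T closure_of Cw w) \<noteq> {}"
  proof (rule ccontr)
    assume *: "\<not> ?thesis"
    let ?K = "(\<lambda>N. ?T closure_of N) ` (F \<union> Cw ` carrier G)"
    have "?T interior_of \<Union>?K = {}"
    proof (rule Baire_category_alt)
      show "completely_metrizable_space ?T \<or> locally_compact_space ?T \<and> regular_space ?T"
        using completely_metrizable_isometry_group[OF nG cG] by blast
      show "countable ?K" using F(1) cG by (intro countable_image countable_Un)
      show "closedin ?T T \<and> ?T interior_of T = {}" if "T \<in> ?K" for T
        using that * F(2) by (auto simp: nowhere_dense_in_def)
    qed
    moreover have "O0 \<subseteq> \<Union>?K"
    proof
      fix g assume g: "g \<in> O0"
      show "g \<in> \<Union>?K"
      proof (cases "g \<in> ?Cl")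
        case True
        obtain k where k: "k \<in> ?A" "\<And>x. x \<in> carrier G \<Longrightarrow> g (k x) = k (h x)"
          using conjugacy_class_isometry_groupD[OF nG h True] by blast
        have "v \<in> k ` carrier G" using AD(2)[OF k(1)] v by simp
        then obtain w where w: "w \<in> carrier G" "k w = v" by blast
        have "g \<in> Cw w" using g k w(2) by (auto simp: Cw_def)
        then have "g \<in> ?T closure_of Cw w" using closure_of_subset[OF Cw_top] by blast
        then show ?thesis using w(1) by blast
      next
        case False
        then have "g \<in> \<Union>F" using g F(3) by (auto simp: O0_def)
        then obtain N where N: "N \<in> F" "g \<in> N" by blast
        then have "N \<subseteq> topspace ?T" using F(2) by (simp add: nowhere_dense_in_def)
        then have "g \<in> ?T closure_of N" using closure_of_subset N(2) by blast
        then show ?thesis using N(1) by blast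
      qed
    qed
    then have "O0 \<subseteq> ?T interior_of \<Union>?K" using O0 by (simp add: interior_of_maximal)
    moreover have "g0 \<in> O0" using g0 by (simp add: O0_def)
    ultimately show False by blast
  qed
  then obtain w where w: "w \<in> carrier G" and ne: "?T interior_of (?T closure_of Cw w) \<noteq> {}" by blast
  define Op where "Op = ?T interior_of (?T closure_of Cw w)"
  have Op: "openin ?T Op" "Op \<noteq> {}" "Op \<subseteq> ?T closure_of Cw w"
    using ne by (simp_all add: Op_def interior_of_subset)
  have meet: "\<exists>g\<in>Cw w. g \<in> B" if B: "openin ?T B" "g \<in> B" "g \<in> Op" for B g
  proof -
    have "g \<in> ?T closure_of Cw w" using Op(3) B(3) by (rule subsetD)
    then show ?thesis using B(1,2) unfolding in_closure_of by blast
  qed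
  obtain g1 where g1: "g1 \<in> Cw w" "g1 \<in> Op" using Op(1,2) meet by blast
  have g1A: "g1 \<in> ?A" "g1 v = g0 v" using g1(1) by (auto simp: Cw_def O0_def)
  obtain F0 where F0: "finite F0" "F0 \<subseteq> carrier G" "{g \<in> ?A. \<forall>x\<in>F0. g x = g1 x} \<subseteq> Op"
    using Op(1) g1(2) unfolding openin_isometry_group by blast
  \<comment> \<open>\<open>V\<close> contains the points that decide membership in
    \<open>Op\<close>, so every element of the group agreeing with \<open>g1\<close> on
    \<open>V\<close> stays in \<open>Op\<close>. The space \<open>C\<close> also holds the images,
    making \<open>g1\<close> on \<open>V\<close> a partial isometry of a finite-dimensional
    space.\<close>
  define B where "B = insert v F0"
  define V where "V = rat_vector.span B"
  define C where "C = rat_vector.span (B \<union> g1 ` B)"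
  note G1 = isometric_embeddingD[OF AD(1)[OF g1A(1)]]
  have BG: "B \<subseteq> carrier G" using v F0(2) by (simp add: B_def)
  have VG: "V \<subseteq> carrier G" unfolding V_def using BG GS by (rule rat_vector.span_minimal)
  have CG: "C \<subseteq> carrier G"
    unfolding C_def using BG G1(1) GS by (intro rat_vector.span_minimal) auto
  have C: "is_subspace_of C G" using CG by (simp add: is_subspace_of_def C_def rat_vector.subspace_span)
  have fC: "rat_finite_dim C" unfolding C_def using F0(1) by (intro rat_finite_dim_span) (simp add: B_def)
  have VC: "V \<subseteq> C" unfolding V_def C_def by (rule rat_vector.span_mono) simp
  have VS: "rat_vector.subspace V" by (simp add: V_def rat_vector.subspace_span)
  have lin: "rat_linear_on V g1" using G1(2) VG by (rule rat_linear_on_subset)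
  have g1V: "g1 ` V \<subseteq> C"
    unfolding C_def by (rule span_image_subset[OF lin V_def[symmetric]]) (auto intro: rat_vector.span_base)
  have vV: "v \<in> V" by (simp add: V_def B_def rat_vector.span_base)
  let ?X = "G\<lparr>carrier := C\<rparr>"
  have nX: "rat_normed_space ?X" using nG C by (rule rat_normed_space_restrict)
  have pX: "polyhedral_space ?X"
  proof -
    obtain X k where X: "X \<in> polyhedral_class" "surj_isometry ?X X k"
      by (rule gurarii_subspace_copy[OF G C fC])
    then show ?thesis
      using polyhedral_space_pullback[OF nX] fC by (auto simp: polyhedral_class_def surj_isometry_def)
  qed
  have pi: "partial_isometry ?X V (g1 ` V) g1"
    using VC g1V G1(4) VG lin VS by (intro partial_isometryI[OF nX]) auto
  have wX: "wandering_vector ?X v (g1 v)" using wv g1A(2) by (simp add: wandering_vector_def)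
  obtain N \<beta> S\<^sub>1 \<alpha>\<^sub>1 y\<^sub>1 S\<^sub>2 \<alpha>\<^sub>2 y\<^sub>2 where
    S1: "orbit_extension ?X V g1 v N S\<^sub>1 \<alpha>\<^sub>1 y\<^sub>1" and S2: "orbit_extension ?X V g1 v N S\<^sub>2 \<alpha>\<^sub>2 y\<^sub>2" and
    neq: "nrm (sys_space S\<^sub>1) (\<Sum>i\<le>N. \<beta> i *\<^sub>Q y\<^sub>1 i) \<noteq> nrm (sys_space S\<^sub>2) (\<Sum>i\<le>N. \<beta> i *\<^sub>Q y\<^sub>2 i)"
    using orbit_norm_not_determined[OF pX pi vV wX] by (elim exE conjE)
  have const: "nrm (sys_space S) (\<Sum>i\<le>N. \<beta> i *\<^sub>Q y i) = nrm G (\<Sum>i\<le>N. \<beta> i *\<^sub>Q (h ^^ i) w)"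
    if S: "orbit_extension ?X V g1 v N S \<alpha> y" for S \<alpha> y
  proof -
    obtain g where g: "g \<in> ?A" "\<forall>x\<in>V. g x = g1 x"
      "nrm G (\<Sum>i\<le>N. \<beta> i *\<^sub>Q (g ^^ i) v) = nrm (sys_space S) (\<Sum>i\<le>N. \<beta> i *\<^sub>Q y i)"
      using gurarii_orbit_realization[OF C fC VS VC g1V vV S, of \<beta>] by (elim bexE conjE)
    have "F0 \<subseteq> V" unfolding V_def B_def using rat_vector.span_superset[of "insert v F0"] by blast
    then have gO: "g \<in> Op" using g(1,2) F0(3) by blast
    have orbG: "(k ^^ i) x \<in> carrier G" if "k \<in> ?A" "x \<in> carrier G" for k i x
      using isometric_embeddingD(1)[OF AD(1)[OF that(1)]] that(2) by (induction i) auto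
    \<comment> \<open>Agreement with \<open>g\<close> at these finitely many orbit points is an open
      condition and forces equal orbits up to exponent \<open>N\<close>, so \<open>g\<close> can be
      replaced by an element of the dense piece \<open>Cw w\<close>.\<close>
    let ?F = "(\<lambda>i. (g ^^ i) v) ` {..N}"
    let ?Nb = "{g' \<in> ?A. \<forall>x\<in>?F. g' x = g x}"
    have "openin ?T ?Nb" using orbG[OF g(1) v] by (intro openin_isometry_group_agree) auto
    moreover have "g \<in> ?Nb" using g(1) by simp
    ultimately obtain g' where g': "g' \<in> Cw w" "g' \<in> ?Nb" using meet gO by blast
    have same: "(g' ^^ i) v = (g ^^ i) v" if "i \<le> N" for i
      using that
    proof (induction i)
      case (Suc i)
      then show ?case using g'(2) by simp
    qed simp
    obtain k where k: "k \<in> ?A" "k w = v" "\<And>x. x \<in> carrier G \<Longrightarrow> g' (k x) = k (h x)"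
      using g'(1) by (auto simp: Cw_def)
    have conj: "(g' ^^ i) v = k ((h ^^ i) w)" for i
      using k orbG[OF h w] by (induction i) auto
    note K = isometric_embeddingD[OF AD(1)[OF k(1)]]
    have "(\<Sum>i\<le>N. \<beta> i *\<^sub>Q (g ^^ i) v) = (\<Sum>i\<le>N. \<beta> i *\<^sub>Q k ((h ^^ i) w))"
      using same conj by (intro sum.cong) auto
    also have "\<dots> = k (\<Sum>i\<le>N. \<beta> i *\<^sub>Q (h ^^ i) w)"
      using rat_linear_on_sum[OF K(2) GS, where x = "\<lambda>i. (h ^^ i) w" and I = "{..N}" and c = \<beta>]
        orbG[OF h w] by simp
    finally have "nrm G (\<Sum>i\<le>N. \<beta> i *\<^sub>Q (g ^^ i) v) = nrm G (\<Sum>i\<le>N. \<beta> i *\<^sub>Q (h ^^ i) w)"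
      using K(4)[of "\<Sum>i\<le>N. \<beta> i *\<^sub>Q (h ^^ i) w"] orbG[OF h w]
      by (simp add: rat_vector.subspace_sum[OF GS] rat_vector.subspace_scale[OF GS])
    then show ?thesis using g(3) by simp
  qed
  show False using neq const[OF S1] const[OF S2] by simp
qed

end

theorem theorem4p4:
  shows "\<not> one_hrushovski_property polyhedral_class \<and>
    \<not> weak_amalgamation_property (isometry_systems polyhedral_class) system_embedding
        (\<lambda>S. carrier (sys_space S)) \<and>
    (\<forall>G :: 'g::rat_vector rat_nspace. rational_gurarii_space G \<longrightarrow>
      \<not> (\<exists>h \<in> carrier (isometry_group G).
            comeager_in (isometry_group_topology G) (conjugacy_class (isometry_group G) h)))"
  using not_one_hrushovski not_weak_amalgamation isometry_group_no_comeager_conjugacy_class by blast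

end
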